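(* Let $n,N\ge1$ be integers and, for $j=1,\dots,n$, let $c_j\in C^\infty(\mathbb{T}^1;\mathbb{C})$ and let $P_j(D_x)$ be a pseudo-differential operator on $\mathbb{T}^N$ with toroidal symbol $p_j\in S^{m_j}(\mathbb{Z}^N)$, $m_j\in\mathbb{R}$. Let $\mathbb{L}$ be the system on $\mathbb{T}^{n+N}$ given by $L_j=D_{t_j}+c_j(t_j)P_j(D_x)$, $j=1,\dots,n$, and let $\mathbb{L}_0$ be the constant coefficient system $L_{j0}=D_{t_j}+c_{j0}P_j(D_x)$, $j=1,\dots,n$, where $c_{j0}=(2\pi)^{-1}\int_0^{2\pi}c_j(s)\,ds$. If $\mathbb{L}$ is globally hypoelliptic, then $\mathbb{L}_0$ is also globally hypoelliptic.
   Context: $\mathbb{T}^d=(\mathbb{R}/2\pi\mathbb{Z})^d$, with variables $(t,x)=(t_1,\dots,t_n,x_1,\dots,x_N)\in\mathbb{T}^{n+N}$, and $D_{t_j}=i^{-1}\partial_{t_j}$. The class $S^{m}(\mathbb{Z}^N)$ of toroidal symbols of order $m$ consists of functions $p:\mathbb{Z}^N\to\mathbb{C}$ such that for every multi-index $\alpha$ there is $C_\alpha>0$ with $|\Delta_\xi^\alpha p(\xi)|\le C_\alpha(1+\|\xi\|)^{m-|\alpha|}$ for all $\xi$, where $\Delta_\xi^\alpha$ are the forward difference operators; in particular $|p(\xi)|\le C(1+\|\xi\|)^m$. The operator with symbol $p$ is $P(D_x)u(x)=\sum_{\xi\in\mathbb{Z}^N}e^{ix\cdot\xi}p(\xi)\widehat{u}(\xi)$,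 where $\widehat{u}(\xi)$ are the Fourier coefficients; it acts in the $x$ variables on functions and distributions on $\mathbb{T}^{n+N}$. A system $L_1,\dots,L_n$ on $\mathbb{T}^{n+N}$ is globally hypoelliptic if the conditions $u\in\mathcal{D}'(\mathbb{T}^{n+N})$ and $L_ju\in C^\infty(\mathbb{T}^{n+N})$ for all $j\in\{1,\dots,n\}$ imply $u\in C^\infty(\mathbb{T}^{n+N})$. *)

theory Defs
  imports "HOL-Analysis.Analysis"
begin

section \<open>Smooth functions on the torus\<close>

text \<open>
  Functions on the torus $(R/2\pi Z)^d$ are functions on a Euclidean space of dimension $d$ that
  are $2\pi$-periodic in every coordinate. The space \<^typ>\<open>real\<close> gives the circle, and
  \<open>(real^'n) \<times> (real^'N)\<close> gives the torus with variables \<open>(t, x)\<close>.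
\<close>

definition partial_deriv :: "'a::euclidean_space \<Rightarrow> ('a \<Rightarrow> complex) \<Rightarrow> 'a \<Rightarrow> complex" where
  "partial_deriv b f x = vector_derivative (\<lambda>s. f (x + s *\<^sub>R b)) (at 0)"

text \<open>
  A multi-index is encoded as a list of coordinate directions, direction \<open>b\<close> occurring as often
  as it is differentiated; the order of the multi-index is the length of the list. If every
  iterated partial derivative is (Frechet) differentiable, then all of them are continuous.
\<close>

definition smooth_torus :: "('a::euclidean_space \<Rightarrow> complex) set" where
  "smooth_torus = {f. (\<forall>x. \<forall>b\<in>Basis. f (x + (2 * pi) *\<^sub>R b) = f x) \<and>
     (\<forall>bs. set bs \<subseteq> Basis \<longrightarrow> (\<forall>x. fold partial_deriv bs f differentiable (at x)))}"

definition torus_integral :: "('a::euclidean_space \<Rightarrow> complex) \<Rightarrow> complex" where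
  "torus_integral f = integral (cbox 0 (\<Sum>b\<in>Basis. (2 * pi) *\<^sub>R b)) f"

section \<open>Distributions on the torus\<close>

text \<open>
  A distribution is a linear functional on \<^const>\<open>smooth_torus\<close> that is continuous for the
  topology given by the norms \<open>torus_Ck_norm k\<close>. Its values outside \<^const>\<open>smooth_torus\<close>
  are irrelevant.
\<close>

type_synonym 'a functional = "('a \<Rightarrow> complex) \<Rightarrow> complex"

definition torus_Ck_norm :: "nat \<Rightarrow> ('a::euclidean_space \<Rightarrow> complex) \<Rightarrow> real" where
  "torus_Ck_norm k f =
     (\<Sum>bs | set bs \<subseteq> Basis \<and> length bs \<le> k. SUP x. cmod (fold partial_deriv bs f x))"

definition torus_distribution :: "('a::euclidean_space) functional \<Rightarrow> bool" where
  "torus_distribution u \<longleftrightarrow>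
     (\<forall>\<phi>\<in>smooth_torus. \<forall>\<psi>\<in>smooth_torus. u (\<lambda>x. \<phi> x + \<psi> x) = u \<phi> + u \<psi>) \<and>
     (\<forall>a. \<forall>\<phi>\<in>smooth_torus. u (\<lambda>x. a * \<phi> x) = a * u \<phi>) \<and>
     (\<exists>C k. \<forall>\<phi>\<in>smooth_torus. cmod (u \<phi>) \<le> C * torus_Ck_norm k \<phi>)"

text \<open>A function \<open>f\<close> is identified with the distribution mapping \<open>\<phi>\<close> to the integral of \<open>f \<phi>\<close>.\<close>

definition smooth_distribution :: "('a::euclidean_space) functional \<Rightarrow> bool" where
  "smooth_distribution u \<longleftrightarrow>
     (\<exists>f\<in>smooth_torus. \<forall>\<phi>\<in>smooth_torus. u \<phi> = torus_integral (\<lambda>x. f x * \<phi> x))"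

definition distr_mult :: "('a \<Rightarrow> complex) \<Rightarrow> 'a functional \<Rightarrow> 'a functional" where
  "distr_mult c u \<phi> = u (\<lambda>x. c x * \<phi> x)"

definition distr_deriv :: "'a::euclidean_space \<Rightarrow> 'a functional \<Rightarrow> 'a functional" where
  "distr_deriv b u \<phi> = - u (partial_deriv b \<phi>)"

definition globally_hypoelliptic ::
  "('j \<Rightarrow> ('a::euclidean_space) functional \<Rightarrow> 'a functional) \<Rightarrow> bool" where
  "globally_hypoelliptic L \<longleftrightarrow>
     (\<forall>u. torus_distribution u \<longrightarrow> (\<forall>j. smooth_distribution (L j u)) \<longrightarrow> smooth_distribution u)"

section \<open>Toroidal symbols\<close>

definition real_vec :: "int ^ 'N \<Rightarrow> real ^ 'N" where
  "real_vec \<xi> = (\<chi> k. real_of_int (\<xi> $ k))"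

definition forward_diff :: "'N::finite \<Rightarrow> (int ^ 'N \<Rightarrow> complex) \<Rightarrow> int ^ 'N \<Rightarrow> complex" where
  "forward_diff k p \<xi> = p (\<xi> + axis k 1) - p \<xi>"

text \<open>As above, a multi-index is a list of coordinates; forward differences commute.\<close>

definition toroidal_symbols :: "real \<Rightarrow> (int ^ 'N::finite \<Rightarrow> complex) set" where
  "toroidal_symbols m = {p. \<forall>\<alpha>. \<exists>C>0. \<forall>\<xi>.
     cmod (fold forward_diff \<alpha> p \<xi>) \<le> C * (1 + norm (real_vec \<xi>)) powr (m - real (length \<alpha>))}"

section \<open>Pseudo-differential operators in the variables $x$\<close>

text \<open>
  The partial Fourier coefficient \<open>partial_fourier u \<xi>\<close> is the distribution in \<open>t\<close> that, for a
  function \<open>u\<close>, is given by $(2\pi)^{-N} \int u(t,x) e^{-i x\cdot\xi} dx$.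
\<close>

definition partial_fourier ::
  "((real ^ 'n::finite) \<times> (real ^ 'N::finite)) functional \<Rightarrow> int ^ 'N \<Rightarrow> (real ^ 'n) functional" where
  "partial_fourier u \<xi> \<psi> =
     u (\<lambda>(t, x). \<psi> t * cis (- (x \<bullet> real_vec \<xi>))) / complex_of_real ((2 * pi) ^ CARD('N))"

text \<open>The distribution $e^{i x\cdot\xi} v(t)$ for a distribution \<open>v\<close> in the variables \<open>t\<close>:\<close>

definition exp_tensor ::
  "int ^ 'N::finite \<Rightarrow> (real ^ 'n::finite) functional \<Rightarrow> ((real ^ 'n) \<times> (real ^ 'N)) functional" where
  "exp_tensor \<xi> v \<phi> = v (\<lambda>t. torus_integral (\<lambda>x. cis (x \<bullet> real_vec \<xi>) * \<phi> (t, x)))"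

text \<open>
  The series is understood in the sense of distributions. For a distribution \<open>u\<close>, a symbol \<open>p\<close>
  and a test function \<open>\<phi>\<close> it converges absolutely, since the factors from \<open>u\<close> and \<open>p\<close> grow at
  most polynomially in \<open>\<xi>\<close> and the Fourier coefficients of \<open>\<phi>\<close> decay rapidly.
\<close>

definition psi_op ::
  "(int ^ 'N \<Rightarrow> complex) \<Rightarrow> ((real ^ 'n::finite) \<times> (real ^ 'N::finite)) functional
     \<Rightarrow> ((real ^ 'n) \<times> (real ^ 'N)) functional" where
  "psi_op p u \<phi> = (\<Sum>\<^sub>\<infinity>\<xi>. p \<xi> * exp_tensor \<xi> (partial_fourier u \<xi>) \<phi>)"

text \<open>The operators $L_j = D_{t_j} + c_j(t_j) P_j(D_x)$ with $D_{t_j} = i^{-1} \partial_{t_j}$:\<close>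

definition system_op ::
  "('n \<Rightarrow> real \<Rightarrow> complex) \<Rightarrow> ('n \<Rightarrow> int ^ 'N \<Rightarrow> complex) \<Rightarrow> 'n::finite
     \<Rightarrow> ((real ^ 'n) \<times> (real ^ 'N::finite)) functional \<Rightarrow> ((real ^ 'n) \<times> (real ^ 'N)) functional" where
  "system_op c p j u \<phi> =
     inverse \<i> * distr_deriv (axis j 1, 0) u \<phi> + distr_mult (\<lambda>(t, x). c j (t $ j)) (psi_op (p j) u) \<phi>"

definition mean_coeff :: "(real \<Rightarrow> complex) \<Rightarrow> complex" where
  "mean_coeff c = integral {0..2 * pi} c / complex_of_real (2 * pi)"

end

theory Submission
  imports Defs
begin

text \<open>
  The proof is by contraposition: from a singular solution of the averaged system a singular solution
  of the system with variable coefficients is built, by conjugating plane waves that are nearly annihilated.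

  Suppose that a distribution \<open>u\<close> is not smooth, although all \<open>L\<^sub>j\<^sub>0 u\<close> are. Write \<open>u'\<close> for its Fourier
  coefficients. Then \<open>(\<tau>\<^sub>j + c\<^sub>j\<^sub>0 p\<^sub>j(\<xi>)) * u'(\<tau>, \<xi>)\<close> decays rapidly, whereas \<open>u'(\<tau>, \<xi>)\<close> does not. Therefore
  there is a sequence of frequencies \<open>(\<tau>\<^sup>k, \<xi>\<^sup>k)\<close> with \<open>\<bar>\<xi>\<^sup>k\<bar> \<ge> 2 ^ k\<close> at which, for every \<open>j\<close>, the number
  \<open>\<epsilon>\<^sub>j\<^sub>k = \<tau>\<^sup>k\<^sub>j + c\<^sub>j\<^sub>0 p\<^sub>j(\<xi>\<^sup>k)\<close> is at most the \<open>k\<close>-th inverse power of the size of the frequency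
  (\<open>resonance_sequence\<close>).

  Let \<open>\<gamma>\<^sub>j\<close> be a periodic antiderivative of \<open>c\<^sub>j - c\<^sub>j\<^sub>0\<close>. The functions
  \<open>E\<^sub>k(t, x) = exp (- \<i> * (\<Sum>j. p\<^sub>j(\<xi>\<^sup>k) * \<gamma>\<^sub>j(t\<^sub>j))) * exp (\<i> * (\<tau>\<^sup>k \<bullet> t + \<xi>\<^sup>k \<bullet> x))\<close>, divided by the maximum of
  their moduli, satisfy \<open>L\<^sub>j E\<^sub>k = \<epsilon>\<^sub>j\<^sub>k E\<^sub>k\<close> exactly, and their derivatives grow at most polynomially in the
  frequency (\<open>quasimode_family\<close>). The sum of all \<open>E\<^sub>k\<close> is a distribution, because pairing with a test
  function allows integration by parts in \<open>x\<close>. It is mapped by every \<open>L\<^sub>j\<close> to the series of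
  the \<open>\<epsilon>\<^sub>j\<^sub>k E\<^sub>k\<close>, which converges with all derivatives (\<open>smooth_summable_resonant\<close>). But it is not smooth: its partial
  Fourier coefficient at \<open>\<xi>\<^sup>k\<close> has maximum modulus \<open>1\<close> (\<open>not_smooth_superposition\<close>). This contradicts
  the hypoellipticity of the \<open>L\<^sub>j\<close>.

  The passage between distributions and Fourier coefficients rests on two facts about the torus. A
  continuous function with vanishing Fourier coefficients is zero (\<open>fourier_uniqueness\<close>), and a
  distribution with rapidly decaying Fourier coefficients is smooth
  (\<open>smooth_distribution_if_rapidly_decaying\<close>).
\<close>

section \<open>Smooth functions on the torus\<close>

text \<open>
  Periodicity is needed for real-valued functions too, because suprema are taken over moduli.
\<close>

definition torus_periodic :: "('a::euclidean_space \<Rightarrow> 'b) \<Rightarrow> bool" where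
  "torus_periodic f \<longleftrightarrow> (\<forall>x. \<forall>b\<in>Basis. f (x + (2 * pi) *\<^sub>R b) = f x)"

lemma torus_periodicD: "torus_periodic f \<Longrightarrow> b \<in> Basis \<Longrightarrow> f (x + (2 * pi) *\<^sub>R b) = f x"
  by (simp add: torus_periodic_def)

lemma partial_deriv_eq:
  assumes "(f has_derivative f') (at x)"
  shows "partial_deriv b f x = f' b"
proof -
  have lin: "bounded_linear f'" using assms by (rule has_derivative_bounded_linear)
  have "((\<lambda>s::real. x + s *\<^sub>R b) has_derivative (\<lambda>s. s *\<^sub>R b)) (at 0)"
    by (auto intro!: derivative_eq_intros)
  then have "((\<lambda>s. f (x + s *\<^sub>R b)) has_derivative (\<lambda>s. f' (s *\<^sub>R b))) (at 0)"
    using has_derivative_compose[of "\<lambda>s::real. x + s *\<^sub>R b" "\<lambda>s. s *\<^sub>R b" 0 UNIV f f'] assms by simp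
  then have "((\<lambda>s. f (x + s *\<^sub>R b)) has_vector_derivative f' b) (at 0)"
    by (simp add: has_vector_derivative_def linear_simps(5)[OF lin])
  then show ?thesis unfolding partial_deriv_def by (rule vector_derivative_at)
qed

lemma has_derivative_partial_deriv:
  fixes f :: "'a::euclidean_space \<Rightarrow> complex"
  assumes "f differentiable (at x)"
  shows "(f has_derivative (\<lambda>h. \<Sum>b\<in>Basis. (h \<bullet> b) *\<^sub>R partial_deriv b f x)) (at x)"
proof -
  let ?f' = "frechet_derivative f (at x)"
  have d: "(f has_derivative ?f') (at x)" using assms frechet_derivative_works by blast
  have lin: "linear ?f'" using d has_derivative_linear by blast
  have "?f' = (\<lambda>h. \<Sum>b\<in>Basis. (h \<bullet> b) *\<^sub>R partial_deriv b f x)"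
  proof
    fix h
    have "?f' h = ?f' (\<Sum>b\<in>Basis. (h \<bullet> b) *\<^sub>R b)" by (simp add: euclidean_representation)
    also have "\<dots> = (\<Sum>b\<in>Basis. (h \<bullet> b) *\<^sub>R ?f' b)" using lin by (simp add: linear_sum linear_cmul)
    finally show "?f' h = (\<Sum>b\<in>Basis. (h \<bullet> b) *\<^sub>R partial_deriv b f x)"
      using partial_deriv_eq[OF d] by simp
  qed
  with d show ?thesis by simp
qed

lemma has_vector_derivative_partial_deriv:
  fixes f :: "'a::euclidean_space \<Rightarrow> complex"
  assumes "f differentiable (at (x + s *\<^sub>R b))"
  shows "((\<lambda>s. f (x + s *\<^sub>R b)) has_vector_derivative partial_deriv b f (x + s *\<^sub>R b)) (at s)"
proof -
  let ?f' = "frechet_derivative f (at (x + s *\<^sub>R b))"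
  have d: "(f has_derivative ?f') (at (x + s *\<^sub>R b))" using assms frechet_derivative_works by blast
  have lin: "bounded_linear ?f'" using d by (rule has_derivative_bounded_linear)
  have "((\<lambda>s::real. x + s *\<^sub>R b) has_derivative (\<lambda>s. s *\<^sub>R b)) (at s)"
    by (auto intro!: derivative_eq_intros)
  then have "((\<lambda>s. f (x + s *\<^sub>R b)) has_derivative (\<lambda>s. ?f' (s *\<^sub>R b))) (at s)"
    using has_derivative_compose[of "\<lambda>s::real. x + s *\<^sub>R b" "\<lambda>s. s *\<^sub>R b" s UNIV f ?f'] d by simp
  then show ?thesis
    by (simp add: has_vector_derivative_def linear_simps(5)[OF lin] partial_deriv_eq[OF d])
qed

lemma smooth_torus_iff:
  "f \<in> smooth_torus \<longleftrightarrow> torus_periodic f \<and>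
     (\<forall>bs. set bs \<subseteq> Basis \<longrightarrow> (\<forall>x. fold partial_deriv bs f differentiable (at x)))"
  by (auto simp: smooth_torus_def torus_periodic_def)

lemma smooth_torus_periodic: "f \<in> smooth_torus \<Longrightarrow> torus_periodic f"
  by (simp add: smooth_torus_iff)

lemma smooth_torus_differentiable: "f \<in> smooth_torus \<Longrightarrow> f differentiable (at x)"
  unfolding smooth_torus_iff by (metis empty_set empty_subsetI fold_simps(1))

lemma smooth_torus_continuous: "f \<in> smooth_torus \<Longrightarrow> continuous_on S f"
  by (simp add: continuous_at_imp_continuous_on differentiable_imp_continuous_within
      smooth_torus_differentiable)

lemma torus_periodic_partial_deriv:
  assumes "torus_periodic f" shows "torus_periodic (partial_deriv b f)"
  unfolding torus_periodic_def
proof (intro allI ballI)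
  fix x c :: 'a assume "c \<in> Basis"
  then have "f (x + (2 * pi) *\<^sub>R c + s *\<^sub>R b) = f (x + s *\<^sub>R b)" for s
    using torus_periodicD[OF assms, of c "x + s *\<^sub>R b"] by (simp add: add_ac)
  then show "partial_deriv b f (x + (2 * pi) *\<^sub>R c) = partial_deriv b f x"
    by (simp add: partial_deriv_def)
qed

lemma smooth_torus_partial_deriv:
  assumes "f \<in> smooth_torus" "b \<in> Basis"
  shows "partial_deriv b f \<in> smooth_torus"
  unfolding smooth_torus_iff
proof (intro conjI allI impI)
  show "torus_periodic (partial_deriv b f)"
    using assms by (simp add: smooth_torus_iff torus_periodic_partial_deriv)
  show "fold partial_deriv bs (partial_deriv b f) differentiable (at x)" if "set bs \<subseteq> Basis" for bs x
    using assms that unfolding smooth_torus_iff by (auto dest!: spec[of _ "b # bs"])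
qed

lemma smooth_torus_fold:
  "f \<in> smooth_torus \<Longrightarrow> set bs \<subseteq> Basis \<Longrightarrow> fold partial_deriv bs f \<in> smooth_torus"
  by (induction bs arbitrary: f) (auto simp: smooth_torus_partial_deriv)

text \<open>
  The way smoothness is proved throughout: every iterated derivative of a member of a class stays
  in the class as soon as the class is closed under single partial derivatives, so no induction over
  multi-indices is needed when the class is chosen well.
\<close>

lemma smooth_torus_coinduct:
  assumes "f \<in> A"
    and "\<And>f. f \<in> A \<Longrightarrow> torus_periodic f"
    and "\<And>f x. f \<in> A \<Longrightarrow> f differentiable (at x)"
    and "\<And>f b. f \<in> A \<Longrightarrow> b \<in> Basis \<Longrightarrow> partial_deriv b f \<in> A"
  shows "f \<in> smooth_torus"
proof -
  have "fold partial_deriv bs f \<in> A" if "set bs \<subseteq> Basis" for bs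
    using that \<open>f \<in> A\<close> by (induction bs arbitrary: f) (auto simp: assms(4))
  then show ?thesis using assms by (auto simp: smooth_torus_iff)
qed

lemma partial_deriv_const [simp]: "partial_deriv b (\<lambda>x. c) = (\<lambda>x. 0)"
  using partial_deriv_eq[OF has_derivative_const] by blast

lemma smooth_torus_const [simp]: "(\<lambda>x. c) \<in> smooth_torus"
  by (rule smooth_torus_coinduct[of _ "range (\<lambda>c x. c)"]) (auto simp: torus_periodic_def)

lemma partial_deriv_add:
  assumes "\<And>x. f differentiable (at x)" "\<And>x. g differentiable (at x)"
  shows "partial_deriv b (\<lambda>x. f x + g x) = (\<lambda>x. partial_deriv b f x + partial_deriv b g x)"
proof
  fix x
  note f = assms(1)[of x, unfolded frechet_derivative_works]
  note g = assms(2)[of x, unfolded frechet_derivative_works]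
  show "partial_deriv b (\<lambda>x. f x + g x) x = partial_deriv b f x + partial_deriv b g x"
    unfolding partial_deriv_eq[OF has_derivative_add[OF f g]] partial_deriv_eq[OF f] partial_deriv_eq[OF g] ..
qed

lemma partial_deriv_mult:
  assumes "\<And>x. f differentiable (at x)" "\<And>x. g differentiable (at x)"
  shows "partial_deriv b (\<lambda>x. f x * g x) =
    (\<lambda>x. partial_deriv b f x * g x + f x * partial_deriv b g x)"
proof
  fix x
  note f = assms(1)[of x, unfolded frechet_derivative_works]
  note g = assms(2)[of x, unfolded frechet_derivative_works]
  show "partial_deriv b (\<lambda>x. f x * g x) x = partial_deriv b f x * g x + f x * partial_deriv b g x"
    unfolding partial_deriv_eq[OF has_derivative_mult[OF f g]] partial_deriv_eq[OF f] partial_deriv_eq[OF g]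
    by (rule add.commute)
qed

lemma smooth_torus_add:
  assumes "f \<in> smooth_torus" "g \<in> smooth_torus"
  shows "(\<lambda>x. f x + g x) \<in> smooth_torus"
proof (rule smooth_torus_coinduct[of _ "{\<lambda>x. f x + g x | f g. f \<in> smooth_torus \<and> g \<in> smooth_torus}"])
  fix h assume "h \<in> {\<lambda>x. f x + g x | f g. f \<in> smooth_torus \<and> g \<in> smooth_torus}"
  then obtain f g where h: "h = (\<lambda>x. f x + g x)" and f: "f \<in> smooth_torus" and g: "g \<in> smooth_torus"
    by blast
  show "torus_periodic h"
    using smooth_torus_periodic[OF f] smooth_torus_periodic[OF g] by (simp add: h torus_periodic_def)
  show "h differentiable (at x)" for x
    unfolding h by (intro differentiable_add smooth_torus_differentiable f g)
  show "partial_deriv b h \<in> {\<lambda>x. f x + g x | f g. f \<in> smooth_torus \<and> g \<in> smooth_torus}" if b: "b \<in> Basis" for b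
    unfolding h partial_deriv_add[OF smooth_torus_differentiable[OF f] smooth_torus_differentiable[OF g]]
    using smooth_torus_partial_deriv[OF f b] smooth_torus_partial_deriv[OF g b] by blast
qed (use assms in blast)

text \<open>
  For products the class has to consist of sums of products: the Leibniz rule leads out of the set
  of products, but not out of its additive closure.
\<close>

inductive_set product_sums :: "('a::euclidean_space \<Rightarrow> complex) set" where
  product: "f \<in> smooth_torus \<Longrightarrow> g \<in> smooth_torus \<Longrightarrow> (\<lambda>x. f x * g x) \<in> product_sums"
| sum: "F \<in> product_sums \<Longrightarrow> G \<in> product_sums \<Longrightarrow> (\<lambda>x. F x + G x) \<in> product_sums"

lemma smooth_torus_mult:
  assumes "f \<in> smooth_torus" "g \<in> smooth_torus"
  shows "(\<lambda>x. f x * g x) \<in> smooth_torus"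
proof (rule smooth_torus_coinduct)
  show "(\<lambda>x. f x * g x) \<in> product_sums" using assms by (rule product_sums.product)
next
  fix F :: "'a \<Rightarrow> complex" assume "F \<in> product_sums"
  then show "torus_periodic F"
    by induction (auto simp: torus_periodic_def smooth_torus_iff)
next
  fix F :: "'a \<Rightarrow> complex" and x assume "F \<in> product_sums"
  then show "F differentiable (at x)"
    by induction (blast intro: differentiable_add differentiable_mult smooth_torus_differentiable)+
next
  fix F :: "'a \<Rightarrow> complex" and b :: 'a assume F: "F \<in> product_sums" and b: "b \<in> Basis"
  have diff: "F differentiable (at x)" if "F \<in> product_sums" for F x using that
    by induction (blast intro: differentiable_add differentiable_mult smooth_torus_differentiable)+
  from F show "partial_deriv b F \<in> product_sums"
  proof induction
    case (product f g)
    then show ?case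
      by (simp add: partial_deriv_mult smooth_torus_differentiable b smooth_torus_partial_deriv product_sums.intros)
  next
    case (sum F G)
    then show ?case by (simp add: partial_deriv_add diff product_sums.sum)
  qed
qed

lemma smooth_torus_cmult: "f \<in> smooth_torus \<Longrightarrow> (\<lambda>x. c * f x) \<in> smooth_torus"
  by (simp add: smooth_torus_mult)

lemma smooth_torus_uminus: "f \<in> smooth_torus \<Longrightarrow> (\<lambda>x. - f x) \<in> smooth_torus"
  using smooth_torus_cmult[of f "-1"] by simp

lemma smooth_torus_diff: "f \<in> smooth_torus \<Longrightarrow> g \<in> smooth_torus \<Longrightarrow> (\<lambda>x. f x - g x) \<in> smooth_torus"
  using smooth_torus_add[of f "\<lambda>x. - g x", OF _ smooth_torus_uminus] by simp

lemma smooth_torus_sum: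
  "(\<And>i. i \<in> I \<Longrightarrow> f i \<in> smooth_torus) \<Longrightarrow> (\<lambda>x. \<Sum>i\<in>I. f i x) \<in> smooth_torus"
  by (induction I rule: infinite_finite_induct) (auto intro: smooth_torus_add)

lemma partial_deriv_cmult:
  "f \<in> smooth_torus \<Longrightarrow> partial_deriv b (\<lambda>x. c * f x) = (\<lambda>x. c * partial_deriv b f x)"
  by (simp add: partial_deriv_mult smooth_torus_differentiable)

lemma fold_partial_deriv_add:
  assumes "f \<in> smooth_torus" "g \<in> smooth_torus" "set bs \<subseteq> Basis"
  shows "fold partial_deriv bs (\<lambda>x. f x + g x) = (\<lambda>x. fold partial_deriv bs f x + fold partial_deriv bs g x)"
  using assms
  by (induction bs arbitrary: f g) (auto simp: partial_deriv_add smooth_torus_differentiable smooth_torus_partial_deriv)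

lemma fold_partial_deriv_cmult:
  assumes "f \<in> smooth_torus" "set bs \<subseteq> Basis"
  shows "fold partial_deriv bs (\<lambda>x. c * f x) = (\<lambda>x. c * fold partial_deriv bs f x)"
  using assms
  by (induction bs arbitrary: f) (auto simp: partial_deriv_cmult smooth_torus_partial_deriv)

lemma partial_deriv_pullback:
  assumes "\<And>y. g differentiable (at y)" and T: "bounded_linear T"
  shows "partial_deriv b (\<lambda>x. g (T x + v)) = (\<lambda>x. partial_deriv (T b) g (T x + v))"
    and "(\<lambda>x. g (T x + v)) differentiable (at x)"
proof -
  have d: "((\<lambda>x. g (T x + v)) has_derivative (\<lambda>h. frechet_derivative g (at (T x + v)) (T h))) (at x)" for x
  proof (rule has_derivative_compose[of "\<lambda>x. T x + v" T x UNIV g, unfolded o_def])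
    show "((\<lambda>x. T x + v) has_derivative T) (at x)"
      by (rule has_derivative_add_const[OF bounded_linear_imp_has_derivative[OF T]])
    show "(g has_derivative frechet_derivative g (at (T x + v))) (at (T x + v))"
      using assms(1) frechet_derivative_works by blast
  qed
  show "partial_deriv b (\<lambda>x. g (T x + v)) = (\<lambda>x. partial_deriv (T b) g (T x + v))"
    using partial_deriv_eq[OF d] partial_deriv_eq[OF assms(1)[unfolded frechet_derivative_works]]
    by (simp add: fun_eq_iff)
  show "(\<lambda>x. g (T x + v)) differentiable (at x)" using d differentiable_def by blast
qed

lemma partial_deriv_direction_0 [simp]: "partial_deriv 0 g = (\<lambda>x. 0)"
  by (simp add: partial_deriv_def fun_eq_iff)

text \<open>
  The condition on the basis makes the substitution respect both periodicity and partial
  derivatives. It covers the coordinate projections, the embeddings of the \<open>t\<close>- and \<open>x\<close>-slices and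
  translations, which are all the substitutions that occur below.
\<close>

lemma smooth_torus_pullback:
  fixes T :: "'a::euclidean_space \<Rightarrow> 'b::euclidean_space"
  assumes g: "g \<in> smooth_torus" and T: "bounded_linear T"
    and basis: "\<And>b. b \<in> Basis \<Longrightarrow> T b \<in> insert 0 Basis"
  shows "(\<lambda>x. g (T x + v)) \<in> smooth_torus"
proof (rule smooth_torus_coinduct[of _ "{\<lambda>x. g (T x + v) | g. g \<in> smooth_torus}"])
  fix h :: "'a \<Rightarrow> complex" assume "h \<in> {\<lambda>x. g (T x + v) | g. g \<in> smooth_torus}"
  then obtain g where h: "h = (\<lambda>x. g (T x + v))" and g: "g \<in> smooth_torus" by blast
  show "torus_periodic h"
    unfolding torus_periodic_def
  proof (intro allI ballI)
    fix x b :: 'a assume "b \<in> Basis"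
    have "h (x + (2 * pi) *\<^sub>R b) = g ((T x + v) + (2 * pi) *\<^sub>R T b)"
      by (simp add: h linear_simps[OF T] add_ac)
    also have "\<dots> = g (T x + v)"
      using basis[OF \<open>b \<in> Basis\<close>] torus_periodicD[OF smooth_torus_periodic[OF g]] by auto
    finally show "h (x + (2 * pi) *\<^sub>R b) = h x" by (simp add: h)
  qed
  show "h differentiable (at x)" for x
    using h partial_deriv_pullback(2)[OF smooth_torus_differentiable[OF g] T] by auto
  show "partial_deriv b h \<in> {\<lambda>x. g (T x + v) | g. g \<in> smooth_torus}" if b: "b \<in> Basis" for b
  proof (intro CollectI exI conjI)
    show "partial_deriv b h = (\<lambda>x. partial_deriv (T b) g (T x + v))"
      unfolding h by (rule partial_deriv_pullback(1)[OF smooth_torus_differentiable[OF g] T])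
    show "partial_deriv (T b) g \<in> smooth_torus"
      using basis[OF b] g by (auto simp: smooth_torus_partial_deriv)
  qed
qed (use g in auto)

text \<open>
  An exponential of a linear or non-periodic phase can still be periodic. Its smoothness follows
  from the logarithmic derivative alone: the multiples of \<open>e\<close> by smooth functions are closed under
  partial derivatives.
\<close>

lemma smooth_torus_log_deriv:
  assumes per: "torus_periodic e" and diff: "\<And>x. e differentiable (at x)"
    and h: "\<And>b. b \<in> Basis \<Longrightarrow> h b \<in> smooth_torus"
    and deriv: "\<And>b. b \<in> Basis \<Longrightarrow> partial_deriv b e = (\<lambda>x. h b x * e x)"
  shows "e \<in> smooth_torus"
proof (rule smooth_torus_coinduct[of _ "{\<lambda>x. g x * e x | g. g \<in> smooth_torus}"])
  show "e \<in> {\<lambda>x. g x * e x | g. g \<in> smooth_torus}"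
    by (intro CollectI exI[of _ "\<lambda>x. 1"]) simp
  fix F assume "F \<in> {\<lambda>x. g x * e x | g. g \<in> smooth_torus}"
  then obtain g where F: "F = (\<lambda>x. g x * e x)" and g: "g \<in> smooth_torus" by blast
  show "torus_periodic F" using per smooth_torus_periodic[OF g] by (simp add: F torus_periodic_def)
  show "F differentiable (at x)" for x
    unfolding F by (intro differentiable_mult diff smooth_torus_differentiable[OF g])
  show "partial_deriv b F \<in> {\<lambda>x. g x * e x | g. g \<in> smooth_torus}" if b: "b \<in> Basis" for b
  proof (intro CollectI exI conjI)
    show "partial_deriv b F = (\<lambda>x. (partial_deriv b g x + g x * h b x) * e x)"
      unfolding F by (simp add: partial_deriv_mult smooth_torus_differentiable[OF g] diff deriv[OF b] algebra_simps)
    show "(\<lambda>x. partial_deriv b g x + g x * h b x) \<in> smooth_torus"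
      by (intro smooth_torus_add smooth_torus_mult smooth_torus_partial_deriv g b h)
  qed
qed

section \<open>Characters and the fundamental cube\<close>

definition lattice :: "'a::euclidean_space set" where
  "lattice = {z. \<forall>b\<in>Basis. z \<bullet> b \<in> \<int>}"

definition character :: "'a::euclidean_space \<Rightarrow> 'a \<Rightarrow> complex" where
  "character z x = cis (z \<bullet> x)"

lemma lattice_0 [simp]: "0 \<in> lattice"
  and lattice_add: "z \<in> lattice \<Longrightarrow> w \<in> lattice \<Longrightarrow> z + w \<in> lattice"
  and lattice_uminus: "z \<in> lattice \<Longrightarrow> - z \<in> lattice"
  and lattice_diff: "z \<in> lattice \<Longrightarrow> w \<in> lattice \<Longrightarrow> z - w \<in> lattice"
  by (auto simp: lattice_def inner_simps)

lemma lattice_Basis: "b \<in> Basis \<Longrightarrow> b \<in> lattice"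
  by (auto simp: lattice_def inner_Basis)

lemma norm_character [simp]: "cmod (character z x) = 1"
  by (simp add: character_def)

lemma character_0 [simp]: "character 0 x = 1" and character_at_0 [simp]: "character z 0 = 1"
  by (auto simp: character_def)

lemma character_add: "character (z + w) x = character z x * character w x"
  by (simp add: character_def inner_simps cis_mult)

lemma character_has_derivative:
  "(character z has_derivative (\<lambda>h. \<i> * of_real (z \<bullet> h) * character z x)) (at x)"
proof -
  have e: "character z = (\<lambda>x. exp (\<i> * of_real (z \<bullet> x)))"
    by (auto simp: character_def cis_conv_exp)
  have "((\<lambda>x. \<i> * complex_of_real (z \<bullet> x)) has_derivative (\<lambda>h. \<i> * complex_of_real (z \<bullet> h))) (at x)"
    by (auto intro!: derivative_eq_intros)
  from has_derivative_compose[OF this DERIV_exp[unfolded has_field_derivative_def]]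
  show ?thesis unfolding e by (simp add: mult_ac)
qed

lemma partial_deriv_character: "partial_deriv b (character z) = (\<lambda>x. \<i> * of_real (z \<bullet> b) * character z x)"
  using partial_deriv_eq[OF character_has_derivative] by blast

lemma torus_periodic_character:
  assumes "z \<in> lattice" shows "torus_periodic (character z)"
  unfolding torus_periodic_def
proof (intro allI ballI)
  fix x b :: 'a assume "b \<in> Basis"
  then have "z \<bullet> b \<in> \<int>" using assms by (auto simp: lattice_def)
  then have "cis (2 * pi * (z \<bullet> b)) = 1" by (rule cis_multiple_2pi)
  then show "character z (x + (2 * pi) *\<^sub>R b) = character z x"
    by (simp add: character_def inner_simps flip: cis_mult)
qed

lemma smooth_torus_character: "z \<in> lattice \<Longrightarrow> character z \<in> smooth_torus"
  by (rule smooth_torus_log_deriv[of _ "\<lambda>b x. \<i> * of_real (z \<bullet> b)"])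
    (auto simp: torus_periodic_character partial_deriv_character differentiable_def
      intro: character_has_derivative)

lemma fold_partial_deriv_character:
  assumes "z \<in> lattice" "set bs \<subseteq> Basis"
  shows "fold partial_deriv bs (character z) = (\<lambda>x. (\<Prod>b\<leftarrow>bs. \<i> * of_real (z \<bullet> b)) * character z x)"
  using assms(2)
proof (induction bs)
  case (Cons b bs)
  then have bs: "set bs \<subseteq> Basis" by simp
  show ?case
    using Cons.IH[OF bs]
    by (simp add: partial_deriv_character fold_partial_deriv_cmult[OF smooth_torus_character[OF assms(1)] bs],
      simp add: mult.assoc)
qed simp

lemma norm_fold_partial_deriv_character:
  assumes "z \<in> lattice" "set bs \<subseteq> Basis"
  shows "cmod (fold partial_deriv bs (character z) x) \<le> (1 + norm z) ^ length bs"
proof -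
  have "cmod (\<Prod>b\<leftarrow>bs. \<i> * of_real (z \<bullet> b)) \<le> (1 + norm z) ^ length bs"
    using assms(2)
  proof (induction bs)
    case (Cons b bs)
    have "\<bar>z \<bullet> b\<bar> \<le> 1 + norm z" using Cons.prems Basis_le_norm[of b z] by auto
    then show ?case using Cons by (auto simp: norm_mult intro!: mult_mono)
  qed simp
  then show ?thesis using assms by (simp add: fold_partial_deriv_character norm_mult)
qed

abbreviation torus_cube :: "'a::euclidean_space set" where
  "torus_cube \<equiv> cbox 0 (\<Sum>b\<in>Basis. (2 * pi) *\<^sub>R b)"

lemma mem_torus_cube: "x \<in> torus_cube \<longleftrightarrow> (\<forall>b\<in>Basis. 0 \<le> x \<bullet> b \<and> x \<bullet> b \<le> 2 * pi)"
  by (simp add: mem_box)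

lemma torus_periodic_int:
  assumes "torus_periodic f" "b \<in> Basis"
  shows "f (x + (2 * pi * of_int n) *\<^sub>R b) = f x"
proof -
  have nat: "f (x + (2 * pi * of_nat n) *\<^sub>R b) = f x" for n x
  proof (induction n)
    case (Suc n)
    have "f (x + (2 * pi * of_nat (Suc n)) *\<^sub>R b) = f ((x + (2 * pi * of_nat n) *\<^sub>R b) + (2 * pi) *\<^sub>R b)"
      by (simp add: algebra_simps)
    then show ?case using Suc torus_periodicD[OF assms] by metis
  qed simp
  show ?thesis
  proof (cases "n \<ge> 0")
    case True
    then show ?thesis using nat[of x "nat n"] by simp
  next
    case False
    then show ?thesis using nat[of "x + (2 * pi * of_int n) *\<^sub>R b" "nat (- n)"]
      by (simp add: algebra_simps)
  qed
qed

lemma torus_periodic_lattice: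
  assumes "torus_periodic f"
  shows "f (x + (\<Sum>b\<in>Basis. (2 * pi * of_int (n b)) *\<^sub>R b)) = f x"
proof -
  have "f (x + (\<Sum>b\<in>B. (2 * pi * of_int (n b)) *\<^sub>R b)) = f x" if "finite B" "B \<subseteq> Basis" for B
    using that
  proof (induction B)
    case (insert b B)
    have "f (x + (\<Sum>b\<in>insert b B. (2 * pi * of_int (n b)) *\<^sub>R b)) =
        f ((x + (\<Sum>b\<in>B. (2 * pi * of_int (n b)) *\<^sub>R b)) + (2 * pi * of_int (n b)) *\<^sub>R b)"
      using insert by (simp add: add_ac)
    also have "\<dots> = f (x + (\<Sum>b\<in>B. (2 * pi * of_int (n b)) *\<^sub>R b))"
      using insert.prems by (intro torus_periodic_int[OF assms]) auto
    finally show ?case using insert by simp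
  qed simp
  then show ?thesis by simp
qed

text \<open>
  Induction on the cube: a property which can be transported along a lattice translation has only
  to be checked at representatives modulo \<open>2 * pi\<close>.
\<close>

lemma torus_cube_representative:
  assumes "\<And>x. x \<in> torus_cube \<Longrightarrow> P x"
    and inv: "\<And>x n. P (x + (\<Sum>b\<in>Basis. (2 * pi * of_int (n b)) *\<^sub>R b)) \<Longrightarrow> P x"
  shows "P x"
proof -
  define n where "n b = - \<lfloor>(x \<bullet> b) / (2 * pi)\<rfloor>" for b
  have "x + (\<Sum>b\<in>Basis. (2 * pi * of_int (n b)) *\<^sub>R b) \<in> torus_cube"
    unfolding mem_torus_cube
  proof
    fix b :: 'a assume b: "b \<in> Basis"
    have "of_int \<lfloor>(x \<bullet> b) / (2 * pi)\<rfloor> * (2 * pi) \<le> (x \<bullet> b) / (2 * pi) * (2 * pi)"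
       "(x \<bullet> b) / (2 * pi) * (2 * pi) \<le> (of_int \<lfloor>(x \<bullet> b) / (2 * pi)\<rfloor> + 1) * (2 * pi)"
      by (intro mult_right_mono; use pi_gt_zero in linarith)+
    then have "of_int \<lfloor>(x \<bullet> b) / (2 * pi)\<rfloor> * (2 * pi) \<le> x \<bullet> b"
       "x \<bullet> b \<le> (of_int \<lfloor>(x \<bullet> b) / (2 * pi)\<rfloor> + 1) * (2 * pi)"
      by simp_all
    moreover have "(x + (\<Sum>b\<in>Basis. (2 * pi * of_int (n b)) *\<^sub>R b)) \<bullet> b = x \<bullet> b + 2 * pi * of_int (n b)"
      using b by (simp add: inner_add_left inner_sum_left_Basis)
    ultimately show "0 \<le> (x + (\<Sum>b\<in>Basis. (2 * pi * of_int (n b)) *\<^sub>R b)) \<bullet> b \<and>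
       (x + (\<Sum>b\<in>Basis. (2 * pi * of_int (n b)) *\<^sub>R b)) \<bullet> b \<le> 2 * pi"
      by (simp add: n_def algebra_simps)
  qed
  then show ?thesis using assms by blast
qed

lemma torus_periodic_cube:
  assumes "torus_periodic f" obtains y where "y \<in> torus_cube" "f y = f x"
proof -
  have "\<exists>y\<in>torus_cube. f y = f x"
    by (rule torus_cube_representative) (use torus_periodic_lattice[OF assms] in auto)
  then show ?thesis using that by blast
qed

lemma torus_periodic_attains_sup:
  fixes f :: "'a::euclidean_space \<Rightarrow> real"
  assumes "torus_periodic f" "continuous_on UNIV f"
  obtains y where "y \<in> torus_cube" "\<And>x. f x \<le> f y"
proof -
  have "torus_cube \<noteq> ({} :: 'a set)" by (auto simp: box_ne_empty)
  then obtain y where y: "y \<in> torus_cube" "\<And>x. x \<in> torus_cube \<Longrightarrow> f x \<le> f y"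
    using continuous_attains_sup[OF compact_cbox] assms(2) continuous_on_subset
    by (metis subset_UNIV)
  show ?thesis using y(1)
  proof (rule that)
    show "f x \<le> f y" for x using y torus_periodic_cube[OF assms(1), of x] by metis
  qed
qed

lemma smooth_torus_bounded:
  assumes "f \<in> smooth_torus" shows "bdd_above (range (\<lambda>x. cmod (f x)))"
proof -
  have "continuous_on UNIV (\<lambda>x. cmod (f x))"
    by (intro continuous_intros smooth_torus_continuous assms)
  moreover have "torus_periodic (\<lambda>x. cmod (f x))"
    using smooth_torus_periodic[OF assms] by (simp add: torus_periodic_def)
  ultimately show ?thesis using torus_periodic_attains_sup unfolding bdd_above_def by (metis imageE)
qed

text \<open>
  The supremum in the norm is a genuine one because smooth functions are bounded, and all summands
  are nonnegative, so each of them is bounded by the sum.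
\<close>

lemma torus_Ck_norm_upper:
  assumes f: "f \<in> smooth_torus" and bs: "set bs \<subseteq> Basis" "length bs \<le> k"
  shows "cmod (fold partial_deriv bs f x) \<le> torus_Ck_norm k f"
proof -
  have nonneg: "0 \<le> (SUP x. cmod (fold partial_deriv cs f x))" if "set cs \<subseteq> Basis" for cs
    using cSUP_upper[OF UNIV_I smooth_torus_bounded[OF smooth_torus_fold[OF f that]]]
    by (meson norm_ge_zero order_trans)
  have "cmod (fold partial_deriv bs f x) \<le> (SUP x. cmod (fold partial_deriv bs f x))"
    by (rule cSUP_upper[OF UNIV_I smooth_torus_bounded[OF smooth_torus_fold[OF f bs(1)]]])
  also have "\<dots> \<le> torus_Ck_norm k f"
    unfolding torus_Ck_norm_def
    by (rule member_le_sum) (use bs nonneg finite_lists_length_le[OF finite_Basis] in auto)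
  finally show ?thesis .
qed

lemma torus_Ck_norm_least:
  fixes f :: "'a::euclidean_space \<Rightarrow> complex"
  assumes "\<And>bs x. set bs \<subseteq> Basis \<Longrightarrow> length bs \<le> k \<Longrightarrow> cmod (fold partial_deriv bs f x) \<le> B bs"
  shows "torus_Ck_norm k f \<le> (\<Sum>bs | set bs \<subseteq> (Basis :: 'a set) \<and> length bs \<le> k. B bs)"
  unfolding torus_Ck_norm_def by (intro sum_mono cSUP_least) (use assms in auto)

lemma torus_Ck_norm_nonneg: "f \<in> smooth_torus \<Longrightarrow> 0 \<le> torus_Ck_norm k f"
  using torus_Ck_norm_upper[of f "[]" k undefined] by (auto intro: order_trans[OF norm_ge_zero])

lemma torus_Ck_norm_partial_deriv:
  fixes f :: "'a::euclidean_space \<Rightarrow> complex"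
  assumes f: "f \<in> smooth_torus" and b: "b \<in> Basis"
  shows "torus_Ck_norm k (partial_deriv b f) \<le> torus_Ck_norm (Suc k) f"
proof -
  have nonneg: "0 \<le> (SUP x. cmod (fold partial_deriv cs f x))" if "set cs \<subseteq> Basis" for cs
    using cSUP_upper[OF UNIV_I smooth_torus_bounded[OF smooth_torus_fold[OF f that]]]
    by (meson norm_ge_zero order_trans)
  have "torus_Ck_norm k (partial_deriv b f) =
     (\<Sum>bs \<in> (#) b ` {bs. set bs \<subseteq> Basis \<and> length bs \<le> k}. SUP x. cmod (fold partial_deriv bs f x))"
    unfolding torus_Ck_norm_def by (subst sum.reindex) (auto simp: inj_on_def)
  also have "\<dots> \<le> torus_Ck_norm (Suc k) f"
    unfolding torus_Ck_norm_def
    by (rule sum_mono2) (use b nonneg finite_lists_length_le[OF finite_Basis] in auto)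
  finally show ?thesis .
qed

section \<open>Integration over the torus\<close>

lemma integrable_torus_cube:
  fixes f :: "'a::euclidean_space \<Rightarrow> complex"
  shows "continuous_on UNIV f \<Longrightarrow> f integrable_on torus_cube"
  by (meson continuous_on_subset integrable_continuous subset_UNIV)

lemma content_torus_cube: "measure lborel (torus_cube :: 'a::euclidean_space set) = (2 * pi) ^ DIM('a)"
  by (subst content_cbox) auto

lemma torus_integral_add:
  "continuous_on UNIV f \<Longrightarrow> continuous_on UNIV g \<Longrightarrow>
    torus_integral (\<lambda>x. f x + g x) = torus_integral f + torus_integral g"
  unfolding torus_integral_def by (intro integral_add integrable_torus_cube)

lemma torus_integral_diff:
  "continuous_on UNIV f \<Longrightarrow> continuous_on UNIV g \<Longrightarrow>
    torus_integral (\<lambda>x. f x - g x) = torus_integral f - torus_integral g"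
  unfolding torus_integral_def by (intro integral_diff integrable_torus_cube)

lemma torus_integral_cmult: "torus_integral (\<lambda>x. c * f x) = c * torus_integral f"
  unfolding torus_integral_def by simp

lemma torus_integral_const: "torus_integral (\<lambda>x :: 'a::euclidean_space. c) = c * (2 * pi) ^ DIM('a)"
  unfolding torus_integral_def
  by (simp add: content_torus_cube scaleR_conv_of_real)

lemma torus_integral_bound:
  fixes f :: "'a::euclidean_space \<Rightarrow> complex"
  assumes "continuous_on UNIV f" "\<And>x. cmod (f x) \<le> B"
  shows "cmod (torus_integral f) \<le> (2 * pi) ^ DIM('a) * B"
proof -
  have "0 \<le> B" using assms(2)[of undefined] norm_ge_zero order_trans by blast
  from has_integral_bound[OF this integrable_integral[OF integrable_torus_cube[OF assms(1)]]] assms(2)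
  show ?thesis unfolding torus_integral_def by (simp add: content_torus_cube mult.commute)
qed

text \<open>
  The shifted cube is cut along the face \<open>x \<bullet> b = 2 * pi\<close>; by periodicity the overhanging slab can
  be moved back by one period, where it fills the gap that the shift has left.
\<close>

lemma torus_integral_shift:
  fixes f :: "'a::euclidean_space \<Rightarrow> complex"
  assumes cont: "continuous_on UNIV f" and per: "torus_periodic f"
    and b: "b \<in> Basis" and s: "0 \<le> s" "s \<le> 2 * pi"
  shows "torus_integral (\<lambda>x. f (x + s *\<^sub>R b)) = torus_integral f"
proof -
  define C :: 'a where "C = (\<Sum>b\<in>Basis. (2 * pi) *\<^sub>R b)"
  define A where "A = C + (s - 2 * pi) *\<^sub>R b"
  have C: "C \<bullet> i = 2 * pi" if "i \<in> Basis" for i using that by (simp add: C_def)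
  have int: "f integrable_on cbox u v" for u v
    using cont by (meson continuous_on_subset integrable_continuous subset_UNIV)
  note splits = integral_unique[OF has_integral_split[OF integrable_integral integrable_integral b]]
  obtain B' where B': "B' = Basis - {b}" by simp
  have split_ball: "(\<forall>i\<in>Basis. P i) \<longleftrightarrow> P b \<and> (\<forall>i\<in>B'. P i)" for P using b B' by blast
  have B'D: "b \<bullet> i = 0" "i \<in> Basis" if "i \<in> B'" for i using b that B' by (auto simp: inner_not_same_Basis)
  have 1: "cbox (s *\<^sub>R b) (C + s *\<^sub>R b) \<inter> {x. x \<bullet> b \<le> 2 * pi} = cbox (s *\<^sub>R b) C"
    and 2: "cbox (s *\<^sub>R b) (C + s *\<^sub>R b) \<inter> {x. x \<bullet> b \<ge> 2 * pi} = cbox ((2 * pi) *\<^sub>R b) (A + (2 * pi) *\<^sub>R b)"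
    and 3: "cbox 0 C \<inter> {x. x \<bullet> b \<le> s} = cbox 0 A"
    and 4: "cbox 0 C \<inter> {x. x \<bullet> b \<ge> s} = cbox (s *\<^sub>R b) C"
    using s b by (auto simp: mem_box split_ball B'D C A_def inner_simps cong: ball_cong)
  have "torus_integral (\<lambda>x. f (x + s *\<^sub>R b)) = integral (cbox (s *\<^sub>R b) (C + s *\<^sub>R b)) f"
    using integral_shift_cbox_plus[of 0 C f "s *\<^sub>R b"]
    by (simp add: torus_integral_def C_def o_def add.commute)
  also have "\<dots> = integral (cbox (s *\<^sub>R b) C) f + integral (cbox ((2 * pi) *\<^sub>R b) (A + (2 * pi) *\<^sub>R b)) f"
    by (rule splits[of f "s *\<^sub>R b" "C + s *\<^sub>R b" "2 * pi", unfolded 1 2, OF int int])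
  also have "integral (cbox ((2 * pi) *\<^sub>R b) (A + (2 * pi) *\<^sub>R b)) f = integral (cbox 0 A) f"
    using integral_shift_cbox_plus[of 0 A f "(2 * pi) *\<^sub>R b"] torus_periodicD[OF per b]
    by (simp add: o_def add.commute)
  also have "integral (cbox (s *\<^sub>R b) C) f + integral (cbox 0 A) f = integral (cbox 0 C) f"
    using splits[of f 0 C s, unfolded 3 4, OF int int] by (simp add: add.commute)
  finally show ?thesis by (simp add: torus_integral_def C_def)
qed

text \<open>
  The integral of a translate does not depend on the translation; differentiating it under the
  integral sign gives the integral of the derivative.
\<close>

lemma torus_integral_partial_deriv:
  fixes f :: "'a::euclidean_space \<Rightarrow> complex"
  assumes f: "f \<in> smooth_torus" and b: "b \<in> Basis"
  shows "torus_integral (partial_deriv b f) = 0"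
proof -
  \<comment> \<open>The derivative is taken at \<open>s = 1\<close>, an interior point of the interval of admissible shifts.\<close>
  define g where "g = (\<lambda>x. f (x + (- b)))"
  have g: "g \<in> smooth_torus"
    using smooth_torus_pullback[OF f bounded_linear_ident, of "- b"] by (auto simp: g_def)
  have dg: "partial_deriv b g (x + b) = partial_deriv b f x" for x
    using partial_deriv_pullback(1)[OF smooth_torus_differentiable[OF f] bounded_linear_ident, of b "- b"]
    by (simp add: g_def)
  have "((\<lambda>s. torus_integral (\<lambda>x. g (x + s *\<^sub>R b))) has_vector_derivative
      torus_integral (\<lambda>x. partial_deriv b g (x + 1 *\<^sub>R b))) (at 1 within {0..2})"
    unfolding torus_integral_def
  proof (rule leibniz_rule_vector_derivative)
    show "((\<lambda>s. g (x + s *\<^sub>R b)) has_vector_derivative partial_deriv b g (x + s *\<^sub>R b)) (at s within {0..2})" for s x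
      by (rule has_vector_derivative_at_within[OF
            has_vector_derivative_partial_deriv[OF smooth_torus_differentiable[OF g]]])
    show "(\<lambda>x. g (x + s *\<^sub>R b)) integrable_on torus_cube" for s
      by (intro integrable_torus_cube continuous_on_compose2[OF smooth_torus_continuous[OF g, of UNIV]]
        continuous_intros) auto
    show "continuous_on ({0..2} \<times> torus_cube) (\<lambda>(s, x). partial_deriv b g (x + s *\<^sub>R b))"
      unfolding split_beta
      by (intro continuous_on_compose2[OF smooth_torus_continuous[OF smooth_torus_partial_deriv[OF g b], of UNIV]]
        continuous_intros) auto
  qed auto
  moreover have "((\<lambda>s. torus_integral (\<lambda>x. g (x + s *\<^sub>R b))) has_vector_derivative 0) (at 1 within {0..2})"
  proof (rule has_vector_derivative_transform[of 1 "{0..2}" _ "\<lambda>s. torus_integral g"])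
    show "torus_integral (\<lambda>x. g (x + s *\<^sub>R b)) = torus_integral g" if "s \<in> {0..2}" for s
      using that pi_gt3 by (intro torus_integral_shift b smooth_torus_continuous[OF g] smooth_torus_periodic[OF g]) auto
  qed auto
  ultimately have "torus_integral (\<lambda>x. partial_deriv b g (x + 1 *\<^sub>R b)) = 0"
    by (simp add: at_within_Icc_at vector_derivative_unique_at)
  then show ?thesis by (simp add: dg)
qed

lemma torus_integration_by_parts:
  assumes f: "f \<in> smooth_torus" and g: "g \<in> smooth_torus" and b: "b \<in> Basis"
  shows "torus_integral (\<lambda>x. f x * partial_deriv b g x) = - torus_integral (\<lambda>x. partial_deriv b f x * g x)"
proof -
  have "0 = torus_integral (\<lambda>x. partial_deriv b f x * g x + f x * partial_deriv b g x)"
    using torus_integral_partial_deriv[OF smooth_torus_mult[OF f g] b]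
    by (simp add: partial_deriv_mult smooth_torus_differentiable f g)
  also have "\<dots> = torus_integral (\<lambda>x. partial_deriv b f x * g x) + torus_integral (\<lambda>x. f x * partial_deriv b g x)"
    by (intro torus_integral_add smooth_torus_continuous smooth_torus_mult smooth_torus_partial_deriv f g b)
  finally show ?thesis by (simp add: add_eq_0_iff2)
qed

lemma torus_integral_character:
  assumes z: "z \<in> lattice"
  shows "torus_integral (character (z :: 'a::euclidean_space)) = (if z = 0 then (2 * pi) ^ DIM('a) else 0)"
proof (cases "z = 0")
  case True
  then have "character z = (\<lambda>x. 1)" by (simp add: fun_eq_iff)
  then show ?thesis using True torus_integral_const[of 1, where ?'a = 'a] by simp
next
  case False
  then obtain b where b: "b \<in> Basis" "z \<bullet> b \<noteq> 0" using euclidean_all_zero_iff by blast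
  have "\<i> * of_real (z \<bullet> b) * torus_integral (character z) = 0"
    using torus_integral_partial_deriv[OF smooth_torus_character[OF z] b(1)]
    by (simp add: partial_deriv_character torus_integral_cmult)
  then show ?thesis using b False by simp
qed

text \<open>
  Repeated integration by parts: each frequency \<open>\<omega> b\<close> can be absorbed by one derivative on the test
  function. The amplitude \<open>e\<close> need not be a pure character. It may depend in any way on the variables
  outside \<open>B\<close>, and the bound is uniform in \<open>e\<close>, which is what the superposition of quasimodes needs.
  With the characters for \<open>e\<close> it is the rapid decay of Fourier coefficients.
\<close>

lemma torus_oscillatory_integral_decay:
  fixes e \<phi> :: "'a::euclidean_space \<Rightarrow> complex"
  assumes e: "e \<in> smooth_torus" "\<And>x. cmod (e x) \<le> 1"
    and B: "B \<subseteq> Basis" and deriv: "\<And>b. b \<in> B \<Longrightarrow> partial_deriv b e = (\<lambda>x. \<i> * of_real (\<omega> b) * e x)"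
    and \<phi>: "\<phi> \<in> smooth_torus"
  shows "(1 + (\<Sum>b\<in>B. \<bar>\<omega> b\<bar>)) ^ M * cmod (torus_integral (\<lambda>x. e x * \<phi> x))
    \<le> (2 * pi) ^ DIM('a) * (1 + real DIM('a)) ^ M * torus_Ck_norm M \<phi>"
  using \<phi>
proof (induction M arbitrary: \<phi>)
  case 0
  have "cmod (torus_integral (\<lambda>x. e x * \<phi> x)) \<le> (2 * pi) ^ DIM('a) * torus_Ck_norm 0 \<phi>"
  proof (rule torus_integral_bound)
    show "continuous_on UNIV (\<lambda>x. e x * \<phi> x)"
      by (intro smooth_torus_continuous smooth_torus_mult e 0)
    show "cmod (e x * \<phi> x) \<le> torus_Ck_norm 0 \<phi>" for x
      using mult_mono[OF e(2)[of x] torus_Ck_norm_upper[OF 0, of "[]" 0 x]] by (simp add: norm_mult)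
  qed
  then show ?case by simp
next
  case (Suc M)
  let ?K = "(2 * pi) ^ DIM('a) * (1 + real DIM('a)) ^ M" and ?s = "\<Sum>b\<in>B. \<bar>\<omega> b\<bar>"
  have K: "0 \<le> ?K" by simp
  have parts: "\<bar>\<omega> b\<bar> * cmod (torus_integral (\<lambda>x. e x * \<phi> x)) = cmod (torus_integral (\<lambda>x. e x * partial_deriv b \<phi> x))"
    if b: "b \<in> B" for b
  proof -
    have "torus_integral (\<lambda>x. e x * partial_deriv b \<phi> x) = - (\<i> * of_real (\<omega> b)) * torus_integral (\<lambda>x. e x * \<phi> x)"
      using torus_integration_by_parts[OF e(1) Suc.prems, of b] b B
      by (auto simp: deriv mult.assoc torus_integral_cmult)
    then show ?thesis by (simp add: norm_mult)
  qed
  have mono: "torus_Ck_norm M \<phi> \<le> torus_Ck_norm (Suc M) \<phi>"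
    unfolding torus_Ck_norm_def
  proof (rule sum_mono2)
    show "0 \<le> (SUP x. cmod (fold partial_deriv cs \<phi> x))"
      if "cs \<in> {bs. set bs \<subseteq> Basis \<and> length bs \<le> Suc M} - {bs. set bs \<subseteq> Basis \<and> length bs \<le> M}" for cs
      using that cSUP_upper[OF UNIV_I smooth_torus_bounded[OF smooth_torus_fold[OF Suc.prems, of cs]]]
      by (force intro: order_trans[OF norm_ge_zero])
  qed (auto intro: finite_lists_length_le)
  have "(1 + ?s) ^ Suc M * cmod (torus_integral (\<lambda>x. e x * \<phi> x)) =
      (1 + ?s) ^ M * cmod (torus_integral (\<lambda>x. e x * \<phi> x)) +
      (\<Sum>b\<in>B. (1 + ?s) ^ M * (\<bar>\<omega> b\<bar> * cmod (torus_integral (\<lambda>x. e x * \<phi> x))))"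
    by (simp add: algebra_simps sum_distrib_left sum_distrib_right)
  also have "\<dots> = (1 + ?s) ^ M * cmod (torus_integral (\<lambda>x. e x * \<phi> x)) +
      (\<Sum>b\<in>B. (1 + ?s) ^ M * cmod (torus_integral (\<lambda>x. e x * partial_deriv b \<phi> x)))"
    by (simp add: parts cong: sum.cong)
  also have "\<dots> \<le> ?K * torus_Ck_norm (Suc M) \<phi> + (\<Sum>b\<in>B. ?K * torus_Ck_norm (Suc M) \<phi>)"
  proof (intro add_mono sum_mono)
    show "(1 + ?s) ^ M * cmod (torus_integral (\<lambda>x. e x * \<phi> x)) \<le> ?K * torus_Ck_norm (Suc M) \<phi>"
      using Suc.IH[OF Suc.prems] mult_left_mono[OF mono K] by linarith
    show "(1 + ?s) ^ M * cmod (torus_integral (\<lambda>x. e x * partial_deriv b \<phi> x)) \<le> ?K * torus_Ck_norm (Suc M) \<phi>"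
      if "b \<in> B" for b
    proof -
      have b: "b \<in> Basis" using that B by blast
      show ?thesis
        using Suc.IH[OF smooth_torus_partial_deriv[OF Suc.prems b]]
          mult_left_mono[OF torus_Ck_norm_partial_deriv[OF Suc.prems b, of M] K] by linarith
    qed
  qed
  also have "\<dots> = (1 + card B) * (?K * torus_Ck_norm (Suc M) \<phi>)" by (simp add: algebra_simps)
  also have "\<dots> \<le> (1 + real DIM('a)) * (?K * torus_Ck_norm (Suc M) \<phi>)"
    using card_mono[OF finite_Basis B] torus_Ck_norm_nonneg[OF Suc.prems]
    by (intro mult_right_mono mult_nonneg_nonneg) auto
  finally show ?case by (simp only: power_Suc mult_ac)
qed

section \<open>Uniqueness of Fourier coefficients\<close>

text \<open>
  The powers of \<open>K\<close> concentrate at \<open>x0\<close>: if \<open>h x0\<close> were positive, the part of the integral near \<open>x0\<close>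
  would be at least a constant times \<open>\<rho> ^ n\<close>, while the part away from \<open>x0\<close> is at most a constant times
  \<open>q ^ n\<close> with \<open>q < \<rho>\<close>, so the integral could not vanish for large \<open>n\<close>.
\<close>

lemma peak_kernel_nonpos:
  fixes h K :: "'a::euclidean_space \<Rightarrow> real"
  assumes h: "continuous_on (cbox a b) h" and K: "continuous_on (cbox a b) K"
    and x0: "x0 \<in> box a b" and K1: "K x0 = 1"
    and K0: "\<And>x. x \<in> cbox a b \<Longrightarrow> 0 \<le> K x"
    and peak: "\<And>x. x \<in> cbox a b \<Longrightarrow> x \<noteq> x0 \<Longrightarrow> K x < 1"
    and int: "\<And>n. ((\<lambda>x. h x * K x ^ n) has_integral 0) (cbox a b)"
  shows "h x0 \<le> 0"
proof (rule ccontr)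
  assume "\<not> h x0 \<le> 0"
  define \<eta> where "\<eta> = h x0 / 2"
  have \<eta>: "0 < \<eta>" "\<eta> < h x0" using \<open>\<not> h x0 \<le> 0\<close> by (auto simp: \<eta>_def)
  have x0': "x0 \<in> cbox a b" using x0 box_subset_cbox by blast
  obtain d1 where d1: "0 < d1" "\<And>x. x \<in> cbox a b \<Longrightarrow> dist x x0 < d1 \<Longrightarrow> \<eta> < h x"
  proof -
    obtain d where "0 < d" "\<forall>x\<in>cbox a b. dist x x0 < d \<longrightarrow> dist (h x) (h x0) < h x0 - \<eta>"
      using h x0' \<eta> unfolding continuous_on_iff by (metis diff_gt_0_iff_gt)
    then show ?thesis by (intro that[of d]) (auto simp: dist_real_def abs_if split: if_splits)
  qed
  obtain q where q: "0 \<le> q" "q < 1" "\<And>x. x \<in> cbox a b \<Longrightarrow> d1 \<le> dist x x0 \<Longrightarrow> K x \<le> q"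
  proof (cases "cbox a b - ball x0 d1 = {}")
    case True
    then show ?thesis by (intro that[of 0]) (auto simp: dist_commute)
  next
    case False
    have "compact (cbox a b - ball x0 d1)" by (intro compact_diff) auto
    moreover have "continuous_on (cbox a b - ball x0 d1) K" using K continuous_on_subset by blast
    ultimately obtain y where y: "y \<in> cbox a b - ball x0 d1" "\<forall>x\<in>cbox a b - ball x0 d1. K x \<le> K y"
      using continuous_attains_sup False by metis
    have "y \<noteq> x0" using y d1 by auto
    then show ?thesis using y K0 peak by (intro that[of "K y"]) (auto simp: dist_commute)
  qed
  define \<rho> where "\<rho> = (1 + q) / 2"
  have \<rho>: "q < \<rho>" "\<rho> < 1" "0 < \<rho>" using q by (auto simp: \<rho>_def)
  obtain d2 where d2: "0 < d2" "\<And>x. x \<in> cbox a b \<Longrightarrow> dist x x0 < d2 \<Longrightarrow> \<rho> < K x"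
  proof -
    obtain d where "0 < d" "\<forall>x\<in>cbox a b. dist x x0 < d \<longrightarrow> dist (K x) (K x0) < 1 - \<rho>"
      using K x0' \<rho> unfolding continuous_on_iff by (metis diff_gt_0_iff_gt)
    then show ?thesis using K1 by (intro that[of d]) (auto simp: dist_real_def abs_if split: if_splits)
  qed
  have "open (ball x0 (min d1 d2) \<inter> box a b)" by (intro open_Int open_ball open_box)
  moreover have "x0 \<in> ball x0 (min d1 d2) \<inter> box a b" using x0 d1 d2 by auto
  ultimately obtain c d where cd: "cbox c d \<subseteq> ball x0 (min d1 d2) \<inter> box a b" "x0 \<in> box c d"
    using open_contains_cbox by meson
  obtain M where M: "\<And>x. x \<in> cbox a b \<Longrightarrow> \<bar>h x\<bar> \<le> M"
    using compact_imp_bounded[OF compact_continuous_image[OF h compact_cbox]] unfolding bounded_iff by auto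
  have M0: "0 \<le> M" using M[OF x0'] by auto
  have le: "\<eta> * measure lborel (cbox c d) * \<rho> ^ n \<le> M * measure lborel (cbox a b) * q ^ n" for n
  proof -
    have sub: "cbox c d \<subseteq> cbox a b" using cd box_subset_cbox by blast
    have "((\<lambda>x. (if x \<in> cbox c d then \<eta> * \<rho> ^ n else 0) - M * q ^ n) has_integral
       measure lborel (cbox c d) *\<^sub>R (\<eta> * \<rho> ^ n) - measure lborel (cbox a b) *\<^sub>R (M * q ^ n)) (cbox a b)"
      by (intro has_integral_diff has_integral_const)
        (subst has_integral_restrict[OF sub], rule has_integral_const)
    then have "measure lborel (cbox c d) *\<^sub>R (\<eta> * \<rho> ^ n) - measure lborel (cbox a b) *\<^sub>R (M * q ^ n) \<le> 0"
    proof (rule has_integral_le[OF _ int[of n]])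
      fix x assume x: "x \<in> cbox a b"
      consider "x \<in> cbox c d" | "x \<notin> cbox c d" "dist x x0 < d1" | "x \<notin> cbox c d" "d1 \<le> dist x x0" by linarith
      then show "(if x \<in> cbox c d then \<eta> * \<rho> ^ n else 0) - M * q ^ n \<le> h x * K x ^ n"
      proof cases
        case 1
        then have "dist x x0 < d1" "dist x x0 < d2" using cd by (auto simp: dist_commute)
        then have "\<eta> * \<rho> ^ n \<le> h x * K x ^ n"
          using d1(2)[OF x] d2(2)[OF x] \<eta> \<rho> by (intro mult_mono power_mono) auto
        moreover have "0 \<le> M * q ^ n" using M0 q by simp
        ultimately show ?thesis using 1 by simp
      next
        case 2
        then have "0 \<le> h x * K x ^ n" using d1(2)[OF x] \<eta> K0[OF x] by (intro mult_nonneg_nonneg) auto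
        moreover have "0 \<le> M * q ^ n" using M0 q by simp
        ultimately show ?thesis using 2 by simp
      next
        case 3
        have "\<bar>h x * K x ^ n\<bar> \<le> M * q ^ n"
          unfolding abs_mult using M[OF x] K0[OF x] q(3)[OF x 3(2)] M0
          by (intro mult_mono) (auto intro: power_mono)
        then show ?thesis using 3 by simp
      qed
    qed
    then show ?thesis by (simp add: mult_ac)
  qed
  have pos: "0 < \<eta> * measure lborel (cbox c d)"
    using \<eta> cd(2) content_lt_nz content_eq_0_interior[of c d] by (intro mult_pos_pos) auto
  have "(\<lambda>n. M * measure lborel (cbox a b) * (q / \<rho>) ^ n) \<longlonglongrightarrow> M * measure lborel (cbox a b) * 0"
    using \<rho> q by (intro tendsto_mult_left LIMSEQ_realpow_zero) auto
  then have "\<forall>\<^sub>F n in sequentially. M * measure lborel (cbox a b) * (q / \<rho>) ^ n < \<eta> * measure lborel (cbox c d)"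
    using order_tendstoD(2) pos by fastforce
  then obtain n where "M * measure lborel (cbox a b) * (q / \<rho>) ^ n < \<eta> * measure lborel (cbox c d)"
    using eventually_happens'[OF sequentially_bot] by blast
  then have "M * measure lborel (cbox a b) * q ^ n < \<eta> * measure lborel (cbox c d) * \<rho> ^ n"
    using \<rho> by (simp add: power_divide field_simps)
  then show False using le[of n] by simp
qed

lemma peak_kernel_vanishing:
  fixes g :: "'a::euclidean_space \<Rightarrow> complex" and K :: "'a \<Rightarrow> real"
  assumes g: "continuous_on (cbox a b) g" and K: "continuous_on (cbox a b) K"
    and x0: "x0 \<in> box a b" and K1: "K x0 = 1"
    and K0: "\<And>x. x \<in> cbox a b \<Longrightarrow> 0 \<le> K x"
    and peak: "\<And>x. x \<in> cbox a b \<Longrightarrow> x \<noteq> x0 \<Longrightarrow> K x < 1"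
    and int: "\<And>n. integral (cbox a b) (\<lambda>x. g x * complex_of_real (K x ^ n)) = 0"
  shows "g x0 = 0"
proof -
  have "((\<lambda>x. Re (cnj (g x0) * g x) * K x ^ n) has_integral 0) (cbox a b)" for n
  proof -
    have "continuous_on (cbox a b) (\<lambda>x. g x * complex_of_real (K x ^ n))"
      by (intro continuous_intros g K)
    then have "((\<lambda>x. g x * complex_of_real (K x ^ n)) has_integral 0) (cbox a b)"
      using integrable_integral[OF integrable_continuous] int by metis
    then have "((\<lambda>x. cnj (g x0) * (g x * complex_of_real (K x ^ n))) has_integral cnj (g x0) * 0) (cbox a b)"
      by (rule has_integral_mult_right)
    from has_integral_linear[OF this bounded_linear_Re]
    show ?thesis by (simp add: o_def algebra_simps flip: of_real_power)
  qed
  then have "Re (cnj (g x0) * g x0) \<le> 0"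
    by (intro peak_kernel_nonpos[of a b "\<lambda>x. Re (cnj (g x0) * g x)" K x0] continuous_intros g K x0 K1 K0 peak)
      auto
  then have "(cmod (g x0))\<^sup>2 \<le> 0"
    unfolding cmod_power2 by (simp add: power2_eq_square)
  then show ?thesis by simp
qed

text \<open>
  The kernel with factors \<open>(1 + cos (x \<bullet> b - x0 \<bullet> b)) / 2\<close> is a trigonometric polynomial with values
  in \<open>{0..1}\<close>, hence so are its powers, and \<open>g\<close> is orthogonal to all of them. For \<open>x0\<close> in the open cube
  the value \<open>1\<close> is taken at \<open>x0\<close> only, and the peak argument applies. Boundary points follow
  by continuity.
\<close>

lemma fourier_uniqueness:
  fixes g :: "'a::euclidean_space \<Rightarrow> complex"
  assumes g: "continuous_on UNIV g" and per: "torus_periodic g"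
    and coeff: "\<And>z. z \<in> lattice \<Longrightarrow> torus_integral (\<lambda>x. g x * character z x) = 0"
  shows "g x = 0"
proof -
  have interior: "g x0 = 0" if x0: "x0 \<in> box 0 (\<Sum>b\<in>Basis. (2 * pi) *\<^sub>R b)" for x0
  proof -
    define k where "k b x = (1 + cos (x \<bullet> b - x0 \<bullet> b)) / 2" for b x :: 'a
    \<comment> \<open>the functions whose product with \<open>g\<close> is orthogonal to all characters\<close>
    define orth where "orth h \<longleftrightarrow> continuous_on UNIV h \<and>
      (\<forall>z\<in>lattice. torus_integral (\<lambda>x. g x * h x * character z x) = 0)" for h
    have char_cont: "continuous_on UNIV (character z)" for z :: 'a
      unfolding character_def by (auto intro!: continuous_intros)
    have step: "orth (\<lambda>x. h x * complex_of_real (k b x))" if h: "orth h" and b: "b \<in> Basis" for h b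
      unfolding orth_def
    proof (intro conjI ballI)
      have hc: "continuous_on UNIV h" using h by (simp add: orth_def)
      show "continuous_on UNIV (\<lambda>x. h x * complex_of_real (k b x))"
        unfolding k_def by (intro continuous_intros hc) auto
      fix z :: 'a assume z: "z \<in> lattice"
      have k: "complex_of_real (k b x) = 1 / 2 + cis (- (x0 \<bullet> b)) / 4 * character b x + cis (x0 \<bullet> b) / 4 * character (- b) x" for x
        by (simp add: k_def character_def complex_eq_iff cos_diff inner_commute field_simps)
      have "torus_integral (\<lambda>x. g x * (h x * complex_of_real (k b x)) * character z x) =
        torus_integral (\<lambda>x. 1 / 2 * (g x * h x * character z x)
          + cis (- (x0 \<bullet> b)) / 4 * (g x * h x * character (b + z) x)
          + cis (x0 \<bullet> b) / 4 * (g x * h x * character (- b + z) x))"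
        unfolding k character_add by (simp add: algebra_simps)
      also have "\<dots> = torus_integral (\<lambda>x. 1 / 2 * (g x * h x * character z x))
          + torus_integral (\<lambda>x. cis (- (x0 \<bullet> b)) / 4 * (g x * h x * character (b + z) x))
          + torus_integral (\<lambda>x. cis (x0 \<bullet> b) / 4 * (g x * h x * character (- b + z) x))"
        by (subst torus_integral_add; (intro continuous_intros g hc char_cont)?)+ simp
      also have "\<dots> = 0"
        unfolding torus_integral_cmult
        using h z b by (simp add: orth_def lattice_add lattice_uminus lattice_Basis del: character_add
          flip: uminus_add_conv_diff)
      finally show "torus_integral (\<lambda>x. g x * (h x * complex_of_real (k b x)) * character z x) = 0" .
    qed
    have step_prod: "orth (\<lambda>x. h x * complex_of_real (\<Prod>b\<in>B. k b x))" if h: "orth h" and B: "finite B" "B \<subseteq> Basis" for h B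
      using B
    proof (induction B)
      case (insert b B)
      then show ?case using step[of "\<lambda>x. h x * complex_of_real (\<Prod>b\<in>B. k b x)" b]
        by (simp add: mult_ac)
    qed (use h in simp)
    define K where "K x = (\<Prod>b\<in>Basis. k b x)" for x
    have orth: "orth (\<lambda>x. complex_of_real (K x ^ n))" for n
    proof (induction n)
      case 0
      then show ?case using coeff by (simp add: orth_def)
    next
      case (Suc n)
      then show ?case using step_prod[of "\<lambda>x. complex_of_real (K x ^ n)" Basis]
        by (simp add: K_def mult_ac)
    qed
    have k01: "0 \<le> k b x" "k b x \<le> 1" for b x
    proof -
      have "0 \<le> 1 + cos (x \<bullet> b - x0 \<bullet> b)" using cos_ge_minus_one[of "x \<bullet> b - x0 \<bullet> b"] by linarith
      then show "0 \<le> k b x" "k b x \<le> 1" by (simp_all add: k_def)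
    qed
    show ?thesis
    proof (rule peak_kernel_vanishing[of 0 "\<Sum>b\<in>Basis. (2 * pi) *\<^sub>R b" g K])
      show "continuous_on torus_cube g" using g continuous_on_subset by blast
      show "continuous_on torus_cube K"
        unfolding K_def k_def by (intro continuous_intros) auto
      show "x0 \<in> box 0 (\<Sum>b\<in>Basis. (2 * pi) *\<^sub>R b)" by (rule x0)
      show "K x0 = 1" by (simp add: K_def k_def)
      show "0 \<le> K x" for x unfolding K_def by (intro prod_nonneg) (auto simp: k01)
      show "K x < 1" if x: "x \<in> torus_cube" "x \<noteq> x0" for x
      proof -
        obtain b where b: "b \<in> Basis" "x \<bullet> b \<noteq> x0 \<bullet> b" using x(2) euclidean_eq_iff by blast
        have bounds: "0 \<le> x \<bullet> b" "x \<bullet> b \<le> 2 * pi" "0 < x0 \<bullet> b" "x0 \<bullet> b < 2 * pi"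
          using x(1) x0 b(1) by (auto simp: mem_box)
        have "cos (x \<bullet> b - x0 \<bullet> b) \<noteq> 1"
        proof
          assume "cos (x \<bullet> b - x0 \<bullet> b) = 1"
          then obtain n :: int where n: "x \<bullet> b - x0 \<bullet> b = of_int n * 2 * pi" using cos_one_2pi_int by blast
          then have "of_int n * (2 * pi) < 1 * (2 * pi)" "(- 1) * (2 * pi) < of_int n * (2 * pi)"
            using bounds by linarith+
          then have "n = 0"
            using mult_less_cancel_right_pos[of "2 * pi" "of_int n" 1]
              mult_less_cancel_right_pos[of "2 * pi" "- 1" "of_int n"] by simp
          then show False using n b by simp
        qed
        then have "cos (x \<bullet> b - x0 \<bullet> b) < 1"
          using cos_le_one[of "x \<bullet> b - x0 \<bullet> b"] by linarith
        then have "k b x < 1" by (simp add: k_def)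
        moreover have "K x = k b x * (\<Prod>b\<in>Basis - {b}. k b x)"
          unfolding K_def by (rule prod.remove) (use b in auto)
        moreover have "(\<Prod>b\<in>Basis - {b}. k b x) \<le> 1" by (intro prod_le_1) (auto simp: k01)
        ultimately show ?thesis using k01(1)[of b x]
          by (metis dual_order.strict_trans2 mult.right_neutral mult_left_mono order.strict_trans1)
      qed
      show "integral torus_cube (\<lambda>x. g x * complex_of_real (K x ^ n)) = 0" for n
        using orth[of n] unfolding orth_def torus_integral_def by (auto dest!: bspec[of _ _ 0])
    qed
  qed
  obtain y where y: "y \<in> torus_cube" "g y = g x" using torus_periodic_cube[OF per] by metis
  have "closure (box 0 (\<Sum>b\<in>Basis. (2 * pi) *\<^sub>R b)) = (torus_cube :: 'a set)"
    by (rule closure_box) (auto simp: box_ne_empty)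
  then have "g y = 0"
    using continuous_constant_on_closure[of "box 0 (\<Sum>b\<in>Basis. (2 * pi) *\<^sub>R b)" g 0 y] interior y
      continuous_on_subset[OF g] by auto
  then show ?thesis using y by simp
qed

section \<open>Series of smooth functions\<close>

text \<open>
  Absolute convergence of the series in every \<open>C^k\<close> norm, expressed by Weierstrass majorants.
\<close>

definition smooth_summable :: "(nat \<Rightarrow> 'a::euclidean_space \<Rightarrow> complex) \<Rightarrow> bool" where
  "smooth_summable f \<longleftrightarrow> (\<forall>k. f k \<in> smooth_torus) \<and>
     (\<forall>bs. set bs \<subseteq> Basis \<longrightarrow>
        (\<exists>B. summable B \<and> (\<forall>k x. cmod (fold partial_deriv bs (f k) x) \<le> B k)))"

lemma smooth_summableD: "smooth_summable f \<Longrightarrow> f k \<in> smooth_torus"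
  by (simp add: smooth_summable_def)

lemma smooth_summable_bound:
  assumes "smooth_summable f" "set bs \<subseteq> Basis"
  obtains B where "summable B" "\<And>k x. cmod (fold partial_deriv bs (f k) x) \<le> B k"
  using assms unfolding smooth_summable_def by blast

lemma smooth_summable_partial_deriv:
  assumes f: "smooth_summable f" and b: "b \<in> Basis"
  shows "smooth_summable (\<lambda>k. partial_deriv b (f k))"
  unfolding smooth_summable_def
proof (intro conjI allI impI)
  show "partial_deriv b (f k) \<in> smooth_torus" for k
    using smooth_summableD[OF f] b by (rule smooth_torus_partial_deriv)
  fix bs :: "'a list" assume "set bs \<subseteq> Basis"
  then have "set (b # bs) \<subseteq> Basis" using b by simp
  from smooth_summable_bound[OF f this]
  show "\<exists>B. summable B \<and> (\<forall>k x. cmod (fold partial_deriv bs (partial_deriv b (f k)) x) \<le> B k)"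
    by (metis fold_simps(2))
qed

lemma smooth_summable_uniform_limit:
  assumes "smooth_summable f"
  shows "uniform_limit UNIV (\<lambda>n x. \<Sum>k<n. f k x) (\<lambda>x. \<Sum>k. f k x) sequentially"
proof -
  obtain B where "summable B" "\<And>k x. cmod (f k x) \<le> B k"
    using smooth_summable_bound[OF assms, of "[]"] by auto
  then show ?thesis by (intro Weierstrass_m_test)
qed

lemma smooth_summable_summable:
  assumes "smooth_summable f" shows "summable (\<lambda>k. f k x)"
proof -
  obtain B where "summable B" "\<And>k x. cmod (f k x) \<le> B k"
    using smooth_summable_bound[OF assms, of "[]"] by auto
  then show ?thesis by (intro summable_comparison_test[of "\<lambda>k. f k x" B]) auto
qed

text \<open>
  Uniform convergence of the partial derivatives gives uniform convergence of the Frechet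
  derivatives, since these are finite combinations of partial derivatives with coefficients bounded
  by the norm of the increment.
\<close>

lemma has_derivative_smooth_series:
  fixes f :: "nat \<Rightarrow> 'a::euclidean_space \<Rightarrow> complex"
  assumes f: "smooth_summable f"
  shows "((\<lambda>x. \<Sum>k. f k x) has_derivative
     (\<lambda>h. \<Sum>b\<in>Basis. (h \<bullet> b) *\<^sub>R (\<Sum>k. partial_deriv b (f k) x))) (at x)"
proof -
  let ?f' = "\<lambda>k x h. \<Sum>b\<in>Basis. (h \<bullet> b) *\<^sub>R partial_deriv b (f k) x"
  let ?g' = "\<lambda>x h. \<Sum>b\<in>Basis. (h \<bullet> b) *\<^sub>R (\<Sum>k. partial_deriv b (f k) x)"
  have "\<exists>g. \<forall>x\<in>UNIV. (\<lambda>k. f k x) sums g x \<and> (g has_derivative ?g' x) (at x within UNIV)"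
  proof (rule has_derivative_series[where f' = ?f'])
    show "(f k has_derivative ?f' k x) (at x within UNIV)" for k x
      using has_derivative_partial_deriv[OF smooth_torus_differentiable[OF smooth_summableD[OF f]]] by simp
    show "(\<lambda>k. f k 0) sums (\<Sum>k. f k 0)"
      using smooth_summable_summable[OF f] by (rule summable_sums)
    fix e :: real assume e: "0 < e"
    have "\<forall>\<^sub>F n in sequentially. \<forall>b\<in>Basis. \<forall>x\<in>UNIV.
        dist (\<Sum>k<n. partial_deriv b (f k) x) (\<Sum>k. partial_deriv b (f k) x) < e / DIM('a)"
      using e by (intro eventually_ball_finite[OF finite_Basis] ballI)
        (rule uniform_limitD[OF smooth_summable_uniform_limit[OF smooth_summable_partial_deriv[OF f]]], auto)
    then show "\<forall>\<^sub>F n in sequentially. \<forall>x\<in>UNIV. \<forall>h. norm ((\<Sum>k<n. ?f' k x h) - ?g' x h) \<le> e * norm h"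
    proof eventually_elim
      fix n assume n: "\<forall>b\<in>Basis. \<forall>x\<in>UNIV.
        dist (\<Sum>k<n. partial_deriv b (f k) x) (\<Sum>k. partial_deriv b (f k) x) < e / DIM('a)"
      show "\<forall>x\<in>UNIV. \<forall>h. norm ((\<Sum>k<n. ?f' k x h) - ?g' x h) \<le> e * norm h"
      proof (intro ballI allI)
        fix x h :: 'a
        have "(\<Sum>k<n. ?f' k x h) = (\<Sum>b\<in>Basis. (h \<bullet> b) *\<^sub>R (\<Sum>k<n. partial_deriv b (f k) x))"
          by (subst sum.swap) (simp add: scaleR_sum_right)
        then have "norm ((\<Sum>k<n. ?f' k x h) - ?g' x h) =
          norm (\<Sum>b\<in>Basis. (h \<bullet> b) *\<^sub>R ((\<Sum>k<n. partial_deriv b (f k) x) - (\<Sum>k. partial_deriv b (f k) x)))"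
          by (simp add: sum_subtractf scaleR_diff_right)
        also have "\<dots> \<le> (\<Sum>b\<in>(Basis::'a set). norm h * (e / DIM('a)))"
        proof (intro order_trans[OF norm_sum] sum_mono)
          fix b :: 'a assume b: "b \<in> Basis"
          show "norm ((h \<bullet> b) *\<^sub>R ((\<Sum>k<n. partial_deriv b (f k) x) - (\<Sum>k. partial_deriv b (f k) x)))
             \<le> norm h * (e / DIM('a))"
            unfolding norm_scaleR real_norm_def
            by (intro mult_mono) (use b n Basis_le_norm[OF b, of h] in \<open>auto simp: dist_norm less_imp_le\<close>)
        qed
        also have "\<dots> = e * norm h" by simp
        finally show "norm ((\<Sum>k<n. ?f' k x h) - ?g' x h) \<le> e * norm h" .
      qed
    qed
  qed auto
  then obtain g where g: "\<And>x. (\<lambda>k. f k x) sums g x" "\<And>x. (g has_derivative ?g' x) (at x)" by auto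
  then have "g = (\<lambda>x. \<Sum>k. f k x)" by (simp add: fun_eq_iff sums_iff)
  with g show ?thesis by simp
qed

lemma partial_deriv_smooth_series:
  assumes f: "smooth_summable f" and b: "b \<in> Basis"
  shows "partial_deriv b (\<lambda>x. \<Sum>k. f k x) = (\<lambda>x. \<Sum>k. partial_deriv b (f k) x)"
proof
  fix x
  show "partial_deriv b (\<lambda>x. \<Sum>k. f k x) x = (\<Sum>k. partial_deriv b (f k) x)"
    unfolding partial_deriv_eq[OF has_derivative_smooth_series[OF f]]
    using b by (simp add: inner_Basis if_distrib[of "\<lambda>r. r *\<^sub>R _"] cong: if_cong)
qed

lemma smooth_torus_series:
  assumes f: "smooth_summable f"
  shows "(\<lambda>x. \<Sum>k. f k x) \<in> smooth_torus"
proof (rule smooth_torus_coinduct[of _ "{\<lambda>x. \<Sum>k. f k x | f. smooth_summable f}"])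
  fix F :: "'a \<Rightarrow> complex" assume "F \<in> {\<lambda>x. \<Sum>k. f k x | f. smooth_summable f}"
  then obtain f where F: "F = (\<lambda>x. \<Sum>k. f k x)" and f: "smooth_summable f" by blast
  show "torus_periodic F"
    using smooth_torus_periodic[OF smooth_summableD[OF f]] by (simp add: F torus_periodic_def)
  show "F differentiable (at x)" for x
    unfolding F differentiable_def using has_derivative_smooth_series[OF f] by blast
  show "partial_deriv b F \<in> {\<lambda>x. \<Sum>k. f k x | f. smooth_summable f}" if b: "b \<in> Basis" for b
    unfolding F partial_deriv_smooth_series[OF f b]
    by (intro CollectI exI[of _ "\<lambda>k. partial_deriv b (f k)"] conjI refl smooth_summable_partial_deriv[OF f b])
qed (use f in blast)

lemma fold_partial_deriv_smooth_series:
  assumes "smooth_summable f" "set bs \<subseteq> Basis"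
  shows "fold partial_deriv bs (\<lambda>x. \<Sum>k. f k x) = (\<lambda>x. \<Sum>k. fold partial_deriv bs (f k) x)"
  using assms
  by (induction bs arbitrary: f) (simp_all add: partial_deriv_smooth_series smooth_summable_partial_deriv)

lemma torus_integral_smooth_series:
  fixes f :: "nat \<Rightarrow> 'a::euclidean_space \<Rightarrow> complex"
  assumes f: "smooth_summable f" and \<phi>: "\<phi> \<in> smooth_torus"
  shows "(\<lambda>k. torus_integral (\<lambda>x. f k x * \<phi> x)) sums torus_integral (\<lambda>x. (\<Sum>k. f k x) * \<phi> x)"
proof -
  obtain B where B: "summable B" "\<And>k x. cmod (f k x) \<le> B k"
    using smooth_summable_bound[OF f, of "[]"] by auto
  obtain M where M: "\<And>x. cmod (\<phi> x) \<le> M"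
    using smooth_torus_bounded[OF \<phi>] unfolding bdd_above_def by auto
  have cont: "continuous_on S (\<lambda>x. f k x * \<phi> x)" for k S
    by (intro smooth_torus_continuous smooth_torus_mult smooth_summableD[OF f] \<phi>)
  have "uniform_limit torus_cube (\<lambda>n x. \<Sum>k<n. f k x * \<phi> x) (\<lambda>x. \<Sum>k. f k x * \<phi> x) sequentially"
  proof (rule Weierstrass_m_test)
    show "cmod (f k x * \<phi> x) \<le> B k * M" for k x
      unfolding norm_mult using B(2)[of k x] M[of x] by (intro mult_mono) (auto intro: order_trans[OF norm_ge_zero])
    show "summable (\<lambda>k. B k * M)" using B(1) by (rule summable_mult2)
  qed
  then obtain I J where IJ: "\<And>n. ((\<lambda>x. \<Sum>k<n. f k x * \<phi> x) has_integral I n) torus_cube"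
    "((\<lambda>x. \<Sum>k. f k x * \<phi> x) has_integral J) torus_cube" "I \<longlonglongrightarrow> J"
    by (rule uniform_limit_integral_cbox) (auto intro!: continuous_on_sum cont)
  have "I n = (\<Sum>k<n. torus_integral (\<lambda>x. f k x * \<phi> x))" for n
    using integral_unique[OF IJ(1)] unfolding torus_integral_def
    by (subst (asm) integral_sum) (auto intro: integrable_torus_cube cont)
  moreover have "J = torus_integral (\<lambda>x. (\<Sum>k. f k x) * \<phi> x)"
    using integral_unique[OF IJ(2)] suminf_mult2[OF smooth_summable_summable[OF f]]
    unfolding torus_integral_def by simp
  ultimately have "(\<lambda>n. \<Sum>k<n. torus_integral (\<lambda>x. f k x * \<phi> x)) \<longlonglongrightarrow>
      torus_integral (\<lambda>x. (\<Sum>k. f k x) * \<phi> x)" using IJ(3) by (metis (no_types, lifting) ext)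
  then show ?thesis by (simp add: sums_def)
qed

lemma torus_distribution_add:
  "torus_distribution u \<Longrightarrow> \<phi> \<in> smooth_torus \<Longrightarrow> \<psi> \<in> smooth_torus \<Longrightarrow> u (\<lambda>x. \<phi> x + \<psi> x) = u \<phi> + u \<psi>"
  by (simp add: torus_distribution_def)

lemma torus_distribution_cmult:
  "torus_distribution u \<Longrightarrow> \<phi> \<in> smooth_torus \<Longrightarrow> u (\<lambda>x. a * \<phi> x) = a * u \<phi>"
  by (simp add: torus_distribution_def)

lemma torus_distribution_0: "torus_distribution u \<Longrightarrow> u (\<lambda>x. 0) = 0"
  using torus_distribution_cmult[of u "\<lambda>x. 0" 0] by simp

lemma torus_distribution_sum:
  assumes u: "torus_distribution u" and "\<And>i. i \<in> I \<Longrightarrow> f i \<in> smooth_torus"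
  shows "u (\<lambda>x. \<Sum>i\<in>I. f i x) = (\<Sum>i\<in>I. u (f i))"
  using assms(2)
  by (induction I rule: infinite_finite_induct)
    (simp_all add: torus_distribution_0[OF u] torus_distribution_add[OF u] smooth_torus_sum)

text \<open>
  A distribution is continuous for one of the norms \<open>torus_Ck_norm j\<close>. In that norm the remainder of
  the series is bounded by finitely many tails of convergent majorants.
\<close>

lemma torus_distribution_series:
  fixes f :: "nat \<Rightarrow> 'a::euclidean_space \<Rightarrow> complex"
  assumes u: "torus_distribution u" and f: "smooth_summable f"
  shows "(\<lambda>k. u (f k)) sums u (\<lambda>x. \<Sum>k. f k x)"
proof -
  let ?F = "\<lambda>x. \<Sum>k. f k x" and ?S = "\<lambda>n x. \<Sum>k<n. f k x"
  obtain C j where C: "\<And>\<phi>. \<phi> \<in> smooth_torus \<Longrightarrow> cmod (u \<phi>) \<le> C * torus_Ck_norm j \<phi>"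
    using u unfolding torus_distribution_def by blast
  define BS where "BS = {bs :: 'a list. set bs \<subseteq> Basis \<and> length bs \<le> j}"
  have "\<exists>B. \<forall>bs\<in>BS. summable (B bs) \<and> (\<forall>k x. cmod (fold partial_deriv bs (f k) x) \<le> B bs k)"
    using f unfolding smooth_summable_def BS_def by (intro bchoice) auto
  then obtain B where B: "\<And>bs. bs \<in> BS \<Longrightarrow> summable (B bs)"
    "\<And>bs k x. bs \<in> BS \<Longrightarrow> cmod (fold partial_deriv bs (f k) x) \<le> B bs k" by auto
  have S: "?S n \<in> smooth_torus" and F: "?F \<in> smooth_torus" for n
    by (intro smooth_torus_sum smooth_torus_series f smooth_summableD[OF f])+
  define R where "R n = (\<lambda>x. \<Sum>k. f (k + n) x)" for n
  have R_summable: "smooth_summable (\<lambda>k. f (k + n))" for n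
    unfolding smooth_summable_def
  proof (intro conjI allI impI)
    fix bs :: "'a list" assume "set bs \<subseteq> Basis"
    then obtain B where "summable B" "\<And>k x. cmod (fold partial_deriv bs (f k) x) \<le> B k"
      using smooth_summable_bound[OF f] by metis
    then show "\<exists>B. summable B \<and> (\<forall>k x. cmod (fold partial_deriv bs (f (k + n)) x) \<le> B k)"
      by (intro exI[of _ "\<lambda>k. B (k + n)"]) auto
  qed (rule smooth_summableD[OF f])
  have R: "R n \<in> smooth_torus" for n unfolding R_def by (rule smooth_torus_series[OF R_summable])
  have split: "?F = (\<lambda>x. R n x + ?S n x)" for n
    unfolding R_def using suminf_split_initial_segment[OF smooth_summable_summable[OF f]] by auto
  have norm_R: "torus_Ck_norm j (R n) \<le> (\<Sum>bs\<in>BS. \<Sum>k. B bs (k + n))" for n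
    unfolding BS_def
  proof (rule torus_Ck_norm_least)
    fix bs :: "'a list" and x :: 'a assume bs: "set bs \<subseteq> Basis" "length bs \<le> j"
    then have "bs \<in> BS" by (simp add: BS_def)
    then have "summable (\<lambda>k. B bs (k + n))" "\<And>k. cmod (fold partial_deriv bs (f (k + n)) x) \<le> B bs (k + n)"
      using B summable_iff_shift by blast+
    then show "cmod (fold partial_deriv bs (R n) x) \<le> (\<Sum>k. B bs (k + n))"
      unfolding R_def fold_partial_deriv_smooth_series[OF R_summable bs(1)] by (rule norm_suminf_le[rotated])
  qed
  have diff: "u ?F - (\<Sum>k<n. u (f k)) = u (R n)" for n
  proof -
    have "u (\<lambda>x. R n x + ?S n x) = u (R n) + u (?S n)"
      by (rule torus_distribution_add[OF u R S])
    then show ?thesis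
      using split[of n] torus_distribution_sum[OF u, of "{..<n}" f] smooth_summableD[OF f] by simp
  qed
  have "(\<lambda>n. \<Sum>bs\<in>BS. \<Sum>k. B bs (k + n)) \<longlonglongrightarrow> (\<Sum>bs\<in>BS. 0)"
    by (intro tendsto_sum suminf_exist_split2 B)
  then have lim: "(\<lambda>n. \<bar>C\<bar> * (\<Sum>bs\<in>BS. \<Sum>k. B bs (k + n))) \<longlonglongrightarrow> 0"
    using tendsto_mult_left by fastforce
  have "(\<lambda>n. u ?F - (\<Sum>k<n. u (f k))) \<longlonglongrightarrow> 0"
  proof (rule Lim_null_comparison[OF _ lim], rule always_eventually, rule allI)
    fix n
    have "cmod (u (R n)) \<le> C * torus_Ck_norm j (R n)" by (rule C[OF R])
    also have "\<dots> \<le> \<bar>C\<bar> * torus_Ck_norm j (R n)"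
      by (intro mult_right_mono torus_Ck_norm_nonneg R) auto
    also have "\<dots> \<le> \<bar>C\<bar> * (\<Sum>bs\<in>BS. \<Sum>k. B bs (k + n))" by (intro mult_left_mono norm_R) auto
    finally show "cmod (u ?F - (\<Sum>k<n. u (f k))) \<le> \<bar>C\<bar> * (\<Sum>bs\<in>BS. \<Sum>k. B bs (k + n))"
      by (simp add: diff)
  qed
  from tendsto_diff[OF tendsto_const[of "u ?F"] this] show ?thesis by (simp add: sums_def)
qed

section \<open>Fourier series and smoothness of distributions\<close>

lemma summable_inverse_one_plus_square: "summable (\<lambda>n. 1 / (1 + (real n)\<^sup>2))"
proof (rule summable_comparison_test)
  show "summable (\<lambda>n. 2 * (1 / (real n + 1)\<^sup>2))"
    using inverse_squares_sums by (intro summable_mult sums_summable) (simp add: add.commute)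
  have "(real n + 1)\<^sup>2 \<le> 2 * (1 + (real n)\<^sup>2)" for n
    using sum_squares_ge_zero[of "real n - 1" 0] by (simp add: power2_eq_square algebra_simps)
  then show "\<exists>N. \<forall>n\<ge>N. norm (1 / (1 + (real n)\<^sup>2)) \<le> 2 * (1 / (real n + 1)\<^sup>2)"
    by (auto simp: divide_simps add_pos_nonneg intro!: exI[of _ 0])
qed

text \<open>
  The nonnegative and the negative integers of \<open>I\<close> are each mapped injectively into the naturals by
  the absolute value.
\<close>

lemma bounded_sums_inverse_one_plus_square_int:
  obtains S where "0 \<le> S" "\<And>I :: int set. finite I \<Longrightarrow> (\<Sum>n\<in>I. 1 / (1 + (of_int n :: real)\<^sup>2)) \<le> S"
proof -
  let ?v = "\<lambda>n::int. 1 / (1 + (of_int n :: real)\<^sup>2)"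
  define S where "S = (\<Sum>n. 1 / (1 + (real n)\<^sup>2))"
  have S: "(\<Sum>n\<in>J. 1 / (1 + (real n)\<^sup>2)) \<le> S" if "finite J" for J
    unfolding S_def by (rule sum_le_suminf[OF summable_inverse_one_plus_square that]) auto
  have bound: "(\<Sum>n\<in>I. ?v n) \<le> S" if "finite I" "inj_on (\<lambda>n. nat \<bar>n\<bar>) I" for I
  proof -
    have "(\<Sum>n\<in>I. ?v n) = (\<Sum>n\<in>(\<lambda>n. nat \<bar>n\<bar>) ` I. 1 / (1 + (real n)\<^sup>2))"
      by (subst sum.reindex[OF that(2)]) (simp add: power2_eq_square abs_mult_self_eq)
    then show ?thesis using S[of "(\<lambda>n. nat \<bar>n\<bar>) ` I"] that by simp
  qed
  show ?thesis
  proof (rule that[of "S + S"])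
    show "0 \<le> S + S" using S[of "{}"] by simp
    fix I :: "int set" assume I: "finite I"
    have "(\<Sum>n\<in>I. ?v n) = (\<Sum>n\<in>{n\<in>I. 0 \<le> n}. ?v n) + (\<Sum>n\<in>{n\<in>I. \<not> 0 \<le> n}. ?v n)"
    proof -
      have "(\<Sum>n\<in>{n\<in>I. 0 \<le> n} \<union> {n\<in>I. \<not> 0 \<le> n}. ?v n) =
          (\<Sum>n\<in>{n\<in>I. 0 \<le> n}. ?v n) + (\<Sum>n\<in>{n\<in>I. \<not> 0 \<le> n}. ?v n)"
        using I by (intro sum.union_disjoint) auto
      moreover have "{n\<in>I. 0 \<le> n} \<union> {n\<in>I. \<not> 0 \<le> n} = I" by blast
      ultimately show ?thesis by (simp only:)
    qed
    also have "\<dots> \<le> S + S" using I by (intro add_mono bound) (auto simp: inj_on_def)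
    finally show "(\<Sum>n\<in>I. ?v n) \<le> S + S" .
  qed
qed

text \<open>
  Since \<open>(1 + norm z)\<^sup>2 \<ge> 1 + (z \<bullet> b)\<^sup>2\<close> for every coordinate, the summand is dominated by a product over
  the coordinates, and a sum of such products over a box is a product of one-dimensional sums.
\<close>

lemma bounded_lattice_sums:
  obtains C where "\<And>F :: 'a::euclidean_space set. finite F \<Longrightarrow> F \<subseteq> lattice \<Longrightarrow>
     (\<Sum>z\<in>F. 1 / (1 + norm z) ^ (2 * DIM('a))) \<le> C"
proof -
  obtain S where S: "0 \<le> S" "\<And>I :: int set. finite I \<Longrightarrow> (\<Sum>n\<in>I. 1 / (1 + (of_int n :: real)\<^sup>2)) \<le> S"
    using bounded_sums_inverse_one_plus_square_int by metis
  let ?v = "\<lambda>n::int. 1 / (1 + (of_int n :: real)\<^sup>2)"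
  show ?thesis
  proof (rule that)
    fix F :: "'a set" assume F: "finite F" "F \<subseteq> lattice"
    define coord where "coord z = restrict (\<lambda>b. \<lfloor>z \<bullet> b\<rfloor>) Basis" for z :: 'a
    define I where "I b = (\<lambda>z. \<lfloor>z \<bullet> b\<rfloor>) ` F" for b :: 'a
    have coord: "of_int (coord z b) = z \<bullet> b" if "z \<in> F" "b \<in> Basis" for z b
      using that F by (auto simp: coord_def lattice_def Ints_def)
    have inj: "inj_on coord F"
    proof (rule inj_onI)
      fix z w assume zw: "z \<in> F" "w \<in> F" "coord z = coord w"
      show "z = w"
      proof (rule euclidean_eqI)
        show "z \<bullet> b = w \<bullet> b" if "b \<in> Basis" for b
          using coord[OF zw(1) that] coord[OF zw(2) that] zw(3) by simp
      qed
    qed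
    have "1 / (1 + norm z) ^ (2 * DIM('a)) \<le> (\<Prod>b\<in>Basis. ?v (coord z b))" if z: "z \<in> F" for z
    proof -
      have "(\<Prod>b\<in>(Basis::'a set). 1 / (1 + norm z)\<^sup>2) \<le> (\<Prod>b\<in>Basis. ?v (coord z b))"
      proof (rule prod_mono, rule conjI)
        fix b :: 'a assume b: "b \<in> Basis"
        have "\<bar>z \<bullet> b\<bar>\<^sup>2 \<le> (norm z)\<^sup>2" using Basis_le_norm[OF b, of z] by (intro power_mono) auto
        then have "1 + (z \<bullet> b)\<^sup>2 \<le> (1 + norm z)\<^sup>2"
          using norm_ge_zero[of z] unfolding power2_sum by (simp del: norm_ge_zero)
        then show "1 / (1 + norm z)\<^sup>2 \<le> ?v (coord z b)"
          unfolding coord[OF z b] by (intro divide_left_mono mult_pos_pos zero_less_power add_pos_nonneg) auto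
      qed auto
      then show ?thesis by (simp add: power_mult power_one_over power_divide)
    qed
    then have "(\<Sum>z\<in>F. 1 / (1 + norm z) ^ (2 * DIM('a))) \<le> (\<Sum>z\<in>F. \<Prod>b\<in>Basis. ?v (coord z b))"
      by (rule sum_mono)
    also have "\<dots> = (\<Sum>g\<in>coord ` F. \<Prod>b\<in>Basis. ?v (g b))"
      by (simp add: sum.reindex[OF inj])
    also have "\<dots> \<le> (\<Sum>g\<in>PiE Basis I. \<Prod>b\<in>Basis. ?v (g b))"
      by (rule sum_mono2)
        (auto simp: I_def coord_def F intro!: finite_PiE prod_nonneg)
    also have "\<dots> = (\<Prod>b\<in>Basis. \<Sum>n\<in>I b. ?v n)"
      by (rule prod_sum_PiE[symmetric]) (auto simp: I_def F)
    also have "\<dots> \<le> (\<Prod>b\<in>(Basis::'a set). S)"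
      by (intro prod_mono conjI sum_nonneg S) (auto simp: I_def F)
    finally show "(\<Sum>z\<in>F. 1 / (1 + norm z) ^ (2 * DIM('a))) \<le> S ^ DIM('a)" by simp
  qed
qed

lemma summable_lattice:
  fixes e :: "nat \<Rightarrow> 'a::euclidean_space"
  assumes e: "inj e" "range e \<subseteq> lattice"
  shows "summable (\<lambda>k. 1 / (1 + norm (e k)) ^ (2 * DIM('a)))"
proof -
  obtain C where C: "\<And>F :: 'a set. finite F \<Longrightarrow> F \<subseteq> lattice \<Longrightarrow>
     (\<Sum>z\<in>F. 1 / (1 + norm z) ^ (2 * DIM('a))) \<le> C"
    using bounded_lattice_sums by metis
  show ?thesis
  proof (rule summableI_nonneg_bounded)
    fix n
    have "(\<Sum>k<n. 1 / (1 + norm (e k)) ^ (2 * DIM('a))) = (\<Sum>z\<in>e ` {..<n}. 1 / (1 + norm z) ^ (2 * DIM('a)))"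
      by (subst sum.reindex) (use e in \<open>auto simp: inj_on_def\<close>)
    also have "\<dots> \<le> C" using e by (intro C) auto
    finally show "(\<Sum>k<n. 1 / (1 + norm (e k)) ^ (2 * DIM('a))) \<le> C" .
  qed auto
qed

lemma lattice_enumeration:
  obtains e :: "nat \<Rightarrow> 'a::euclidean_space" where "bij_betw e UNIV lattice"
proof -
  have "(lattice :: 'a set) \<subseteq> (\<lambda>g. \<Sum>b\<in>Basis. of_int (g b) *\<^sub>R b) ` (PiE Basis (\<lambda>b. UNIV :: int set))"
  proof
    fix z :: 'a assume z: "z \<in> lattice"
    have eq: "z = (\<Sum>b\<in>Basis. of_int (restrict (\<lambda>b. \<lfloor>z \<bullet> b\<rfloor>) Basis b) *\<^sub>R b)"
    proof -
      have "(\<Sum>b\<in>Basis. of_int (restrict (\<lambda>b. \<lfloor>z \<bullet> b\<rfloor>) Basis b) *\<^sub>R b) = (\<Sum>b\<in>Basis. (z \<bullet> b) *\<^sub>R b)"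
        using z by (intro sum.cong) (auto simp: lattice_def Ints_def)
      then show ?thesis by (simp add: euclidean_representation)
    qed
    show "z \<in> (\<lambda>g. \<Sum>b\<in>Basis. of_int (g b) *\<^sub>R b) ` (PiE Basis (\<lambda>b. UNIV :: int set))"
      by (subst eq, rule imageI) (auto simp: PiE_iff extensional_def)
  qed
  then have "countable (lattice :: 'a set)"
    by (rule countable_subset) (intro countable_image countable_PiE finite_Basis, simp)
  moreover have "infinite (lattice :: 'a set)"
  proof
    assume fin: "finite (lattice :: 'a set)"
    obtain b :: 'a where b: "b \<in> Basis" using nonempty_Basis by blast
    have "range (\<lambda>n::nat. real n *\<^sub>R b) \<subseteq> lattice"
      using b by (auto simp: lattice_def inner_Basis)
    moreover have "inj (\<lambda>n::nat. real n *\<^sub>R b)" using b by (auto simp: inj_on_def)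
    ultimately show False using fin by (meson finite_imageD finite_subset infinite_UNIV_nat)
  qed
  ultimately show ?thesis using that bij_betw_from_nat_into by blast
qed

definition rapidly_decaying :: "('a::euclidean_space \<Rightarrow> complex) \<Rightarrow> bool" where
  "rapidly_decaying a \<longleftrightarrow> (\<forall>M. \<exists>C. \<forall>z\<in>lattice. cmod (a z) * (1 + norm z) ^ M \<le> C)"

lemma rapidly_decaying_reflect: "rapidly_decaying a \<Longrightarrow> rapidly_decaying (\<lambda>z. a (- z))"
  unfolding rapidly_decaying_def by (metis lattice_uminus norm_minus_cancel)

lemma rapidly_decaying_divide:
  assumes "rapidly_decaying a" shows "rapidly_decaying (\<lambda>z. a z / c)"
  unfolding rapidly_decaying_def
proof
  fix M
  obtain C where C: "\<And>z. z \<in> lattice \<Longrightarrow> cmod (a z) * (1 + norm z) ^ M \<le> C"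
    using assms unfolding rapidly_decaying_def by blast
  have "cmod (a z / c) * (1 + norm z) ^ M \<le> C / cmod c" if "z \<in> lattice" for z
    using divide_right_mono[OF C[OF that], of "cmod c"] by (simp add: norm_divide)
  then show "\<exists>C. \<forall>z\<in>lattice. cmod (a z / c) * (1 + norm z) ^ M \<le> C" by blast
qed

lemma smooth_summable_fourier_series:
  fixes e :: "nat \<Rightarrow> 'a::euclidean_space"
  assumes a: "rapidly_decaying a" and e: "inj e" "range e \<subseteq> lattice"
  shows "smooth_summable (\<lambda>k x. a (e k) * character (e k) x)"
  unfolding smooth_summable_def
proof (intro conjI allI impI)
  have e': "e k \<in> lattice" for k using e by auto
  show "(\<lambda>x. a (e k) * character (e k) x) \<in> smooth_torus" for k
    by (intro smooth_torus_cmult smooth_torus_character e')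
  fix bs :: "'a list" assume bs: "set bs \<subseteq> Basis"
  obtain C where C: "\<And>z. z \<in> lattice \<Longrightarrow> cmod (a z) * (1 + norm z) ^ (length bs + 2 * DIM('a)) \<le> C"
    using a unfolding rapidly_decaying_def by blast
  have "cmod (fold partial_deriv bs (\<lambda>x. a (e k) * character (e k) x) x)
      \<le> C * (1 / (1 + norm (e k)) ^ (2 * DIM('a)))" for k x
  proof -
    have pos: "0 < (1 + norm (e k)) ^ (2 * DIM('a))" by (intro zero_less_power add_pos_nonneg) auto
    have "cmod (fold partial_deriv bs (\<lambda>x. a (e k) * character (e k) x) x) =
        cmod (a (e k)) * cmod (fold partial_deriv bs (character (e k)) x)"
      by (simp add: fold_partial_deriv_cmult[OF smooth_torus_character[OF e'] bs] norm_mult)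
    also have "\<dots> \<le> cmod (a (e k)) * (1 + norm (e k)) ^ length bs"
      by (intro mult_left_mono norm_fold_partial_deriv_character e' bs) auto
    also have "\<dots> \<le> C * (1 / (1 + norm (e k)) ^ (2 * DIM('a)))"
      using C[OF e', of k] pos by (simp add: field_simps power_add)
    finally show ?thesis .
  qed
  then show "\<exists>B. summable B \<and> (\<forall>k x. cmod (fold partial_deriv bs (\<lambda>x. a (e k) * character (e k) x) x) \<le> B k)"
    using summable_mult[OF summable_lattice[OF e], of C] by blast
qed

lemma rapidly_decaying_fourier_coefficients:
  fixes \<phi> :: "'a::euclidean_space \<Rightarrow> complex"
  assumes \<phi>: "\<phi> \<in> smooth_torus"
  shows "rapidly_decaying (\<lambda>z. torus_integral (\<lambda>x. \<phi> x * character z x))"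
  unfolding rapidly_decaying_def
proof (intro allI exI ballI)
  fix M and z :: 'a assume z: "z \<in> lattice"
  have "cmod (torus_integral (\<lambda>x. \<phi> x * character z x)) * (1 + norm z) ^ M \<le>
      (1 + (\<Sum>b\<in>Basis. \<bar>z \<bullet> b\<bar>)) ^ M * cmod (torus_integral (\<lambda>x. character z x * \<phi> x))"
    by (subst mult.commute) (intro mult_mono power_mono add_mono norm_le_l1, simp_all add: mult.commute sum_nonneg)
  also have "\<dots> \<le> (2 * pi) ^ DIM('a) * (1 + real DIM('a)) ^ M * torus_Ck_norm M \<phi>"
    by (rule torus_oscillatory_integral_decay[OF smooth_torus_character[OF z] _ order_refl _ \<phi>])
      (auto simp: partial_deriv_character)
  finally show "cmod (torus_integral (\<lambda>x. \<phi> x * character z x)) * (1 + norm z) ^ M \<le>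
     (2 * pi) ^ DIM('a) * (1 + real DIM('a)) ^ M * torus_Ck_norm M \<phi>" .
qed

text \<open>
  The Fourier series converges together with all derivatives, and it has the same Fourier
  coefficients as the function, so it equals the function by uniqueness. The characters carry the
  opposite sign to the coefficients because the pairing of distributions with functions is bilinear.
\<close>

lemma fourier_inversion:
  fixes e :: "nat \<Rightarrow> 'a::euclidean_space"
  assumes \<phi>: "\<phi> \<in> smooth_torus" and e: "bij_betw e UNIV lattice"
  defines "f \<equiv> \<lambda>k x. torus_integral (\<lambda>x. \<phi> x * character (e k) x) / (2 * pi) ^ DIM('a) * character (- e k) x"
  shows "smooth_summable f" "\<phi> = (\<lambda>x. \<Sum>k. f k x)"
proof -
  let ?c = "\<lambda>z. torus_integral (\<lambda>x. \<phi> x * character z x)"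
  have e_lat: "e k \<in> lattice" for k using e by (auto simp: bij_betw_def)
  have e': "inj (\<lambda>k. - e k)" "range (\<lambda>k. - e k) \<subseteq> lattice"
    using e by (auto simp: bij_betw_def inj_on_def intro: lattice_uminus)
  show f: "smooth_summable f"
    using smooth_summable_fourier_series[OF rapidly_decaying_divide[OF rapidly_decaying_reflect[OF
            rapidly_decaying_fourier_coefficients[OF \<phi>]]] e', of "(2 * pi) ^ DIM('a)"]
    by (simp add: f_def)
  define F where "F = (\<lambda>x. \<Sum>k. f k x)"
  have F: "F \<in> smooth_torus" unfolding F_def by (rule smooth_torus_series[OF f])
  have "\<phi> x - F x = 0" for x
  proof (rule fourier_uniqueness[of "\<lambda>x. \<phi> x - F x"])
    show "continuous_on UNIV (\<lambda>x. \<phi> x - F x)" "torus_periodic (\<lambda>x. \<phi> x - F x)"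
      using smooth_torus_diff[OF \<phi> F] by (auto intro: smooth_torus_continuous smooth_torus_periodic)
    fix w :: 'a assume w: "w \<in> lattice"
    obtain k0 where k0: "e k0 = w" using w e unfolding bij_betw_def by (metis imageE)
    have "torus_integral (\<lambda>x. f k x * character w x) = (if k = k0 then ?c w else 0)" for k
    proof -
      have "torus_integral (\<lambda>x. f k x * character w x) =
          ?c (e k) / (2 * pi) ^ DIM('a) * torus_integral (character (w - e k))"
        unfolding f_def mult.assoc character_add[symmetric] torus_integral_cmult by simp
      also have "\<dots> = (if k = k0 then ?c w else 0)"
      proof (cases "k = k0")
        case False
        then have "w - e k \<noteq> 0" using k0 e by (auto simp: bij_betw_def inj_on_def)
        then show ?thesis
          using False torus_integral_character[OF lattice_diff[OF w e_lat]] by simp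
      qed (simp add: k0 torus_integral_character)
      finally show ?thesis .
    qed
    then have "(\<lambda>k. if k = k0 then ?c w else 0) sums torus_integral (\<lambda>x. F x * character w x)"
      using torus_integral_smooth_series[OF f smooth_torus_character[OF w]] by (simp add: F_def)
    moreover have "(\<lambda>k. if k = k0 then ?c w else 0) sums ?c w" by (rule sums_single)
    ultimately have "torus_integral (\<lambda>x. F x * character w x) = ?c w" by (rule sums_unique2)
    then show "torus_integral (\<lambda>x. (\<phi> x - F x) * character w x) = 0"
      unfolding left_diff_distrib
      by (subst torus_integral_diff)
        (auto intro!: smooth_torus_continuous smooth_torus_mult \<phi> F smooth_torus_character[OF w])
  qed
  then show "\<phi> = (\<lambda>x. \<Sum>k. f k x)" by (simp add: F_def fun_eq_iff)
qed

text \<open>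
  The Fourier series with the coefficients of \<open>u\<close> is a smooth function. Testing against a smooth
  \<open>\<phi>\<close> and expanding \<open>\<phi>\<close> in its own Fourier series shows that this function represents \<open>u\<close>.
\<close>

lemma smooth_distribution_if_rapidly_decaying:
  fixes u :: "'a::euclidean_space functional"
  assumes u: "torus_distribution u" and decay: "rapidly_decaying (\<lambda>z. u (character (- z)))"
  shows "smooth_distribution u"
proof -
  obtain e :: "nat \<Rightarrow> 'a" where e: "bij_betw e UNIV lattice" by (rule lattice_enumeration)
  have e': "inj e" "range e \<subseteq> lattice" using e by (auto simp: bij_betw_def)
  define f where "f k x = u (character (- e k)) / (2 * pi) ^ DIM('a) * character (e k) x" for k x
  have f: "smooth_summable f"
    using smooth_summable_fourier_series[OF rapidly_decaying_divide[OF decay] e'] by (simp add: f_def[abs_def])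
  show ?thesis
    unfolding smooth_distribution_def
  proof (intro bexI ballI)
    show "(\<lambda>x. \<Sum>k. f k x) \<in> smooth_torus" by (rule smooth_torus_series[OF f])
    fix \<phi> :: "'a \<Rightarrow> complex" assume \<phi>: "\<phi> \<in> smooth_torus"
    define c where "c k = torus_integral (\<lambda>x. \<phi> x * character (e k) x) / (2 * pi) ^ DIM('a)" for k
    have "torus_integral (\<lambda>x. f k x * \<phi> x) = c k * u (character (- e k))" for k
    proof -
      have "(\<lambda>x. f k x * \<phi> x) =
          (\<lambda>x. u (character (- e k)) / (2 * pi) ^ DIM('a) * (\<phi> x * character (e k) x))"
        by (simp add: f_def fun_eq_iff mult_ac)
      then show ?thesis by (simp only: torus_integral_cmult) (simp add: c_def)
    qed
    then have "(\<lambda>k. c k * u (character (- e k))) sums torus_integral (\<lambda>x. (\<Sum>k. f k x) * \<phi> x)"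
      using torus_integral_smooth_series[OF f \<phi>] by simp
    moreover have "(\<lambda>k. c k * u (character (- e k))) sums u \<phi>"
    proof -
      have "(\<lambda>k. u (\<lambda>x. c k * character (- e k) x)) sums u (\<lambda>x. \<Sum>k. c k * character (- e k) x)"
        unfolding c_def by (rule torus_distribution_series[OF u fourier_inversion(1)[OF \<phi> e]])
      moreover have "(\<lambda>x. \<Sum>k. c k * character (- e k) x) = \<phi>"
        unfolding c_def by (rule fourier_inversion(2)[OF \<phi> e, symmetric])
      moreover have "u (\<lambda>x. c k * character (- e k) x) = c k * u (character (- e k))" for k
        using e' by (intro torus_distribution_cmult[OF u] smooth_torus_character lattice_uminus) auto
      ultimately show ?thesis by simp
    qed
    ultimately show "u \<phi> = torus_integral (\<lambda>x. (\<Sum>k. f k x) * \<phi> x)" by (rule sums_unique2[symmetric])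
  qed
qed

lemma torus_distribution_character_bound:
  fixes u :: "'a::euclidean_space functional"
  assumes u: "torus_distribution u"
  obtains C j where "\<And>z. z \<in> lattice \<Longrightarrow> cmod (u (character z)) \<le> C * (1 + norm z) ^ j"
proof -
  obtain C j where C: "\<And>\<phi>. \<phi> \<in> smooth_torus \<Longrightarrow> cmod (u \<phi>) \<le> C * torus_Ck_norm j \<phi>"
    using u unfolding torus_distribution_def by blast
  define n where "n = card {bs :: 'a list. set bs \<subseteq> Basis \<and> length bs \<le> j}"
  show ?thesis
  proof (rule that)
    fix z :: 'a assume z: "z \<in> lattice"
    have "torus_Ck_norm j (character z) \<le> (\<Sum>bs | set bs \<subseteq> (Basis :: 'a set) \<and> length bs \<le> j. (1 + norm z) ^ j)"
      by (intro torus_Ck_norm_least order_trans[OF norm_fold_partial_deriv_character[OF z]] power_increasing) auto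
    then have N: "torus_Ck_norm j (character z) \<le> n * (1 + norm z) ^ j" by (simp add: n_def)
    have "cmod (u (character z)) \<le> C * torus_Ck_norm j (character z)" by (rule C[OF smooth_torus_character[OF z]])
    also have "\<dots> \<le> \<bar>C\<bar> * torus_Ck_norm j (character z)"
      by (intro mult_right_mono torus_Ck_norm_nonneg smooth_torus_character z) auto
    also have "\<dots> \<le> \<bar>C\<bar> * (n * (1 + norm z) ^ j)" by (intro mult_left_mono N) auto
    finally show "cmod (u (character z)) \<le> \<bar>C\<bar> * n * (1 + norm z) ^ j" by (simp add: mult.assoc)
  qed
qed

section \<open>Resonances of the constant coefficient system\<close>

lemma Basis_torus_cases:
  assumes "b \<in> (Basis :: ((real ^ 'n) \<times> (real ^ 'N)) set)"
  obtains j where "b = (axis j 1, 0)" | l where "b = (0, axis l 1)"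
  using assms by (auto simp: Basis_prod_def Basis_vec_def)

lemma axis_Pair_in_Basis [simp]:
  "(axis j (1::real), 0 :: 'b::euclidean_space) \<in> Basis"
  "(0 :: 'b::euclidean_space, axis l (1::real)) \<in> Basis"
  by (auto simp: Basis_prod_def axis_in_Basis_iff)

lemma lattice_Pair_iff: "(s, y) \<in> lattice \<longleftrightarrow> s \<in> lattice \<and> y \<in> lattice"
  by (simp add: lattice_def Basis_prod_def ball_Un)

lemma real_vec_inner_axis: "real_vec \<xi> \<bullet> axis l 1 = of_int (\<xi> $ l)"
  by (simp add: real_vec_def inner_axis)

lemma lattice_real_vec [simp]: "real_vec \<xi> \<in> lattice"
  by (auto simp: lattice_def Basis_vec_def real_vec_inner_axis)

lemma lattice_imp_real_vec:
  fixes z :: "real ^ 'N"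
  assumes "z \<in> lattice" obtains \<xi> where "z = real_vec \<xi>"
proof
  have "z $ l \<in> \<int>" for l
    using assms by (auto simp: lattice_def Basis_vec_def inner_axis)
  then have "z $ l = of_int \<lfloor>z $ l\<rfloor>" for l by (metis Ints_cases floor_of_int)
  then show "z = real_vec (\<chi> l. \<lfloor>z $ l\<rfloor>)"
    unfolding vec_eq_iff real_vec_def vec_lambda_beta by blast
qed

lemma real_vec_eq_iff [simp]: "real_vec \<xi> = real_vec \<eta> \<longleftrightarrow> \<xi> = \<eta>"
  by (simp add: real_vec_def vec_eq_iff)

lemma character_Pair: "character (s, y) (t, x) = character s t * character y x"
  by (simp add: character_def cis_mult)

lemma torus_integral_Pair:
  fixes f :: "'a::euclidean_space \<times> 'b::euclidean_space \<Rightarrow> complex"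
  assumes "continuous_on UNIV f"
  shows "torus_integral f = torus_integral (\<lambda>t. torus_integral (\<lambda>x. f (t, x)))"
proof -
  have "(\<Sum>b\<in>Basis. (2 * pi) *\<^sub>R b) = ((\<Sum>b\<in>Basis. (2 * pi) *\<^sub>R b :: 'a), (\<Sum>b\<in>Basis. (2 * pi) *\<^sub>R b :: 'b))"
    unfolding sum_Basis_prod_eq
    by (simp add: scaleR_Pair sum_prod)
  then show ?thesis
    unfolding torus_integral_def zero_prod_def
    using integral_prod_continuous[OF continuous_on_subset[OF assms subset_UNIV]] by simp
qed

lemma toroidal_symbol_polynomial_bound:
  fixes p :: "int ^ 'N::finite \<Rightarrow> complex"
  assumes "p \<in> toroidal_symbols m"
  obtains D q where "0 < D" "\<And>\<xi>. cmod (p \<xi>) \<le> D * (1 + norm (real_vec \<xi>)) ^ q"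
proof -
  obtain D where D: "0 < D" "\<And>\<xi>. cmod (p \<xi>) \<le> D * (1 + norm (real_vec \<xi>)) powr m"
    using assms unfolding toroidal_symbols_def by (auto dest!: spec[of _ "[]"])
  show ?thesis
  proof (rule that[OF D(1)])
    fix \<xi> :: "int ^ 'N"
    have "(1 + norm (real_vec \<xi>)) powr m \<le> (1 + norm (real_vec \<xi>)) powr real (nat \<lceil>m\<rceil>)"
      by (intro powr_mono real_nat_ceiling_ge) simp
    also have "\<dots> = (1 + norm (real_vec \<xi>)) ^ nat \<lceil>m\<rceil>"
      by (intro powr_realpow add_pos_nonneg) auto
    finally show "cmod (p \<xi>) \<le> D * (1 + norm (real_vec \<xi>)) ^ nat \<lceil>m\<rceil>"
      using D mult_left_mono[of _ _ D] by (meson less_imp_le order_trans)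
  qed
qed

text \<open>
  By orthogonality of the characters in \<open>x\<close>, only one term of the defining series is
  different from zero.
\<close>

lemma psi_op_character:
  fixes u :: "((real ^ 'n::finite) \<times> (real ^ 'N::finite)) functional"
  assumes u: "torus_distribution u" and \<tau>: "\<tau> \<in> lattice"
  shows "psi_op p u (\<lambda>y. a * character (- (\<tau>, real_vec \<xi>)) y) = a * p \<xi> * u (character (- (\<tau>, real_vec \<xi>)))"
proof -
  let ?e = "character (- (\<tau>, real_vec \<xi>))"
  have e: "?e \<in> smooth_torus" by (intro smooth_torus_character lattice_uminus) (simp add: lattice_Pair_iff \<tau>)
  have inner: "torus_integral (\<lambda>x. cis (x \<bullet> real_vec \<eta>) * (a * ?e (t, x))) =
      (if \<eta> = \<xi> then a * (2 * pi) ^ CARD('N) * character (- \<tau>) t else 0)" for \<eta> t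
  proof -
    have "torus_integral (\<lambda>x. cis (x \<bullet> real_vec \<eta>) * (a * ?e (t, x))) =
      torus_integral (\<lambda>x. a * character (- \<tau>) t * character (real_vec \<eta> - real_vec \<xi>) x)"
      by (rule arg_cong[where f = torus_integral])
        (simp add: fun_eq_iff character_def cis_mult inner_diff_left inner_commute algebra_simps)
    also have "\<dots> = a * character (- \<tau>) t * (if \<eta> = \<xi> then (2 * pi) ^ CARD('N) else 0)"
      unfolding torus_integral_cmult
      by (subst torus_integral_character) (auto intro: lattice_diff)
    finally show ?thesis by simp
  qed
  have summand: "p \<eta> * exp_tensor \<eta> (partial_fourier u \<eta>) (\<lambda>y. a * ?e y) =
      (if \<eta> = \<xi> then a * p \<xi> * u ?e else 0)" for \<eta>
  proof (cases "\<eta> = \<xi>")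
    case True
    have eq: "(\<lambda>(t, x). a * (2 * pi) ^ CARD('N) * character (- \<tau>) t * cis (- (x \<bullet> real_vec \<xi>))) =
        (\<lambda>y. a * (2 * pi) ^ CARD('N) * ?e y)"
      by (auto simp: fun_eq_iff character_def cis_mult inner_commute)
    have "partial_fourier u \<xi> (\<lambda>t. a * (2 * pi) ^ CARD('N) * character (- \<tau>) t) = a * u ?e"
      unfolding partial_fourier_def eq torus_distribution_cmult[OF u e] by simp
    then show ?thesis unfolding exp_tensor_def inner using True by simp
  next
    case False
    then show ?thesis
      unfolding exp_tensor_def partial_fourier_def inner
      by (simp add: case_prod_unfold torus_distribution_0[OF u])
  qed
  have "psi_op p u (\<lambda>y. a * ?e y) = (\<Sum>\<^sub>\<infinity>\<eta>. if \<eta> = \<xi> then a * p \<xi> * u ?e else 0)"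
    unfolding psi_op_def summand ..
  also have "\<dots> = (\<Sum>\<^sub>\<infinity>\<eta>\<in>{\<xi>}. a * p \<xi> * u ?e)"
    by (rule infsum_cong_neutral) auto
  finally show ?thesis by simp
qed

lemma system_op_constant_character:
  fixes u :: "((real ^ 'n::finite) \<times> (real ^ 'N::finite)) functional"
  assumes u: "torus_distribution u" and \<tau>: "\<tau> \<in> lattice"
  shows "system_op (\<lambda>j _. a j) p j u (character (- (\<tau>, real_vec \<xi>))) =
    (of_real (\<tau> $ j) + a j * p j \<xi>) * u (character (- (\<tau>, real_vec \<xi>)))"
proof -
  let ?e = "character (- (\<tau>, real_vec \<xi>))"
  have e: "?e \<in> smooth_torus" by (intro smooth_torus_character lattice_uminus) (simp add: lattice_Pair_iff \<tau>)
  have "distr_deriv (axis j 1, 0) u ?e = \<i> * of_real (\<tau> $ j) * u ?e"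
    unfolding distr_deriv_def partial_deriv_character torus_distribution_cmult[OF u e]
    by (simp add: inner_axis)
  moreover have "distr_mult (\<lambda>(t, x). a j) (psi_op (p j) u) ?e = a j * p j \<xi> * u ?e"
    unfolding distr_mult_def using psi_op_character[OF u \<tau>] by (simp add: case_prod_unfold)
  ultimately show ?thesis unfolding system_op_def by (simp add: algebra_simps)
qed

text \<open>
  The symbol of the constant coefficient system at \<open>(\<tau>, \<xi>)\<close>, multiplied by the Fourier coefficient of
  \<open>u\<close>, is a Fourier coefficient of a smooth function and so decays rapidly. The coefficients of \<open>u\<close>
  itself do not decay faster than some fixed power, since otherwise \<open>u\<close> would be smooth. Hence the symbol
  must be tiny wherever the coefficient is large. At such points \<open>\<tau>\<close> is controlled by \<open>\<xi>\<close>, because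
  \<open>\<tau> $ j\<close> is within distance \<open>1\<close> of \<open>- a j * p j \<xi>\<close>; this is why \<open>\<xi>\<close> can be made large
  and not merely \<open>(\<tau>, \<xi>)\<close>.
\<close>

lemma resonances_of_nonhypoelliptic:
  fixes u :: "((real ^ 'n::finite) \<times> (real ^ 'N::finite)) functional"
  assumes u: "torus_distribution u" and not_smooth: "\<not> smooth_distribution u"
    and smooth: "\<And>j. smooth_distribution (system_op (\<lambda>j _. a j) p j u)"
    and p: "\<And>j. p j \<in> toroidal_symbols (m j)"
  obtains \<tau> \<xi> where "\<tau> \<in> lattice" "R \<le> norm (real_vec \<xi>)"
    "\<And>j. cmod (of_real (\<tau> $ j) + a j * p j \<xi>) * (1 + norm (\<tau>, real_vec \<xi>)) ^ k \<le> 1"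
proof -
  define \<epsilon> where "\<epsilon> j z = of_real (fst z $ j) + a j * p j (\<chi> l. \<lfloor>snd z $ l\<rfloor>)" for j and z :: "(real ^ 'n) \<times> (real ^ 'N)"
  have \<epsilon>: "\<epsilon> j (\<tau>, real_vec \<xi>) = of_real (\<tau> $ j) + a j * p j \<xi>" for j \<tau> \<xi>
    by (simp add: \<epsilon>_def real_vec_def)
  obtain M where M: "\<And>C. \<exists>z\<in>lattice. C < cmod (u (character (- z))) * (1 + norm z) ^ M"
    using smooth_distribution_if_rapidly_decaying[OF u] not_smooth
    unfolding rapidly_decaying_def by (meson not_le)
  have "\<exists>C. \<forall>z\<in>lattice. cmod (system_op (\<lambda>j _. a j) p j u (character (- z))) * (1 + norm z) ^ (M + k) \<le> C" for j
  proof -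
    obtain f where f: "f \<in> smooth_torus"
      "\<And>\<phi>. \<phi> \<in> smooth_torus \<Longrightarrow> system_op (\<lambda>j _. a j) p j u \<phi> = torus_integral (\<lambda>x. f x * \<phi> x)"
      using smooth[of j] unfolding smooth_distribution_def by blast
    obtain C where C: "\<And>z. z \<in> lattice \<Longrightarrow>
        cmod (torus_integral (\<lambda>x. f x * character (- z) x)) * (1 + norm z) ^ (M + k) \<le> C"
      using rapidly_decaying_reflect[OF rapidly_decaying_fourier_coefficients[OF f(1)]]
      unfolding rapidly_decaying_def by blast
    then show ?thesis by (intro exI[of _ C]) (auto simp: f(2) smooth_torus_character lattice_uminus)
  qed
  then obtain C where C: "\<And>j z. z \<in> lattice \<Longrightarrow>
      cmod (system_op (\<lambda>j _. a j) p j u (character (- z))) * (1 + norm z) ^ (M + k) \<le> C j"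
    by metis
  obtain C' r where C': "\<And>z. z \<in> lattice \<Longrightarrow> cmod (u (character z)) \<le> C' * (1 + norm z) ^ r"
    using torus_distribution_character_bound[OF u] by metis
  have "\<exists>D q. 0 < D \<and> (\<forall>\<xi>. cmod (p j \<xi>) \<le> D * (1 + norm (real_vec \<xi>)) ^ q)" for j
    using toroidal_symbol_polynomial_bound[OF p] by metis
  then obtain D q where D: "\<And>j. 0 < D j" "\<And>j \<xi>. cmod (p j \<xi>) \<le> D j * (1 + norm (real_vec \<xi>)) ^ q j"
    by metis
  \<comment> \<open>a bound for the norm of approximate resonances with \<open>norm (real_vec \<xi>) < R\<close>\<close>
  define B where "B = (\<Sum>j\<in>UNIV. 1 + cmod (a j) * (D j * (1 + \<bar>R\<bar>) ^ q j)) + \<bar>R\<bar>"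
  \<comment> \<open>The first part of the constant makes the symbol small, the second part excludes norms up to \<open>B\<close>.\<close>
  obtain z where z: "z \<in> lattice"
    "(\<Sum>j\<in>UNIV. \<bar>C j\<bar>) + \<bar>C'\<bar> * (1 + B) ^ (r + M) < cmod (u (character (- z))) * (1 + norm z) ^ M"
    using M by blast
  obtain \<tau> \<xi> where z_eq: "z = (\<tau>, real_vec \<xi>)" and \<tau>: "\<tau> \<in> lattice"
    using z(1) lattice_imp_real_vec by (metis lattice_Pair_iff surj_pair)
  have B0: "0 \<le> B" unfolding B_def using D(1)
    by (intro add_nonneg_nonneg sum_nonneg mult_nonneg_nonneg) (auto simp: less_imp_le)
  have pos: "0 < cmod (u (character (- z))) * (1 + norm z) ^ M"
    using z(2) sum_nonneg[of UNIV "\<lambda>j. \<bar>C j\<bar>"] B0 by (smt (verit) abs_ge_zero mult_nonneg_nonneg zero_le_power)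
  have res: "cmod (\<epsilon> j z) * (1 + norm z) ^ k \<le> 1" for j
  proof -
    have "cmod (\<epsilon> j z) * (1 + norm z) ^ k * (cmod (u (character (- z))) * (1 + norm z) ^ M) =
      cmod (system_op (\<lambda>j _. a j) p j u (character (- z))) * (1 + norm z) ^ (M + k)"
      unfolding z_eq system_op_constant_character[OF u \<tau>] \<epsilon> norm_mult by (simp add: power_add)
    also have "\<dots> \<le> \<bar>C j\<bar>" using C[OF z(1), of j] by simp
    also have "\<dots> \<le> (\<Sum>j\<in>UNIV. \<bar>C j\<bar>)" by (rule member_le_sum) auto
    also have "\<dots> \<le> 1 * (cmod (u (character (- z))) * (1 + norm z) ^ M)"
      using z(2) B0 by (smt (verit) abs_ge_zero mult_nonneg_nonneg zero_le_power)
    finally show ?thesis using pos mult_le_cancel_right_pos by blast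
  qed
  have "R \<le> norm (real_vec \<xi>)"
  proof (rule ccontr)
    assume "\<not> R \<le> norm (real_vec \<xi>)"
    then have R: "norm (real_vec \<xi>) \<le> \<bar>R\<bar>" by simp
    have \<tau>_le: "\<bar>\<tau> $ j\<bar> \<le> 1 + cmod (a j) * (D j * (1 + \<bar>R\<bar>) ^ q j)" for j
    proof -
      have "cmod (\<epsilon> j z) * 1 \<le> cmod (\<epsilon> j z) * (1 + norm z) ^ k"
        by (intro mult_left_mono one_le_power) auto
      then have "cmod (of_real (\<tau> $ j) + a j * p j \<xi>) \<le> 1" using res[of j] by (simp add: z_eq \<epsilon>)
      then have "cmod (complex_of_real (\<tau> $ j)) \<le> 1 + cmod (a j * p j \<xi>)"
        using norm_triangle_ineq4[of "of_real (\<tau> $ j) + a j * p j \<xi>" "a j * p j \<xi>"] by simp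
      also have "cmod (a j * p j \<xi>) \<le> cmod (a j) * (D j * (1 + norm (real_vec \<xi>)) ^ q j)"
        unfolding norm_mult by (intro mult_left_mono D) auto
      also have "\<dots> \<le> cmod (a j) * (D j * (1 + \<bar>R\<bar>) ^ q j)"
        using R D(1)[of j] by (intro mult_left_mono power_mono) auto
      finally show ?thesis by simp
    qed
    have "norm z \<le> norm \<tau> + norm (real_vec \<xi>)" unfolding z_eq by (rule norm_Pair_le)
    also have "norm \<tau> \<le> (\<Sum>j\<in>UNIV. \<bar>\<tau> $ j\<bar>)" by (rule norm_le_l1_cart)
    also have "\<dots> \<le> (\<Sum>j\<in>UNIV. 1 + cmod (a j) * (D j * (1 + \<bar>R\<bar>) ^ q j))" by (intro sum_mono \<tau>_le)
    finally have zB: "norm z \<le> B" using R unfolding B_def by linarith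
    have "cmod (u (character (- z))) * (1 + norm z) ^ M \<le> \<bar>C'\<bar> * (1 + norm z) ^ r * (1 + norm z) ^ M"
    proof (intro mult_right_mono)
      have "cmod (u (character (- z))) \<le> C' * (1 + norm z) ^ r"
        using C'[OF lattice_uminus[OF z(1)]] by simp
      also have "\<dots> \<le> \<bar>C'\<bar> * (1 + norm z) ^ r" by (intro mult_right_mono) auto
      finally show "cmod (u (character (- z))) \<le> \<bar>C'\<bar> * (1 + norm z) ^ r" .
    qed auto
    also have "\<dots> = \<bar>C'\<bar> * (1 + norm z) ^ (r + M)" by (simp add: power_add)
    also have "\<dots> \<le> \<bar>C'\<bar> * (1 + B) ^ (r + M)" using zB by (intro mult_left_mono power_mono) auto
    also have "\<dots> \<le> (\<Sum>j\<in>UNIV. \<bar>C j\<bar>) + \<bar>C'\<bar> * (1 + B) ^ (r + M)" by (simp add: sum_nonneg)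
    finally show False using z(2) by simp
  qed
  then show ?thesis using res \<tau> by (intro that[of \<tau> \<xi>]) (auto simp: z_eq \<epsilon>)
qed

text \<open>
  The exponential growth of the frequencies turns a negative power of the frequency into
  geometric decay, so that series over the sequence converge; growth by at least \<open>1\<close> in each step makes
  the frequencies distinct.
\<close>

lemma resonance_sequence:
  fixes u :: "((real ^ 'n::finite) \<times> (real ^ 'N::finite)) functional"
  assumes u: "torus_distribution u" and not_smooth: "\<not> smooth_distribution u"
    and smooth: "\<And>j. smooth_distribution (system_op (\<lambda>j _. a j) p j u)"
    and p: "\<And>j. p j \<in> toroidal_symbols (m j)"
  obtains \<tau> \<xi> where "\<And>k. \<tau> k \<in> lattice" "inj \<xi>" "\<And>k. 2 ^ k \<le> norm (real_vec (\<xi> k))"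
    "\<And>j k. cmod (of_real (\<tau> k $ j) + a j * p j (\<xi> k)) * (1 + norm (\<tau> k, real_vec (\<xi> k))) ^ k \<le> 1"
proof -
  define good where "good k z \<longleftrightarrow> fst z \<in> lattice \<and> 2 ^ k \<le> norm (real_vec (snd z)) \<and>
    (\<forall>j. cmod (of_real (fst z $ j) + a j * p j (snd z)) * (1 + norm (fst z, real_vec (snd z))) ^ k \<le> 1)"
    for k and z :: "(real ^ 'n) \<times> (int ^ 'N)"
  have ex: "\<exists>z. good k z \<and> R \<le> norm (real_vec (snd z))" for k R
  proof -
    obtain \<tau> \<xi> where "\<tau> \<in> lattice" "max R (2 ^ k) \<le> norm (real_vec \<xi>)"
      "\<And>j. cmod (of_real (\<tau> $ j) + a j * p j \<xi>) * (1 + norm (\<tau>, real_vec \<xi>)) ^ k \<le> 1"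
      using resonances_of_nonhypoelliptic[OF u not_smooth smooth p] by metis
    then show ?thesis by (intro exI[of _ "(\<tau>, \<xi>)"]) (auto simp: good_def)
  qed
  obtain z where z: "\<And>k. good k (z k)" "\<And>k. norm (real_vec (snd (z k))) + 1 \<le> norm (real_vec (snd (z (Suc k))))"
    using dependent_nat_choice[of good "\<lambda>k z w. norm (real_vec (snd z)) + 1 \<le> norm (real_vec (snd w))"] ex
    by metis
  have "strict_mono (\<lambda>k. norm (real_vec (snd (z k))))"
    unfolding strict_mono_Suc_iff using z(2) by (smt (verit))
  then have "inj (\<lambda>k. snd (z k))"
    unfolding inj_def by (metis strict_mono_eq)
  then show ?thesis
    using z(1) by (intro that[of "\<lambda>k. fst (z k)" "\<lambda>k. snd (z k)"]) (auto simp: good_def)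
qed

section \<open>Families with polynomially bounded derivatives\<close>

text \<open>
  The weight \<open>r k\<close> will be the size of the frequency of the \<open>k\<close>-th quasimode. The power of \<open>r k\<close> may
  depend on the order of the derivative, as it is beaten by coefficients that decay faster
  than every power.
\<close>

definition tempered :: "(nat \<Rightarrow> real) \<Rightarrow> (nat \<Rightarrow> 'a::euclidean_space \<Rightarrow> complex) \<Rightarrow> bool" where
  "tempered r g \<longleftrightarrow> (\<forall>k. g k \<in> smooth_torus) \<and>
     (\<forall>bs. set bs \<subseteq> Basis \<longrightarrow> (\<exists>C n. \<forall>k x. cmod (fold partial_deriv bs (g k) x) \<le> C * r k ^ n))"

lemma tempered_smooth: "tempered r g \<Longrightarrow> g k \<in> smooth_torus"
  by (simp add: tempered_def)

lemma tempered_partial_deriv: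
  assumes "tempered r g" "b \<in> Basis" shows "tempered r (\<lambda>k. partial_deriv b (g k))"
  unfolding tempered_def
proof (intro conjI allI impI)
  fix bs :: "'a list" assume "set bs \<subseteq> Basis"
  then have "set (b # bs) \<subseteq> Basis" using assms by simp
  then have "\<exists>C n. \<forall>k x. cmod (fold partial_deriv (b # bs) (g k) x) \<le> C * r k ^ n"
    using assms(1) unfolding tempered_def by blast
  then show "\<exists>C n. \<forall>k x. cmod (fold partial_deriv bs (partial_deriv b (g k)) x) \<le> C * r k ^ n"
    by simp
qed (use assms smooth_torus_partial_deriv tempered_smooth in blast)

lemma polynomial_bound_add:
  fixes a b :: complex
  assumes r: "1 \<le> r" and a: "cmod a \<le> C * r ^ n" and b: "cmod b \<le> D * r ^ m"
  shows "cmod (a + b) \<le> (\<bar>C\<bar> + \<bar>D\<bar>) * r ^ (n + m)"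
proof -
  have "C * r ^ n \<le> \<bar>C\<bar> * r ^ (n + m)" "D * r ^ m \<le> \<bar>D\<bar> * r ^ (n + m)"
    using r by (intro mult_mono power_increasing; simp)+
  then show ?thesis using norm_triangle_mono[OF a b] by (simp add: algebra_simps)
qed

lemma tempered_add:
  assumes r: "\<And>k. 1 \<le> r k" and "tempered r f" "tempered r g"
  shows "tempered r (\<lambda>k x. f k x + g k x)"
  unfolding tempered_def
proof (intro conjI allI impI)
  note smooth = tempered_smooth[OF assms(2)] tempered_smooth[OF assms(3)]
  show "(\<lambda>x. f k x + g k x) \<in> smooth_torus" for k by (intro smooth_torus_add smooth)
  fix bs :: "'a list" assume bs: "set bs \<subseteq> Basis"
  obtain C n D m where bounds: "\<And>k x. cmod (fold partial_deriv bs (f k) x) \<le> C * r k ^ n"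
    "\<And>k x. cmod (fold partial_deriv bs (g k) x) \<le> D * r k ^ m"
    using assms bs unfolding tempered_def by meson
  show "\<exists>C n. \<forall>k x. cmod (fold partial_deriv bs (\<lambda>x. f k x + g k x) x) \<le> C * r k ^ n"
    unfolding fold_partial_deriv_add[OF smooth bs]
    by (intro exI[of _ "\<bar>C\<bar> + \<bar>D\<bar>"] exI[of _ "n + m"] allI polynomial_bound_add r bounds)
qed

lemma tempered_mult:
  fixes f g :: "nat \<Rightarrow> 'a::euclidean_space \<Rightarrow> complex"
  assumes r: "\<And>k. 1 \<le> r k" and "tempered r f" "tempered r g"
  shows "tempered r (\<lambda>k x. f k x * g k x)"
  unfolding tempered_def
proof (intro conjI allI impI)
  show "(\<lambda>x. f k x * g k x) \<in> smooth_torus" for k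
    by (intro smooth_torus_mult tempered_smooth[OF assms(2)] tempered_smooth[OF assms(3)])
  fix bs :: "'a list" assume "set bs \<subseteq> Basis"
  then show "\<exists>C n. \<forall>k x. cmod (fold partial_deriv bs (\<lambda>x. f k x * g k x) x) \<le> C * r k ^ n"
    using assms(2,3)
  proof (induction bs arbitrary: f g)
    case Nil
    obtain C n D m where bounds: "\<And>k x. cmod (f k x) \<le> C * r k ^ n" "\<And>k x. cmod (g k x) \<le> D * r k ^ m"
      using Nil unfolding tempered_def by (metis empty_set empty_subsetI fold_simps(1))
    have "cmod (f k x * g k x) \<le> C * D * r k ^ (n + m)" for k x
      using mult_mono'[OF bounds(1)[of k x] bounds(2)[of k x]] by (simp add: norm_mult power_add mult_ac)
    then show ?case by auto
  next
    case (Cons b bs)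
    then have b: "b \<in> Basis" and bs: "set bs \<subseteq> Basis" by auto
    note f = tempered_smooth[OF Cons.prems(2)] and g = tempered_smooth[OF Cons.prems(3)]
    obtain C n where C: "\<And>k x. cmod (fold partial_deriv bs (\<lambda>x. partial_deriv b (f k) x * g k x) x) \<le> C * r k ^ n"
      using Cons.IH[OF bs tempered_partial_deriv[OF Cons.prems(2) b] Cons.prems(3)] by metis
    obtain D m where D: "\<And>k x. cmod (fold partial_deriv bs (\<lambda>x. f k x * partial_deriv b (g k) x) x) \<le> D * r k ^ m"
      using Cons.IH[OF bs Cons.prems(2) tempered_partial_deriv[OF Cons.prems(3) b]] by metis
    have eq: "fold partial_deriv (b # bs) (\<lambda>x. f k x * g k x) = (\<lambda>x.
        fold partial_deriv bs (\<lambda>x. partial_deriv b (f k) x * g k x) x +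
        fold partial_deriv bs (\<lambda>x. f k x * partial_deriv b (g k) x) x)" for k
      using smooth_torus_mult[OF smooth_torus_partial_deriv[OF f b] g]
        smooth_torus_mult[OF f smooth_torus_partial_deriv[OF g b]] bs
      by (simp add: partial_deriv_mult smooth_torus_differentiable[OF f] smooth_torus_differentiable[OF g]
          fold_partial_deriv_add)
    show ?case unfolding eq by (intro exI[of _ "\<bar>C\<bar> + \<bar>D\<bar>"] exI[of _ "n + m"] allI polynomial_bound_add r C D)
  qed
qed

lemma tempered_const:
  assumes "\<And>k. cmod (s k) \<le> C * r k ^ n"
  shows "tempered r (\<lambda>k x. s k)"
  unfolding tempered_def
proof (intro conjI allI impI)
  fix bs :: "'a list" assume "set bs \<subseteq> Basis"
  show "\<exists>C n. \<forall>k x. cmod (fold partial_deriv bs (\<lambda>x. s k) x) \<le> C * r k ^ n"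
  proof (cases bs)
    case Nil
    then show ?thesis using assms by auto
  next
    case (Cons b bs')
    have "fold partial_deriv bs (\<lambda>x::'a. 0 :: complex) = (\<lambda>x. 0)" for bs by (induction bs) auto
    then show ?thesis unfolding Cons by (auto intro!: exI[of _ 0])
  qed
qed simp

lemma tempered_fixed:
  assumes g: "g \<in> smooth_torus" and r: "\<And>k. 1 \<le> r k"
  shows "tempered r (\<lambda>k. g)"
  unfolding tempered_def
proof (intro conjI allI impI)
  fix bs :: "'a list" assume "set bs \<subseteq> Basis"
  from smooth_torus_bounded[OF smooth_torus_fold[OF g this]]
  obtain B where "\<And>x. cmod (fold partial_deriv bs g x) \<le> B"
    unfolding bdd_above_def by auto
  then show "\<exists>C n. \<forall>(k::nat) x. cmod (fold partial_deriv bs g x) \<le> C * r k ^ n"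
    by (intro exI[of _ B] exI[of _ 0]) simp
qed (rule g)

lemma tempered_sum:
  assumes r: "\<And>k. 1 \<le> r k" and "\<And>i. i \<in> I \<Longrightarrow> tempered r (f i)"
  shows "tempered r (\<lambda>k x. \<Sum>i\<in>I. f i k x)"
  using assms(2)
  by (induction I rule: infinite_finite_induct)
    (simp_all add: tempered_add[OF r] tempered_fixed[OF smooth_torus_const r])

text \<open>
  Derivatives of \<open>E\<close> are products of \<open>E\<close> with polynomial expressions in the derivatives of its
  logarithmic derivatives \<open>h\<close>. The induction is over products \<open>g * E\<close> with tempered \<open>g\<close>, a class closed under
  differentiation.
\<close>

lemma tempered_log_deriv:
  assumes r: "\<And>k. 1 \<le> r k" and E: "\<And>k. E k \<in> smooth_torus" "\<And>k x. cmod (E k x) \<le> 1"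
    and h: "\<And>b. b \<in> Basis \<Longrightarrow> tempered r (h b)"
    and deriv: "\<And>b k. b \<in> Basis \<Longrightarrow> partial_deriv b (E k) = (\<lambda>x. h b k x * E k x)"
  shows "tempered r E"
proof -
  have "\<exists>C n. \<forall>k x. cmod (fold partial_deriv bs (\<lambda>x. g k x * E k x) x) \<le> C * r k ^ n"
    if "set bs \<subseteq> Basis" "tempered r g" for bs g
    using that
  proof (induction bs arbitrary: g)
    case Nil
    obtain C n where C: "\<And>k x. cmod (g k x) \<le> C * r k ^ n"
      using Nil unfolding tempered_def by (metis empty_set empty_subsetI fold_simps(1))
    have "cmod (g k x * E k x) \<le> C * r k ^ n" for k x
      using mult_mono'[OF C[of k x] E(2)[of k x]] by (simp add: norm_mult)
    then show ?case by auto
  next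
    case (Cons b bs)
    then have b: "b \<in> Basis" and bs: "set bs \<subseteq> Basis" by auto
    let ?g = "\<lambda>k x. partial_deriv b (g k) x + g k x * h b k x"
    have "tempered r ?g"
      by (intro tempered_add tempered_mult tempered_partial_deriv r Cons.prems b h)
    moreover have "partial_deriv b (\<lambda>x. g k x * E k x) = (\<lambda>x. ?g k x * E k x)" for k
      using tempered_smooth[OF Cons.prems(2)]
      by (simp add: partial_deriv_mult smooth_torus_differentiable E deriv[OF b] algebra_simps)
    ultimately show ?case using Cons.IH[OF bs, of ?g] by simp
  qed
  from this[OF _ tempered_fixed[OF smooth_torus_const[of 1] r]] show ?thesis
    unfolding tempered_def using E by simp
qed

section \<open>Quasimodes of the variable coefficient system\<close>

text \<open>
  Subtracting the mean is exactly what makes the antiderivative periodic: its increment over a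
  period is the integral over a period.
\<close>

lemma periodic_antiderivative:
  assumes c: "c \<in> smooth_torus"
  obtains \<gamma> where "\<gamma> \<in> smooth_torus" "partial_deriv 1 \<gamma> = (\<lambda>s. c s - mean_coeff c)"
proof -
  define f where "f s = c s - mean_coeff c" for s
  have f: "f \<in> smooth_torus" unfolding f_def by (intro smooth_torus_diff c smooth_torus_const)
  have "\<exists>\<gamma>. \<forall>s. - \<infinity> < ereal s \<longrightarrow> ereal s < \<infinity> \<longrightarrow> (\<gamma> has_vector_derivative f s) (at s)"
    using smooth_torus_continuous[OF f, of UNIV]
    by (intro einterval_antiderivative) (auto simp: continuous_on_eq_continuous_at)
  then obtain \<gamma> where \<gamma>: "\<And>s. (\<gamma> has_vector_derivative f s) (at s)" by auto
  have d: "(\<gamma> has_derivative (\<lambda>h. h *\<^sub>R f s)) (at s)" for s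
    using \<gamma> by (simp add: has_vector_derivative_def)
  have deriv: "partial_deriv 1 \<gamma> = f" using partial_deriv_eq[OF d, of 1] by (simp add: fun_eq_iff)
  have per: "torus_periodic \<gamma>"
  proof -
    have "((\<lambda>s. \<gamma> (s + 2 * pi) - \<gamma> s) has_vector_derivative f (s + 2 * pi) - f s) (at s)" for s
    proof (rule has_vector_derivative_diff[OF _ \<gamma>])
      have "(\<gamma> \<circ> (\<lambda>s. s + 2 * pi) has_vector_derivative 1 *\<^sub>R f (s + 2 * pi)) (at s)"
        by (rule vector_diff_chain_at) (auto intro!: derivative_eq_intros \<gamma>)
      then show "((\<lambda>s. \<gamma> (s + 2 * pi)) has_vector_derivative f (s + 2 * pi)) (at s)" by (simp add: o_def)
    qed
    moreover have "f (s + 2 * pi) = f s" for s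
      using torus_periodicD[OF smooth_torus_periodic[OF f], of 1 s] by simp
    ultimately have "((\<lambda>s. \<gamma> (s + 2 * pi) - \<gamma> s) has_vector_derivative 0) (at s within UNIV)" for s
      by simp
    then obtain K where K: "\<And>s. \<gamma> (s + 2 * pi) - \<gamma> s = K"
      using has_vector_derivative_zero_constant[of UNIV "\<lambda>s. \<gamma> (s + 2 * pi) - \<gamma> s"] by auto
    have "(f has_integral \<gamma> (2 * pi) - \<gamma> 0) {0..2 * pi}"
      by (rule fundamental_theorem_of_calculus) (auto intro: has_vector_derivative_at_within \<gamma>)
    moreover have "(f has_integral 0) {0..2 * pi}"
    proof -
      have "(c has_integral integral {0..2 * pi} c) {0..2 * pi}"
        by (intro integrable_integral integrable_continuous_real smooth_torus_continuous c)
      from has_integral_diff[OF this has_integral_const_real[of "mean_coeff c" 0 "2 * pi"]]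
      show ?thesis unfolding f_def by (simp add: mean_coeff_def scaleR_conv_of_real)
    qed
    ultimately have "\<gamma> (2 * pi) - \<gamma> 0 = 0" by (rule has_integral_unique)
    with K[of 0] have "K = 0" by simp
    with K show ?thesis by (simp add: torus_periodic_def)
  qed
  have "\<gamma> \<in> smooth_torus"
  proof (rule smooth_torus_coinduct[of _ "insert \<gamma> smooth_torus"])
    show "g differentiable (at s)" if "g \<in> insert \<gamma> smooth_torus" for g s
      using that d smooth_torus_differentiable differentiable_def by blast
    show "partial_deriv b g \<in> insert \<gamma> smooth_torus" if "g \<in> insert \<gamma> smooth_torus" "b \<in> Basis" for g b
      using that deriv f smooth_torus_partial_deriv[of g b] by auto
  qed (use per smooth_torus_periodic in auto)
  then show ?thesis using deriv that by (simp add: f_def[abs_def])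
qed

lemma smooth_torus_exp:
  assumes f: "f \<in> smooth_torus"
  shows "(\<lambda>x. exp (f x)) \<in> smooth_torus"
    and "partial_deriv b (\<lambda>x. exp (f x)) = (\<lambda>x. partial_deriv b f x * exp (f x))"
proof -
  have d: "((\<lambda>x. exp (f x)) has_derivative (\<lambda>h. frechet_derivative f (at x) h * exp (f x))) (at x)" for x
    using has_derivative_compose[OF smooth_torus_differentiable[OF f, of x, unfolded frechet_derivative_works]
        DERIV_exp[of "f x", unfolded has_field_derivative_def]]
    by (simp add: mult_ac)
  show deriv: "partial_deriv b (\<lambda>x. exp (f x)) = (\<lambda>x. partial_deriv b f x * exp (f x))" for b
    using partial_deriv_eq[OF d] partial_deriv_eq[OF smooth_torus_differentiable[OF f, unfolded frechet_derivative_works]]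
    by (simp add: fun_eq_iff)
  show "(\<lambda>x. exp (f x)) \<in> smooth_torus"
  proof (rule smooth_torus_log_deriv[of _ "\<lambda>b. partial_deriv b f"])
    show "torus_periodic (\<lambda>x. exp (f x))"
      using smooth_torus_periodic[OF f] by (simp add: torus_periodic_def)
    show "(\<lambda>x. exp (f x)) differentiable (at x)" for x using d differentiable_def by blast
  qed (auto simp: deriv smooth_torus_partial_deriv f)
qed

text \<open>
  With periodic antiderivatives \<open>\<gamma> j\<close> of \<open>c j - mean_coeff (c j)\<close>, the function \<open>E k\<close> is a normalised multiple of
  \<open>exp (- \<i> * (\<Sum>j. p j (\<xi> k) * \<gamma> j (t $ j)))\<close> times the character of \<open>(\<tau> k, \<xi> k)\<close>. The exponential factor conjugates
  the operator with coefficient \<open>c j\<close> into the one with the mean coefficient. Its modulus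
  may grow exponentially in \<open>p j (\<xi> k)\<close>, and only the normalisation by its maximum makes the family
  bounded. The normalisation does not affect the logarithmic derivatives, which stay polynomial in
  the frequency, so the family is tempered.
\<close>

lemma quasimode_family:
  fixes c :: "'n::finite \<Rightarrow> real \<Rightarrow> complex" and p :: "'n \<Rightarrow> int ^ 'N::finite \<Rightarrow> complex"
  assumes c: "\<And>j. c j \<in> smooth_torus" and p: "\<And>j. p j \<in> toroidal_symbols (m j)"
    and \<tau>: "\<And>k. \<tau> k \<in> lattice"
  obtains E :: "nat \<Rightarrow> (real ^ 'n) \<times> (real ^ 'N) \<Rightarrow> complex"
  where "tempered (\<lambda>k. 1 + norm (\<tau> k, real_vec (\<xi> k))) E"
    "\<And>k y. cmod (E k y) \<le> 1" "\<And>k. \<exists>t. cmod (E k (t, 0)) = 1"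
    "\<And>k t x. E k (t, x) = E k (t, 0) * character (real_vec (\<xi> k)) x"
    "\<And>j k. partial_deriv (axis j 1, 0) (E k) =
      (\<lambda>y. \<i> * (of_real (\<tau> k $ j) - p j (\<xi> k) * (c j (fst y $ j) - mean_coeff (c j))) * E k y)"
    "\<And>l k. partial_deriv (0, axis l 1) (E k) = (\<lambda>y. \<i> * of_real (real_vec (\<xi> k) $ l) * E k y)"
proof -
  define r where "r k = 1 + norm (\<tau> k, real_vec (\<xi> k))" for k
  have r: "1 \<le> r k" for k by (simp add: r_def)
  have "\<exists>\<gamma>. \<gamma> \<in> smooth_torus \<and> partial_deriv 1 \<gamma> = (\<lambda>s. c j s - mean_coeff (c j))" for j
    using periodic_antiderivative[OF c] by metis
  then obtain \<gamma> where \<gamma>: "\<And>j. \<gamma> j \<in> smooth_torus" "\<And>j. partial_deriv 1 (\<gamma> j) = (\<lambda>s. c j s - mean_coeff (c j))"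
    by metis
  define \<Gamma> where "\<Gamma> j = (\<lambda>y :: (real ^ 'n) \<times> (real ^ 'N). \<gamma> j (fst y $ j + 0))" for j
  have lin: "bounded_linear (\<lambda>y :: (real ^ 'n) \<times> (real ^ 'N). fst y $ j)" for j
    by (intro bounded_linear_compose[OF bounded_linear_vec_nth] bounded_linear_fst)
  have \<Gamma>: "\<Gamma> j \<in> smooth_torus" for j
    unfolding \<Gamma>_def
  proof (rule smooth_torus_pullback[OF \<gamma>(1) lin])
    fix b :: "(real ^ 'n) \<times> (real ^ 'N)" assume "b \<in> Basis"
    then show "fst b $ j \<in> insert 0 Basis" by (cases rule: Basis_torus_cases) (auto simp: axis_def)
  qed
  have \<Gamma>_deriv: "partial_deriv b (\<Gamma> j) = (\<lambda>y. partial_deriv (fst b $ j) (\<gamma> j) (fst y $ j))" for b j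
    unfolding \<Gamma>_def using partial_deriv_pullback(1)[OF smooth_torus_differentiable[OF \<gamma>(1)] lin, of b j j 0]
    by simp
  define X where "X k y = (\<Sum>j\<in>UNIV. - \<i> * p j (\<xi> k) * \<Gamma> j y)" for k y
  have X: "X k \<in> smooth_torus" for k
    unfolding X_def by (intro smooth_torus_sum smooth_torus_cmult \<Gamma>)
  have X_tempered: "tempered r X"
    unfolding X_def[abs_def]
  proof (rule tempered_sum[OF r], rule tempered_mult[OF r])
    show "tempered r (\<lambda>k. \<Gamma> j)" for j by (rule tempered_fixed[OF \<Gamma> r])
    show "tempered r (\<lambda>k x :: (real ^ 'n) \<times> (real ^ 'N). - \<i> * p j (\<xi> k))" for j
    proof -
      obtain D q where D: "0 < D" "\<And>\<xi>. cmod (p j \<xi>) \<le> D * (1 + norm (real_vec \<xi>)) ^ q"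
        using toroidal_symbol_polynomial_bound[OF p] by metis
      have "cmod (- \<i> * p j (\<xi> k)) \<le> D * r k ^ q" for k
      proof -
        have "cmod (- \<i> * p j (\<xi> k)) \<le> D * (1 + norm (real_vec (\<xi> k))) ^ q"
          using D(2) by (simp add: norm_mult)
        also have "\<dots> \<le> D * r k ^ q"
          using D(1) norm_snd_le[of "real_vec (\<xi> k)" "\<tau> k"] unfolding r_def
          by (intro mult_left_mono power_mono) auto
        finally show ?thesis .
      qed
      then show ?thesis by (rule tempered_const)
    qed
  qed
  have X_deriv: "partial_deriv b (X k) = (\<lambda>y. \<Sum>j\<in>UNIV. - \<i> * p j (\<xi> k) * partial_deriv b (\<Gamma> j) y)" for b k
  proof
    fix y
    have "(X k has_derivative (\<lambda>h. \<Sum>j\<in>UNIV. - \<i> * p j (\<xi> k) * frechet_derivative (\<Gamma> j) (at y) h)) (at y)"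
      unfolding X_def using smooth_torus_differentiable[OF \<Gamma>]
      by (intro has_derivative_sum has_derivative_mult_right) (simp add: frechet_derivative_works[symmetric])
    from partial_deriv_eq[OF this] show "partial_deriv b (X k) y = (\<Sum>j\<in>UNIV. - \<i> * p j (\<xi> k) * partial_deriv b (\<Gamma> j) y)"
      using partial_deriv_eq[OF smooth_torus_differentiable[OF \<Gamma>, unfolded frechet_derivative_works]] by simp
  qed
  \<comment> \<open>the conjugating factor, whose modulus attains its maximum at \<open>y k\<close>\<close>
  define W where "W k y = exp (X k y)" for k y
  have W: "W k \<in> smooth_torus" for k unfolding W_def[abs_def] by (rule smooth_torus_exp(1)[OF X])
  have "\<exists>y. \<forall>x. cmod (W k x) \<le> cmod (W k y)" for k
  proof -
    have "continuous_on UNIV (\<lambda>y. cmod (W k y))" by (intro continuous_intros smooth_torus_continuous W)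
    moreover have "torus_periodic (\<lambda>y. cmod (W k y))"
      using smooth_torus_periodic[OF W] by (simp add: torus_periodic_def)
    ultimately show ?thesis using torus_periodic_attains_sup by metis
  qed
  then obtain y where y: "\<And>k x. cmod (W k x) \<le> cmod (W k (y k))" by metis
  have W_pos: "0 < cmod (W k x)" for k x by (simp add: W_def)
  define z where "z k = (\<tau> k, real_vec (\<xi> k))" for k
  have z: "z k \<in> lattice" for k using \<tau> by (simp add: z_def lattice_Pair_iff)
  define E where "E k x = 1 / of_real (cmod (W k (y k))) * (W k x * character (z k) x)" for k x
  have E: "E k \<in> smooth_torus" for k
    unfolding E_def by (intro smooth_torus_cmult smooth_torus_mult W smooth_torus_character z)
  have E_le: "cmod (E k x) \<le> 1" for k x
    using y[of k x] W_pos[of k "y k"] by (simp add: E_def norm_mult norm_divide)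
  define h where "h b k x = partial_deriv b (X k) x + \<i> * of_real (z k \<bullet> b)" for b k x
  have E_deriv: "partial_deriv b (E k) = (\<lambda>x. h b k x * E k x)" for b k
  proof -
    have "partial_deriv b (W k) = (\<lambda>x. partial_deriv b (X k) x * W k x)"
      unfolding W_def[abs_def] by (rule smooth_torus_exp(2)[OF X])
    then have "partial_deriv b (\<lambda>x. W k x * character (z k) x) = (\<lambda>x. h b k x * (W k x * character (z k) x))"
      using smooth_torus_differentiable[OF W] smooth_torus_differentiable[OF smooth_torus_character[OF z]]
      by (simp add: partial_deriv_mult partial_deriv_character h_def algebra_simps)
    then show ?thesis
      unfolding E_def[abs_def]
      by (subst partial_deriv_cmult) (auto intro!: smooth_torus_mult W smooth_torus_character z)
  qed
  have W_indep: "W k (t, x) = W k (t, 0)" for k t x by (simp add: W_def X_def \<Gamma>_def)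
  show ?thesis
  proof (rule that)
    show "tempered (\<lambda>k. 1 + norm (\<tau> k, real_vec (\<xi> k))) E"
      unfolding r_def[symmetric]
    proof (rule tempered_log_deriv[OF r E E_le _ E_deriv])
      fix b :: "(real ^ 'n) \<times> (real ^ 'N)" assume b: "b \<in> Basis"
      show "tempered r (h b)"
        unfolding h_def[abs_def]
      proof (intro tempered_add tempered_partial_deriv X_tempered r b)
        have "cmod (\<i> * of_real (z k \<bullet> b)) \<le> 1 * r k ^ 1" for k
          using Basis_le_norm[OF b, of "z k"] by (simp add: norm_mult r_def z_def)
        then show "tempered r (\<lambda>k x :: (real ^ 'n) \<times> (real ^ 'N). \<i> * of_real (z k \<bullet> b))" by (rule tempered_const)
      qed
    qed
    show "cmod (E k x) \<le> 1" for k x by (rule E_le)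
    show "\<exists>t. cmod (E k (t, 0)) = 1" for k
      using W_pos[of k "y k"] W_indep[of k "fst (y k)" "snd (y k)"]
      by (intro exI[of _ "fst (y k)"]) (simp add: E_def norm_mult norm_divide)
    show "E k (t, x) = E k (t, 0) * character (real_vec (\<xi> k)) x" for k t x
      using W_indep[of k t x] by (simp add: E_def z_def character_Pair)
    show "partial_deriv (axis j 1, 0) (E k) =
      (\<lambda>y. \<i> * (of_real (\<tau> k $ j) - p j (\<xi> k) * (c j (fst y $ j) - mean_coeff (c j))) * E k y)" for j k
    proof -
      have "partial_deriv (axis j 1, 0) (\<Gamma> i) y = (if i = j then c j (fst y $ j) - mean_coeff (c j) else 0)" for i y
        unfolding \<Gamma>_deriv using \<gamma>(2) by (simp add: axis_def)
      then have "h (axis j 1, 0) k y = \<i> * (of_real (\<tau> k $ j) - p j (\<xi> k) * (c j (fst y $ j) - mean_coeff (c j)))" for y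
        unfolding h_def X_deriv
        by (simp add: if_distrib[of "\<lambda>x. _ * x"] z_def inner_axis algebra_simps cong: if_cong)
      then show ?thesis by (simp add: E_deriv)
    qed
    show "partial_deriv (0, axis l 1) (E k) = (\<lambda>y. \<i> * of_real (real_vec (\<xi> k) $ l) * E k y)" for l k
    proof -
      have "h (0, axis l 1) k y = \<i> * of_real (real_vec (\<xi> k) $ l)" for y
        unfolding h_def X_deriv \<Gamma>_deriv by (simp add: z_def inner_axis)
      then show ?thesis by (simp add: E_deriv)
    qed
  qed
qed

section \<open>Lacunary superpositions of quasimodes\<close>

lemma smooth_torus_slice:
  assumes f: "f \<in> smooth_torus"
  shows "(\<lambda>x. f (t, x)) \<in> smooth_torus"
    and "set bs \<subseteq> Basis \<Longrightarrow> fold partial_deriv bs (\<lambda>x. f (t, x)) = (\<lambda>x. fold partial_deriv (map (Pair 0) bs) f (t, x))"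
proof -
  have lin: "bounded_linear (\<lambda>x :: 'b. (0 :: 'a, x))"
    by (intro bounded_linear_Pair bounded_linear_zero bounded_linear_ident)
  have smooth: "(\<lambda>x. f (t, x)) \<in> smooth_torus" if "f \<in> smooth_torus" for f :: "'a \<times> 'b \<Rightarrow> complex"
    using smooth_torus_pullback[OF that lin, of "(t, 0)"] by (simp add: Basis_prod_def)
  have deriv: "partial_deriv b (\<lambda>x. f (t, x)) = (\<lambda>x. partial_deriv (0, b) f (t, x))"
    if "f \<in> smooth_torus" for f :: "'a \<times> 'b \<Rightarrow> complex" and b
    using partial_deriv_pullback(1)[OF smooth_torus_differentiable[OF that] lin, of b "(t, 0)"] by simp
  show "(\<lambda>x. f (t, x)) \<in> smooth_torus" by (rule smooth[OF f])
  show "fold partial_deriv bs (\<lambda>x. f (t, x)) = (\<lambda>x. fold partial_deriv (map (Pair 0) bs) f (t, x))"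
    if "set bs \<subseteq> Basis"
    using that f
  proof (induction bs arbitrary: f)
    case (Cons b bs)
    have "(0 :: 'a, b) \<in> Basis" using Cons.prems by (auto simp: Basis_prod_def)
    then show ?case using Cons by (simp add: deriv smooth_torus_partial_deriv)
  qed simp
qed

lemma torus_Ck_norm_slice:
  fixes f :: "'a::euclidean_space \<times> 'b::euclidean_space \<Rightarrow> complex"
  assumes f: "f \<in> smooth_torus"
  obtains C where "\<And>t. torus_Ck_norm k (\<lambda>x. f (t, x)) \<le> C"
proof
  fix t
  show "torus_Ck_norm k (\<lambda>x. f (t, x)) \<le>
      (\<Sum>bs | set bs \<subseteq> (Basis :: 'b set) \<and> length bs \<le> k. torus_Ck_norm k f)"
  proof (rule torus_Ck_norm_least)
    fix bs :: "'b list" and x :: 'b assume bs: "set bs \<subseteq> Basis" "length bs \<le> k"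
    have "set (map (Pair (0 :: 'a)) bs) \<subseteq> Basis" using bs by (auto simp: Basis_prod_def)
    then show "cmod (fold partial_deriv bs (\<lambda>x. f (t, x)) x) \<le> torus_Ck_norm k f"
      unfolding smooth_torus_slice(2)[OF f bs(1)] using bs by (intro torus_Ck_norm_upper f) auto
  qed
qed

text \<open>
  What is used of the quasimodes to define their sum as a distribution and to see that it is not
  smooth: plane waves in \<open>x\<close> with distinct, exponentially growing frequencies, whose amplitudes in
  \<open>t\<close> have maximum \<open>1\<close>.
\<close>

locale lacunary_quasimodes =
  fixes \<xi> :: "nat \<Rightarrow> int ^ 'N::finite" and E :: "nat \<Rightarrow> (real ^ 'n::finite) \<times> (real ^ 'N) \<Rightarrow> complex"
  assumes inj: "inj \<xi>" and lacunary: "\<And>k. 2 ^ k \<le> norm (real_vec (\<xi> k))"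
    and E_smooth: "\<And>k. E k \<in> smooth_torus" and E_le: "\<And>k y. cmod (E k y) \<le> 1"
    and E_peak: "\<And>k. \<exists>t. cmod (E k (t, 0)) = 1"
    and E_tensor: "\<And>k t x. E k (t, x) = E k (t, 0) * character (real_vec (\<xi> k)) x"
    and E_x_deriv: "\<And>l k. partial_deriv (0, axis l 1) (E k) = (\<lambda>y. \<i> * of_real (real_vec (\<xi> k) $ l) * E k y)"
begin

definition pairing :: "nat \<Rightarrow> ((real ^ 'n) \<times> (real ^ 'N)) functional" where
  "pairing k \<phi> = torus_integral (\<lambda>y. E k y * \<phi> y)"

definition superposition :: "((real ^ 'n) \<times> (real ^ 'N)) functional" where
  "superposition \<phi> = (\<Sum>k. pairing k \<phi>)"

lemma pairing_decay:
  assumes \<phi>: "\<phi> \<in> smooth_torus"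
  shows "(1 + norm (real_vec (\<xi> k))) ^ M * cmod (pairing k \<phi>) \<le>
    (2 * pi) ^ DIM((real ^ 'n) \<times> (real ^ 'N)) * (1 + real DIM((real ^ 'n) \<times> (real ^ 'N))) ^ M * torus_Ck_norm M \<phi>"
proof -
  let ?B = "Pair (0 :: real ^ 'n) ` (Basis :: (real ^ 'N) set)"
  have "norm (real_vec (\<xi> k)) \<le> (\<Sum>b\<in>Basis. \<bar>real_vec (\<xi> k) \<bullet> b\<bar>)" by (rule norm_le_l1)
  also have "\<dots> = (\<Sum>b\<in>?B. \<bar>real_vec (\<xi> k) \<bullet> snd b\<bar>)" by (subst sum.reindex) (auto simp: inj_on_def)
  finally have "(1 + norm (real_vec (\<xi> k))) ^ M * cmod (pairing k \<phi>) \<le>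
      (1 + (\<Sum>b\<in>?B. \<bar>real_vec (\<xi> k) \<bullet> snd b\<bar>)) ^ M * cmod (torus_integral (\<lambda>y. E k y * \<phi> y))"
    unfolding pairing_def by (intro mult_right_mono power_mono) auto
  also have "\<dots> \<le> (2 * pi) ^ DIM((real ^ 'n) \<times> (real ^ 'N)) * (1 + real DIM((real ^ 'n) \<times> (real ^ 'N))) ^ M * torus_Ck_norm M \<phi>"
  proof (rule torus_oscillatory_integral_decay[OF E_smooth E_le _ _ \<phi>])
    show "?B \<subseteq> Basis" by (auto simp: Basis_prod_def)
    show "partial_deriv b (E k) = (\<lambda>x. \<i> * complex_of_real (real_vec (\<xi> k) \<bullet> snd b) * E k x)" if "b \<in> ?B" for b
      using that E_x_deriv[of _ k] by (auto simp: Basis_vec_def inner_axis)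
  qed
  finally show ?thesis .
qed

lemma pairing_geometric:
  obtains K where "0 \<le> K" "\<And>k \<phi>. \<phi> \<in> smooth_torus \<Longrightarrow> cmod (pairing k \<phi>) \<le> K * torus_Ck_norm 1 \<phi> * (1 / 2) ^ k"
proof -
  let ?K = "(2 * pi) ^ DIM((real ^ 'n) \<times> (real ^ 'N)) * (1 + real DIM((real ^ 'n) \<times> (real ^ 'N)))"
  show ?thesis
  proof (rule that)
    show "0 \<le> ?K" by simp
    fix k and \<phi> :: "(real ^ 'n) \<times> (real ^ 'N) \<Rightarrow> complex" assume \<phi>: "\<phi> \<in> smooth_torus"
    have "2 ^ k * cmod (pairing k \<phi>) \<le> (1 + norm (real_vec (\<xi> k))) * cmod (pairing k \<phi>)"
      using lacunary[of k] by (intro mult_right_mono) auto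
    also have "\<dots> \<le> ?K * torus_Ck_norm 1 \<phi>" using pairing_decay[OF \<phi>, of k 1] by simp
    finally show "cmod (pairing k \<phi>) \<le> ?K * torus_Ck_norm 1 \<phi> * (1 / 2) ^ k"
      by (simp add: power_divide field_simps)
  qed
qed

lemma summable_pairing: "\<phi> \<in> smooth_torus \<Longrightarrow> summable (\<lambda>k. pairing k \<phi>)"
proof -
  assume \<phi>: "\<phi> \<in> smooth_torus"
  obtain K where K: "\<And>k \<phi>. \<phi> \<in> smooth_torus \<Longrightarrow> cmod (pairing k \<phi>) \<le> K * torus_Ck_norm 1 \<phi> * (1 / 2) ^ k"
    using pairing_geometric by metis
  have "summable (\<lambda>k. K * torus_Ck_norm 1 \<phi> * (1 / 2) ^ k)"
    by (intro summable_mult summable_geometric) simp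
  then show ?thesis by (rule summable_comparison_test'[where N = 0]) (rule K[OF \<phi>])
qed

lemma torus_distribution_superposition: "torus_distribution superposition"
  unfolding torus_distribution_def
proof (intro conjI ballI allI)
  fix \<phi> \<psi> :: "(real ^ 'n) \<times> (real ^ 'N) \<Rightarrow> complex" assume \<phi>: "\<phi> \<in> smooth_torus" and \<psi>: "\<psi> \<in> smooth_torus"
  have "pairing k (\<lambda>x. \<phi> x + \<psi> x) = pairing k \<phi> + pairing k \<psi>" for k
    unfolding pairing_def distrib_left
    by (intro torus_integral_add smooth_torus_continuous smooth_torus_mult E_smooth \<phi> \<psi>)
  then show "superposition (\<lambda>x. \<phi> x + \<psi> x) = superposition \<phi> + superposition \<psi>"
    unfolding superposition_def using suminf_add[OF summable_pairing[OF \<phi>] summable_pairing[OF \<psi>]] by simp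
next
  fix a and \<phi> :: "(real ^ 'n) \<times> (real ^ 'N) \<Rightarrow> complex" assume \<phi>: "\<phi> \<in> smooth_torus"
  have "pairing k (\<lambda>x. a * \<phi> x) = a * pairing k \<phi>" for k
    unfolding pairing_def mult.left_commute[of _ a] by (rule torus_integral_cmult)
  then show "superposition (\<lambda>x. a * \<phi> x) = a * superposition \<phi>"
    unfolding superposition_def using suminf_mult[OF summable_pairing[OF \<phi>]] by simp
next
  obtain K where K: "0 \<le> K" "\<And>k \<phi>. \<phi> \<in> smooth_torus \<Longrightarrow> cmod (pairing k \<phi>) \<le> K * torus_Ck_norm 1 \<phi> * (1 / 2) ^ k"
    using pairing_geometric by metis
  have "cmod (superposition \<phi>) \<le> 2 * K * torus_Ck_norm 1 \<phi>" if \<phi>: "\<phi> \<in> smooth_torus" for \<phi>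
  proof -
    have "cmod (superposition \<phi>) \<le> (\<Sum>k. K * torus_Ck_norm 1 \<phi> * (1 / 2) ^ k)"
      unfolding superposition_def
      by (rule norm_suminf_le[OF K(2)[OF \<phi>]]) (intro summable_mult summable_geometric, simp)
    also have "\<dots> = K * torus_Ck_norm 1 \<phi> * (\<Sum>k. (1 / 2) ^ k)"
      by (rule suminf_mult) (simp add: summable_geometric)
    finally show ?thesis by (simp add: suminf_geometric)
  qed
  then show "\<exists>C k. \<forall>\<phi>\<in>smooth_torus. cmod (superposition \<phi>) \<le> C * torus_Ck_norm k \<phi>"
    by (intro exI[of _ "2 * K"] exI[of _ 1] ballI)
qed

text \<open>
  Integrating over \<open>x\<close> first leaves the orthogonality relation of the characters in \<open>x\<close>.
\<close>

lemma pairing_tensor: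
  assumes \<psi>: "continuous_on UNIV \<psi>"
  shows "pairing k (\<lambda>(t, x). \<psi> t * cis (- (x \<bullet> real_vec \<eta>))) =
    (if \<eta> = \<xi> k then (2 * pi) ^ CARD('N) * torus_integral (\<lambda>t. E k (t, 0) * \<psi> t) else 0)"
proof -
  have "pairing k (\<lambda>(t, x). \<psi> t * cis (- (x \<bullet> real_vec \<eta>))) =
      torus_integral (\<lambda>t. torus_integral (\<lambda>x. E k (t, x) * (\<psi> t * cis (- (x \<bullet> real_vec \<eta>)))))"
    unfolding pairing_def case_prod_unfold
    by (subst torus_integral_Pair)
      (auto intro!: continuous_intros smooth_torus_continuous[OF E_smooth] continuous_on_compose2[OF \<psi>])
  also have "\<dots> = torus_integral (\<lambda>t. (if \<eta> = \<xi> k then (2 * pi) ^ CARD('N) else 0) * (E k (t, 0) * \<psi> t))"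
  proof (rule arg_cong[where f = torus_integral], rule ext)
    fix t
    have "torus_integral (\<lambda>x. E k (t, x) * (\<psi> t * cis (- (x \<bullet> real_vec \<eta>)))) =
        torus_integral (\<lambda>x. E k (t, 0) * \<psi> t * character (real_vec (\<xi> k) - real_vec \<eta>) x)"
    proof (rule arg_cong[where f = torus_integral], rule ext)
      fix x
      show "E k (t, x) * (\<psi> t * cis (- (x \<bullet> real_vec \<eta>))) = E k (t, 0) * \<psi> t * character (real_vec (\<xi> k) - real_vec \<eta>) x"
        unfolding E_tensor[of k t x] by (simp add: character_def cis_mult inner_diff_left inner_diff_right inner_commute)
    qed
    also have "\<dots> = E k (t, 0) * \<psi> t * (if \<eta> = \<xi> k then (2 * pi) ^ CARD('N) else 0)"
      unfolding torus_integral_cmult by (subst torus_integral_character) (auto intro: lattice_diff)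
    finally show "torus_integral (\<lambda>x. E k (t, x) * (\<psi> t * cis (- (x \<bullet> real_vec \<eta>)))) =
      (if \<eta> = \<xi> k then (2 * pi) ^ CARD('N) else 0) * (E k (t, 0) * \<psi> t)" by simp
  qed
  finally show ?thesis unfolding torus_integral_cmult by simp
qed

lemma partial_fourier_superposition:
  assumes \<psi>: "continuous_on UNIV \<psi>"
  shows "partial_fourier superposition (\<xi> k) \<psi> = torus_integral (\<lambda>t. E k (t, 0) * \<psi> t)"
    and "\<eta> \<notin> range \<xi> \<Longrightarrow> partial_fourier superposition \<eta> \<psi> = 0"
proof -
  have eq: "(\<lambda>i. pairing i (\<lambda>(t, x). \<psi> t * cis (- (x \<bullet> real_vec (\<xi> k))))) =
     (\<lambda>i. if i = k then (2 * pi) ^ CARD('N) * torus_integral (\<lambda>t. E k (t, 0) * \<psi> t) else 0)"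
    unfolding pairing_tensor[OF \<psi>] using inj by (auto simp: inj_eq)
  have "superposition (\<lambda>(t, x). \<psi> t * cis (- (x \<bullet> real_vec (\<xi> k)))) =
      (2 * pi) ^ CARD('N) * torus_integral (\<lambda>t. E k (t, 0) * \<psi> t)"
    unfolding superposition_def eq by (rule sums_unique[OF sums_single, symmetric])
  then show "partial_fourier superposition (\<xi> k) \<psi> = torus_integral (\<lambda>t. E k (t, 0) * \<psi> t)"
    unfolding partial_fourier_def by simp
  show "partial_fourier superposition \<eta> \<psi> = 0" if "\<eta> \<notin> range \<xi>"
    unfolding partial_fourier_def superposition_def pairing_tensor[OF \<psi>] using that by (auto simp: image_iff)
qed

text \<open>
  The partial Fourier coefficient of the superposition at \<open>\<xi> k\<close> is the amplitude of the \<open>k\<close>-th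
  quasimode, and it vanishes at all other frequencies. So the series over all frequencies reduces to
  one over \<open>k\<close>. It converges absolutely because integration by parts in \<open>x\<close> beats the polynomial growth of
  the symbol with one power to spare.
\<close>

lemma psi_op_superposition:
  assumes p: "p \<in> toroidal_symbols m" and \<phi>: "\<phi> \<in> smooth_torus"
  shows "(\<lambda>k. p (\<xi> k) * pairing k \<phi>) sums psi_op p superposition \<phi>"
proof -
  define \<psi> where "\<psi> \<eta> t = torus_integral (\<lambda>x. cis (x \<bullet> real_vec \<eta>) * \<phi> (t, x))" for \<eta> t
  have \<psi>: "continuous_on UNIV (\<psi> \<eta>)" for \<eta>
    unfolding \<psi>_def torus_integral_def
    by (rule integral_continuous_on_param)
      (auto simp: case_prod_unfold intro!: continuous_intros continuous_on_compose2[OF smooth_torus_continuous[OF \<phi>, of UNIV]])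
  have coeff: "exp_tensor (\<xi> k) (partial_fourier superposition (\<xi> k)) \<phi> = pairing k \<phi>" for k
  proof -
    have "exp_tensor (\<xi> k) (partial_fourier superposition (\<xi> k)) \<phi> = torus_integral (\<lambda>t. E k (t, 0) * \<psi> (\<xi> k) t)"
      unfolding exp_tensor_def \<psi>_def[symmetric] by (rule partial_fourier_superposition(1)[OF \<psi>])
    also have "\<dots> = torus_integral (\<lambda>t. torus_integral (\<lambda>x. E k (t, x) * \<phi> (t, x)))"
    proof -
      have "E k (t, 0) * (cis (x \<bullet> real_vec (\<xi> k)) * \<phi> (t, x)) = E k (t, x) * \<phi> (t, x)" for t x
        using E_tensor[of k t x] by (simp add: character_def inner_commute)
      then show ?thesis unfolding \<psi>_def torus_integral_cmult[symmetric] by (simp only:)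
    qed
    also have "\<dots> = pairing k \<phi>"
      unfolding pairing_def
      by (subst torus_integral_Pair) (auto intro!: smooth_torus_continuous smooth_torus_mult E_smooth \<phi>)
    finally show ?thesis .
  qed
  have zero: "exp_tensor \<eta> (partial_fourier superposition \<eta>) \<phi> = 0" if "\<eta> \<notin> range \<xi>" for \<eta>
    unfolding exp_tensor_def \<psi>_def[symmetric] by (rule partial_fourier_superposition(2)[OF \<psi> that])
  obtain D q where D: "0 < D" "\<And>\<eta>. cmod (p \<eta>) \<le> D * (1 + norm (real_vec \<eta>)) ^ q"
    using toroidal_symbol_polynomial_bound[OF p] by metis
  define K where "K = (2 * pi) ^ DIM((real ^ 'n) \<times> (real ^ 'N)) * (1 + real DIM((real ^ 'n) \<times> (real ^ 'N))) ^ (q + 1) * torus_Ck_norm (q + 1) \<phi>"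
  have bound: "cmod (p (\<xi> k) * pairing k \<phi>) \<le> D * K * (1 / 2) ^ k" for k
  proof -
    let ?s = "1 + norm (real_vec (\<xi> k))"
    have "2 ^ k * cmod (p (\<xi> k) * pairing k \<phi>) \<le> ?s * (D * ?s ^ q * cmod (pairing k \<phi>))"
      unfolding norm_mult using lacunary[of k] by (intro mult_mono mult_right_mono D) auto
    also have "\<dots> = D * (?s ^ (q + 1) * cmod (pairing k \<phi>))" by simp
    also have "\<dots> \<le> D * K" unfolding K_def using D(1) by (intro mult_left_mono pairing_decay \<phi>) auto
    finally show ?thesis by (simp add: power_divide field_simps)
  qed
  have norm_summable: "summable (\<lambda>k. cmod (p (\<xi> k) * pairing k \<phi>))"
  proof (rule summable_comparison_test'[where N = 0])
    show "summable (\<lambda>k. D * K * (1 / 2) ^ k)" by (intro summable_mult summable_geometric) simp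
    show "norm (cmod (p (\<xi> k) * pairing k \<phi>)) \<le> D * K * (1 / 2) ^ k" for k using bound[of k] by simp
  qed
  have "psi_op p superposition \<phi> = (\<Sum>\<^sub>\<infinity>\<eta>\<in>range \<xi>. p \<eta> * exp_tensor \<eta> (partial_fourier superposition \<eta>) \<phi>)"
    unfolding psi_op_def by (rule infsum_cong_neutral) (auto simp: zero)
  also have "\<dots> = (\<Sum>\<^sub>\<infinity>k. p (\<xi> k) * pairing k \<phi>)"
    unfolding infsum_reindex[OF inj] by (simp add: o_def coeff)
  also have "\<dots> = (\<Sum>k. p (\<xi> k) * pairing k \<phi>)"
    by (rule infsumI[OF norm_summable_imp_has_sum[OF norm_summable summable_sums]]) (rule summable_norm_cancel[OF norm_summable])
  finally show ?thesis using summable_sums[OF summable_norm_cancel[OF norm_summable]] by simp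
qed

text \<open>
  If a smooth function represented the superposition, its partial Fourier coefficients in \<open>x\<close> would
  be the amplitudes of the quasimodes, pointwise in \<open>t\<close> by uniqueness of Fourier coefficients in the
  variables \<open>t\<close>. These coefficients tend to zero uniformly in \<open>t\<close>, but the amplitudes have maximum \<open>1\<close>.
\<close>

lemma not_smooth_superposition: "\<not> smooth_distribution superposition"
proof
  assume "smooth_distribution superposition"
  then obtain f where f: "f \<in> smooth_torus"
    "\<And>\<phi>. \<phi> \<in> smooth_torus \<Longrightarrow> superposition \<phi> = torus_integral (\<lambda>y. f y * \<phi> y)"
    unfolding smooth_distribution_def by blast
  define F where "F k t = torus_integral (\<lambda>x. character (- real_vec (\<xi> k)) x * f (t, x))" for k t
  have F_cont: "continuous_on UNIV (F k)" for k
    unfolding F_def torus_integral_def character_def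
    by (rule integral_continuous_on_param)
      (auto simp: case_prod_unfold intro!: continuous_intros continuous_on_compose2[OF smooth_torus_continuous[OF f(1), of UNIV]])
  have E0: "(\<lambda>t. E k (t, 0)) \<in> smooth_torus" for k
  proof -
    have lin: "bounded_linear (\<lambda>t :: real ^ 'n. (t, 0 :: real ^ 'N))"
      by (intro bounded_linear_Pair bounded_linear_zero bounded_linear_ident)
    show ?thesis using smooth_torus_pullback[OF E_smooth lin, of k 0] by (simp add: Basis_prod_def zero_prod_def)
  qed
  have eq: "(2 * pi) ^ CARD('N) * E k (t, 0) = F k t" for k t
  proof -
    have "(2 * pi) ^ CARD('N) * E k (t, 0) - F k t = 0"
    proof (rule fourier_uniqueness[of "\<lambda>t. (2 * pi) ^ CARD('N) * E k (t, 0) - F k t"])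
      show "continuous_on UNIV (\<lambda>t. (2 * pi) ^ CARD('N) * E k (t, 0) - F k t)"
        by (intro continuous_intros F_cont smooth_torus_continuous E0)
      show "torus_periodic (\<lambda>t. (2 * pi) ^ CARD('N) * E k (t, 0) - F k t)"
        unfolding torus_periodic_def
      proof (intro allI ballI)
        fix t b :: "real ^ 'n" assume b: "b \<in> Basis"
        have "f (t + (2 * pi) *\<^sub>R b, x) = f (t, x)" for x
          using torus_periodicD[OF smooth_torus_periodic[OF f(1)], of "(b, 0)" "(t, x)"] b
          by (simp add: Basis_prod_def)
        then show "(2 * pi) ^ CARD('N) * E k (t + (2 * pi) *\<^sub>R b, 0) - F k (t + (2 * pi) *\<^sub>R b) =
            (2 * pi) ^ CARD('N) * E k (t, 0) - F k t"
          using torus_periodicD[OF smooth_torus_periodic[OF E0] b] by (simp add: F_def)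
      qed
      fix \<tau> :: "real ^ 'n" assume \<tau>: "\<tau> \<in> lattice"
      let ?\<phi> = "character (\<tau>, - real_vec (\<xi> k))"
      have \<phi>: "?\<phi> \<in> smooth_torus"
        by (intro smooth_torus_character) (simp add: lattice_Pair_iff \<tau> lattice_uminus)
      have cont: "continuous_on UNIV (character \<tau>)" by (intro smooth_torus_continuous smooth_torus_character \<tau>)
      have "?\<phi> = (\<lambda>(t, x). character \<tau> t * cis (- (x \<bullet> real_vec (\<xi> k))))"
        by (auto simp: fun_eq_iff character_Pair) (simp add: character_def inner_commute)
      then have "superposition ?\<phi> = (2 * pi) ^ CARD('N) * partial_fourier superposition (\<xi> k) (character \<tau>)"
        by (simp add: partial_fourier_def)
      also have "\<dots> = torus_integral (\<lambda>t. (2 * pi) ^ CARD('N) * E k (t, 0) * character \<tau> t)"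
        unfolding partial_fourier_superposition(1)[OF cont] mult.assoc torus_integral_cmult ..
      finally have 1: "superposition ?\<phi> = torus_integral (\<lambda>t. (2 * pi) ^ CARD('N) * E k (t, 0) * character \<tau> t)" .
      have "superposition ?\<phi> = torus_integral (\<lambda>t. torus_integral (\<lambda>x. f (t, x) * ?\<phi> (t, x)))"
        unfolding f(2)[OF \<phi>] by (intro torus_integral_Pair smooth_torus_continuous smooth_torus_mult f \<phi>)
      also have "\<dots> = torus_integral (\<lambda>t. torus_integral (\<lambda>x. character \<tau> t * (character (- real_vec (\<xi> k)) x * f (t, x))))"
        by (simp add: character_Pair mult_ac)
      also have "\<dots> = torus_integral (\<lambda>t. F k t * character \<tau> t)"
        unfolding torus_integral_cmult F_def[symmetric] by (simp add: mult.commute)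
      finally have 2: "superposition ?\<phi> = torus_integral (\<lambda>t. F k t * character \<tau> t)" .
      show "torus_integral (\<lambda>t. ((2 * pi) ^ CARD('N) * E k (t, 0) - F k t) * character \<tau> t) = 0"
        unfolding left_diff_distrib using 1 2
        by (subst torus_integral_diff)
          (auto intro!: continuous_intros F_cont cont smooth_torus_continuous[OF E0])
    qed
    then show ?thesis by simp
  qed
  obtain C where C: "\<And>t. torus_Ck_norm 1 (\<lambda>x. f (t, x)) \<le> C" using torus_Ck_norm_slice[OF f(1)] by metis
  define K where "K = (2 * pi) ^ DIM(real ^ 'N) * (1 + real DIM(real ^ 'N)) ^ 1"
  have le: "2 ^ k \<le> K * C" for k
  proof -
    obtain t where t: "cmod (E k (t, 0)) = 1" using E_peak by blast
    have pi_ge: "1 \<le> (2 * pi) ^ CARD('N)" using pi_gt3 by (intro one_le_power) linarith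
    have "(2::real) ^ k * 1 \<le> (1 + norm (real_vec (\<xi> k))) * (2 * pi) ^ CARD('N)"
      using lacunary[of k] pi_ge by (intro mult_mono) auto
    also have "(2 * pi) ^ CARD('N) = cmod (F k t)"
      unfolding eq[symmetric] norm_mult t by (simp add: norm_power norm_mult)
    also have "(1 + norm (real_vec (\<xi> k))) * cmod (F k t) \<le>
       (1 + (\<Sum>b\<in>Basis. \<bar>- real_vec (\<xi> k) \<bullet> b\<bar>)) ^ 1 * cmod (F k t)"
      using norm_le_l1[of "real_vec (\<xi> k)"] by (intro mult_right_mono) auto
    also have "\<dots> \<le> K * torus_Ck_norm 1 (\<lambda>x. f (t, x))"
      unfolding F_def K_def
      by (rule torus_oscillatory_integral_decay[OF smooth_torus_character _ order_refl _ smooth_torus_slice(1)[OF f(1)]])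
        (auto simp: partial_deriv_character lattice_uminus)
    also have "\<dots> \<le> K * C" by (intro mult_left_mono C) (simp add: K_def)
    finally show ?thesis by simp
  qed
  obtain k where "K * C < 2 ^ k" using real_arch_pow[of 2 "K * C"] by auto
  with le[of k] show False by simp
qed

end

text \<open>
  A derivative of order given by \<open>bs\<close> costs a fixed power \<open>r k ^ n\<close>, while \<open>\<epsilon> k\<close> gains \<open>r k ^ k\<close>. From
  \<open>k = n + 1\<close> on at least one factor \<open>r k\<close> is left, which gives geometric convergence.
\<close>

lemma smooth_summable_resonant:
  assumes r: "\<And>k. 2 ^ k \<le> r k" and E: "tempered r E" and \<epsilon>: "\<And>k. cmod (\<epsilon> k) * r k ^ k \<le> 1"
  shows "smooth_summable (\<lambda>k y. \<epsilon> k * E k y)"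
  unfolding smooth_summable_def
proof (intro conjI allI impI)
  note smooth = tempered_smooth[OF E]
  show "(\<lambda>y. \<epsilon> k * E k y) \<in> smooth_torus" for k by (intro smooth_torus_cmult smooth)
  fix bs :: "'a list" assume bs: "set bs \<subseteq> Basis"
  then obtain C n where C: "\<And>k x. cmod (fold partial_deriv bs (E k) x) \<le> C * r k ^ n"
    using E unfolding tempered_def by meson
  define B where "B k = (if k \<le> n then cmod (\<epsilon> k) * (\<bar>C\<bar> * r k ^ n) else \<bar>C\<bar> * (1 / 2) ^ k)" for k
  have geom: "summable (\<lambda>k. \<bar>C\<bar> * (1 / 2) ^ k)" by (intro summable_mult summable_geometric) auto
  have ev: "\<forall>\<^sub>F k in sequentially. \<bar>C\<bar> * (1 / 2) ^ k = B k"
    using eventually_gt_at_top[of n] by eventually_elim (simp add: B_def)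
  have "summable B" using geom unfolding summable_cong[OF ev] .
  moreover have "cmod (fold partial_deriv bs (\<lambda>y. \<epsilon> k * E k y) x) \<le> B k" for k x
  proof -
    have r1: "1 \<le> r k" using r[of k] one_le_power[of "2::real" k] by linarith
    have "C * r k ^ n \<le> \<bar>C\<bar> * r k ^ n" using r1 by (intro mult_right_mono) auto
    then have "cmod (fold partial_deriv bs (E k) x) \<le> \<bar>C\<bar> * r k ^ n" using C[of k x] by linarith
    then have 1: "cmod (fold partial_deriv bs (\<lambda>y. \<epsilon> k * E k y) x) \<le> cmod (\<epsilon> k) * (\<bar>C\<bar> * r k ^ n)"
      by (simp add: fold_partial_deriv_cmult[OF smooth bs] norm_mult mult_left_mono)
    show ?thesis
    proof (cases "k \<le> n")
      case False
      have "2 ^ k * r k ^ n \<le> r k * r k ^ n" using r r1 by (intro mult_right_mono) auto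
      also have "\<dots> = r k ^ Suc n" by simp
      also have "\<dots> \<le> r k ^ k" using False r1 by (intro power_increasing) auto
      finally have "cmod (\<epsilon> k) * (2 ^ k * r k ^ n) \<le> 1"
        using \<epsilon>[of k] mult_left_mono[of _ _ "cmod (\<epsilon> k)"] by (meson norm_ge_zero order_trans)
      then have "cmod (\<epsilon> k) * r k ^ n \<le> (1 / 2) ^ k" by (simp add: power_divide field_simps)
      from mult_left_mono[OF this, of "\<bar>C\<bar>"]
      have "cmod (\<epsilon> k) * (\<bar>C\<bar> * r k ^ n) \<le> B k" using False by (simp add: B_def mult_ac)
      with 1 show ?thesis by linarith
    qed (use 1 in \<open>simp add: B_def\<close>)
  qed
  ultimately show "\<exists>B. summable B \<and> (\<forall>k x. cmod (fold partial_deriv bs (\<lambda>y. \<epsilon> k * E k y) x) \<le> B k)" by blast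
qed

section \<open>Hypoellipticity of the averaged system\<close>

theorem theorem3p5:
  fixes c :: "'n::finite \<Rightarrow> real \<Rightarrow> complex"
    and p :: "'n \<Rightarrow> int ^ 'N::finite \<Rightarrow> complex"
    and m :: "'n \<Rightarrow> real"
  assumes "\<And>j. c j \<in> smooth_torus"
    and "\<And>j. p j \<in> toroidal_symbols (m j)"
    and "globally_hypoelliptic (system_op c p)"
  shows "globally_hypoelliptic (system_op (\<lambda>j _. mean_coeff (c j)) p)"
  unfolding globally_hypoelliptic_def
proof (intro allI impI, rule ccontr)
  fix u assume u: "torus_distribution u" "\<forall>j. smooth_distribution (system_op (\<lambda>j _. mean_coeff (c j)) p j u)"
    "\<not> smooth_distribution u"
  obtain \<tau> :: "nat \<Rightarrow> real ^ 'n" and \<xi> :: "nat \<Rightarrow> int ^ 'N" where \<tau>: "\<And>k. \<tau> k \<in> lattice"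
    and inj: "inj \<xi>" and lacunary: "\<And>k. 2 ^ k \<le> norm (real_vec (\<xi> k))"
    and res: "\<And>j k. cmod (of_real (\<tau> k $ j) + mean_coeff (c j) * p j (\<xi> k)) * (1 + norm (\<tau> k, real_vec (\<xi> k))) ^ k \<le> 1"
    by (rule resonance_sequence[where a = "\<lambda>j. mean_coeff (c j)", OF u(1,3) _ assms(2)]) (use u(2) in \<open>rule spec\<close>, rule that)
  obtain E :: "nat \<Rightarrow> (real ^ 'n) \<times> (real ^ 'N) \<Rightarrow> complex"
    where E: "tempered (\<lambda>k. 1 + norm (\<tau> k, real_vec (\<xi> k))) E"
    "\<And>k y. cmod (E k y) \<le> 1" "\<And>k. \<exists>t. cmod (E k (t, 0)) = 1"
    "\<And>k t x. E k (t, x) = E k (t, 0) * character (real_vec (\<xi> k)) x"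
    and E_deriv: "\<And>j k. partial_deriv (axis j 1, 0) (E k) =
      (\<lambda>y. \<i> * (of_real (\<tau> k $ j) - p j (\<xi> k) * (c j (fst y $ j) - mean_coeff (c j))) * E k y)"
    and E_x_deriv': "\<And>l k. partial_deriv (0, axis l 1) (E k) = (\<lambda>y. \<i> * of_real (real_vec (\<xi> k) $ l) * E k y)"
    by (rule quasimode_family[where \<xi> = \<xi>, OF assms(1,2) \<tau>]) (rule that)
  note E' = tempered_smooth[OF E(1)]
  interpret lacunary_quasimodes \<xi> E
    by unfold_locales (rule inj lacunary E E' E_x_deriv')+
  have "smooth_distribution (system_op c p j superposition)" for j
  proof -
    define \<epsilon> where "\<epsilon> k = of_real (\<tau> k $ j) + mean_coeff (c j) * p j (\<xi> k)" for k
    have "2 ^ k \<le> 1 + norm (\<tau> k, real_vec (\<xi> k))" for k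
      using lacunary[of k] norm_snd_le[of "real_vec (\<xi> k)" "\<tau> k"] by linarith
    then have sum: "smooth_summable (\<lambda>k y. \<epsilon> k * E k y)"
      using res[where j = j] E(1) unfolding \<epsilon>_def by (intro smooth_summable_resonant)
    have "system_op c p j superposition \<phi> = torus_integral (\<lambda>y. (\<Sum>k. \<epsilon> k * E k y) * \<phi> y)"
      if \<phi>: "\<phi> \<in> smooth_torus" for \<phi>
    proof -
      have lin: "bounded_linear (\<lambda>y :: (real ^ 'n) \<times> (real ^ 'N). fst y $ j)"
        by (intro bounded_linear_compose[OF bounded_linear_vec_nth] bounded_linear_fst)
      have cj: "(\<lambda>y :: (real ^ 'n) \<times> (real ^ 'N). c j (fst y $ j)) \<in> smooth_torus"
      proof -
        have "(\<lambda>y :: (real ^ 'n) \<times> (real ^ 'N). c j (fst y $ j + 0)) \<in> smooth_torus"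
        proof (rule smooth_torus_pullback[OF assms(1) lin])
          fix b :: "(real ^ 'n) \<times> (real ^ 'N)" assume "b \<in> Basis"
          then show "fst b $ j \<in> insert 0 Basis" by (cases rule: Basis_torus_cases) (auto simp: axis_def)
        qed
        then show ?thesis by simp
      qed
      have d\<phi>: "partial_deriv (axis j 1, 0) \<phi> \<in> smooth_torus" by (rule smooth_torus_partial_deriv[OF \<phi>]) simp
      have c\<phi>: "(\<lambda>y. c j (fst y $ j) * \<phi> y) \<in> smooth_torus" by (rule smooth_torus_mult[OF cj \<phi>])
      \<comment> \<open>Each quasimode is an eigenfunction with eigenvalue \<open>\<epsilon> k\<close>, as the terms with \<open>c j\<close> cancel.\<close>
      have "- inverse \<i> * pairing k (partial_deriv (axis j 1, 0) \<phi>) + p j (\<xi> k) * pairing k (\<lambda>y. c j (fst y $ j) * \<phi> y)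
          = torus_integral (\<lambda>y. \<epsilon> k * E k y * \<phi> y)" for k
      proof -
        have "- inverse \<i> * pairing k (partial_deriv (axis j 1, 0) \<phi>) =
            torus_integral (\<lambda>y. inverse \<i> * (partial_deriv (axis j 1, 0) (E k) y * \<phi> y))"
          unfolding pairing_def torus_integration_by_parts[OF E' \<phi> axis_Pair_in_Basis(1)] torus_integral_cmult by simp
        moreover have "p j (\<xi> k) * pairing k (\<lambda>y. c j (fst y $ j) * \<phi> y) =
            torus_integral (\<lambda>y. p j (\<xi> k) * (E k y * (c j (fst y $ j) * \<phi> y)))"
          unfolding pairing_def torus_integral_cmult ..
        moreover have "torus_integral (\<lambda>y. inverse \<i> * (partial_deriv (axis j 1, 0) (E k) y * \<phi> y)) +
            torus_integral (\<lambda>y. p j (\<xi> k) * (E k y * (c j (fst y $ j) * \<phi> y))) =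
          torus_integral (\<lambda>y. inverse \<i> * (partial_deriv (axis j 1, 0) (E k) y * \<phi> y) +
             p j (\<xi> k) * (E k y * (c j (fst y $ j) * \<phi> y)))"
          by (rule torus_integral_add[symmetric])
            (intro smooth_torus_continuous smooth_torus_cmult smooth_torus_mult smooth_torus_partial_deriv
              E' \<phi> cj axis_Pair_in_Basis)+
        moreover have "inverse \<i> * (partial_deriv (axis j 1, 0) (E k) y * \<phi> y) + p j (\<xi> k) * (E k y * (c j (fst y $ j) * \<phi> y))
          = \<epsilon> k * E k y * \<phi> y" for y
          unfolding E_deriv \<epsilon>_def by (simp add: algebra_simps)
        ultimately show ?thesis by simp
      qed
      moreover have "(\<lambda>k. - inverse \<i> * pairing k (partial_deriv (axis j 1, 0) \<phi>) + p j (\<xi> k) * pairing k (\<lambda>y. c j (fst y $ j) * \<phi> y))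
        sums (- inverse \<i> * superposition (partial_deriv (axis j 1, 0) \<phi>) + psi_op (p j) superposition (\<lambda>y. c j (fst y $ j) * \<phi> y))"
        unfolding superposition_def[of "partial_deriv (axis j 1, 0) \<phi>"]
        by (intro sums_add sums_mult summable_sums summable_pairing d\<phi> psi_op_superposition[OF assms(2) c\<phi>])
      moreover have "system_op c p j superposition \<phi> =
          - inverse \<i> * superposition (partial_deriv (axis j 1, 0) \<phi>) + psi_op (p j) superposition (\<lambda>y. c j (fst y $ j) * \<phi> y)"
        by (simp add: system_op_def distr_deriv_def distr_mult_def case_prod_unfold)
      ultimately have "(\<lambda>k. torus_integral (\<lambda>y. \<epsilon> k * E k y * \<phi> y)) sums system_op c p j superposition \<phi>" by simp
      then show ?thesis using torus_integral_smooth_series[OF sum \<phi>] by (rule sums_unique2)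
    qed
    then show ?thesis
      unfolding smooth_distribution_def by (intro bexI[OF _ smooth_torus_series[OF sum]] ballI)
  qed
  then have "smooth_distribution superposition"
    using assms(3) torus_distribution_superposition by (simp add: globally_hypoelliptic_def)
  then show False using not_smooth_superposition by contradiction
qed

end
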